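(* A measurable function $F:X^{*}\to\mathbb{C}$ on $(X^{*},\mathcal{A}^{*})$ is a stochastic integral if and only if there exists a measurable function $f:X\to\mathbb{C}$ on $(X,\mathcal{A})$ such that, for $\mu\otimes\mu^{*}$-a.e. $(x,\omega)\in X\times X^{*}$, $$(D_{x}F)(\omega)=f(x);$$ in particular, in this case there exists $c\in\mathbb{C}$ such that $F=I(f)+c$ ($\mu^{*}$-a.e.).
   Context: $(X,\mathcal{A},\mu)$ is a non-atomic infinite Borel measure space, i.e. measurably isomorphic to the real line with its Borel sets and Lebesgue measure. Poisson space $(X^{*},\mathcal{A}^{*},\mu^{*})$: $X^{*}$ is the set of measures of the form $\sum_{i\in I}\delta_{x_i}$, $x_i\in X$, $I$ countable; $\mathcal{A}^{*}=\sigma\{N(A): A\in\mathcal{A}\}$ with $N(A)(\omega)=\omega(A)$; $\mu^{*}$ is the unique probability measure such that for pairwise disjoint $A_1,\dots,A_k\in\mathcal{A}$ of finite $\mu$-measure, $N(A_1),\dots,N(A_k)$ are independent and Poisson distributed with parameters $\mu(A_1),\dots,\mu(A_k)$ ($\mathcal{A}^*$ is completed with respect to $\mu^*$). For $f\in L^{1}(\mu)$ write $\mu(f)=\int_X f\,d\mu$ and $N(f)(\omega)=\int_X f\,d\omega$ (defined for $\mu^{*}$-a.e. $\omega$; the same notation $N(g)$ is used for $g$ supported on a set of finite measure). Let $L^{\chi}(\mu)=\{f\in L^{0}(\mu):\int_X \min(|f|^{2},1)\,d\mu<\infty\}$. For $f\in L^{\chi}(\mu)$, $$I(f):=\lim_{\epsilon\to0}\Big(N(f1_{|f|>\epsilon})-\mu(f1_{|f|\le1}1_{|f|>\epsilon})\Big),$$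 the limit being in $\mu^{*}$-measure (it exists). A stochastic integral is a random variable on $(X^{*},\mathcal{A}^{*},\mu^{*})$ of the form $I(f)+c$ with $f\in L^{\chi}(\mu)$ and $c\in\mathbb{C}$ (equality $\mu^*$-a.e.). Difference operator: for measurable $F$ on $(X^{*},\mathcal{A}^{*})$, $(D_xF)(\omega):=F(\omega+\delta_x)-F(\omega)$, a measurable function on $X\times X^{*}$; up to $\mu\otimes\mu^{*}$-null sets it depends only on the $\mu^{*}$-a.e. class of $F$. *)

theory Defs
  imports "HOL-Probability.Probability"
begin

text \<open>
  Measurable isomorphism with the real line carrying its Borel sets and Lebesgue measure.
\<close>

definition iso_real_line :: "'a measure \<Rightarrow> bool" where
  "iso_real_line M \<longleftrightarrow>
     (\<exists>\<phi>. bij_betw \<phi> (space M) (UNIV :: real set) \<and>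
          \<phi> \<in> measurable M lborel \<and>
          the_inv_into (space M) \<phi> \<in> measurable lborel M \<and>
          distr M lborel \<phi> = lborel)"

definition add_measure :: "'a measure \<Rightarrow> 'a measure \<Rightarrow> 'a measure" where
  "add_measure \<omega> \<nu> = measure_of (space \<omega>) (sets \<omega>) (\<lambda>A. emeasure \<omega> A + emeasure \<nu> A)"

definition dirac_sum :: "'a measure \<Rightarrow> nat set \<Rightarrow> (nat \<Rightarrow> 'a) \<Rightarrow> 'a measure" where
  "dirac_sum M I x = measure_of (space M) (sets M)
     (\<lambda>A. \<integral>\<^sup>+ i. emeasure (return M (x i)) A \<partial>count_space I)"

text \<open>
  \<open>measure_of\<close> yields the zero measure unless its last argument is countably additive; the next
  two lemmas show that this does not happen in the definitions above.
\<close>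

lemma emeasure_add_measure:
  assumes "sets \<nu> = sets \<omega>" and A: "A \<in> sets \<omega>"
  shows "emeasure (add_measure \<omega> \<nu>) A = emeasure \<omega> A + emeasure \<nu> A"
proof (rule emeasure_measure_of[OF add_measure_def])
  show "sets \<omega> \<subseteq> Pow (space \<omega>)"
    by (rule sets.space_closed)
  show "A \<in> sets (add_measure \<omega> \<nu>)"
    using A by (simp add: add_measure_def)
  show "positive (sets (add_measure \<omega> \<nu>)) (\<lambda>A. emeasure \<omega> A + emeasure \<nu> A)"
    by (simp add: positive_def)
  show "countably_additive (sets (add_measure \<omega> \<nu>)) (\<lambda>A. emeasure \<omega> A + emeasure \<nu> A)"
  proof (rule countably_additiveI)
    fix B :: "nat \<Rightarrow> 'a set"
    assume B: "range B \<subseteq> sets (add_measure \<omega> \<nu>)" "disjoint_family B"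
    have B': "range B \<subseteq> sets \<omega>" "range B \<subseteq> sets \<nu>"
      using B(1) assms(1) by (simp_all add: add_measure_def)
    show "(\<Sum>i. emeasure \<omega> (B i) + emeasure \<nu> (B i)) =
        emeasure \<omega> (\<Union>i. B i) + emeasure \<nu> (\<Union>i. B i)"
      using suminf_emeasure[OF B'(1) B(2)] suminf_emeasure[OF B'(2) B(2)]
      by (simp add: suminf_add[symmetric])
  qed
qed

lemma emeasure_dirac_sum:
  assumes A: "A \<in> sets M"
  shows "emeasure (dirac_sum M I x) A = emeasure (count_space I) {i \<in> I. x i \<in> A}"
proof -
  have "emeasure (dirac_sum M I x) A = (\<integral>\<^sup>+ i. emeasure (return M (x i)) A \<partial>count_space I)"
  proof (rule emeasure_measure_of[OF dirac_sum_def])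
    show "sets M \<subseteq> Pow (space M)"
      by (rule sets.space_closed)
    show "A \<in> sets (dirac_sum M I x)"
      using A by (simp add: dirac_sum_def)
    show "positive (sets (dirac_sum M I x))
        (\<lambda>A. \<integral>\<^sup>+ i. emeasure (return M (x i)) A \<partial>count_space I)"
      by (simp add: positive_def)
    show "countably_additive (sets (dirac_sum M I x))
        (\<lambda>A. \<integral>\<^sup>+ i. emeasure (return M (x i)) A \<partial>count_space I)"
    proof (rule countably_additiveI)
      fix B :: "nat \<Rightarrow> 'a set"
      assume B: "range B \<subseteq> sets (dirac_sum M I x)" "disjoint_family B"
      have B': "range B \<subseteq> sets (return M (x i))" for i
        using B(1) by (simp add: dirac_sum_def)
      show "(\<Sum>j. \<integral>\<^sup>+ i. emeasure (return M (x i)) (B j) \<partial>count_space I) =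
          (\<integral>\<^sup>+ i. emeasure (return M (x i)) (\<Union>j. B j) \<partial>count_space I)"
        by (simp add: nn_integral_suminf[symmetric] suminf_emeasure[OF B' B(2)])
    qed
  qed
  also have "\<dots> = (\<integral>\<^sup>+ i. indicator {i \<in> I. x i \<in> A} i \<partial>count_space I)"
    using A by (intro nn_integral_cong) (auto simp: indicator_def)
  also have "\<dots> = emeasure (count_space I) {i \<in> I. x i \<in> A}"
    by (rule nn_integral_indicator) simp
  finally show ?thesis .
qed

text \<open>
  The set of countable sums of Dirac masses. Countable index sets are taken to be sets of natural
  numbers; points may be repeated and need not be locally finite.
\<close>

definition configurations :: "'a measure \<Rightarrow> 'a measure set" where
  "configurations M = {dirac_sum M I x | I x. x \<in> I \<rightarrow> space M}"

text \<open>
  A Poisson measure with intensity \<open>M\<close>, on the \<open>\<sigma>\<close>-algebra generated by the counting maps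
  \<open>N(A)\<close> (not yet completed). The conditions determine \<open>P\<close> uniquely when \<open>M\<close> is
  \<open>\<sigma>\<close>-finite. The point probabilities add up to 1, so \<open>N(A)\<close> is almost surely finite when
  \<open>A\<close> has finite measure.
\<close>

definition poisson_measure :: "'a measure \<Rightarrow> 'a measure measure \<Rightarrow> bool" where
  "poisson_measure M P \<longleftrightarrow>
     prob_space P \<and>
     space P = configurations M \<and>
     sets P = sigma_sets (configurations M)
       {(\<lambda>\<omega>. emeasure \<omega> A) -` B \<inter> configurations M | A B.
          A \<in> sets M \<and> B \<in> sets (borel :: ennreal measure)} \<and>
     (\<forall>(k::nat) A. (\<forall>i<k. A i \<in> sets M \<and> emeasure M (A i) < \<infinity>) \<and> disjoint_family_on A {..<k} \<longrightarrow>
        prob_space.indep_vars P (\<lambda>_. borel :: ennreal measure)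
          (\<lambda>i \<omega>. emeasure \<omega> (A i)) {..<k} \<and>
        (\<forall>i<k. \<forall>n::nat.
           measure P {\<omega> \<in> space P. emeasure \<omega> (A i) = of_nat n} =
             exp (- measure M (A i)) * measure M (A i) ^ n / fact n))"

definition L_chi :: "'a measure \<Rightarrow> ('a \<Rightarrow> complex) set" where
  "L_chi M = {f \<in> borel_measurable M. (\<integral>\<^sup>+ x. ennreal (min ((cmod (f x))\<^sup>2) 1) \<partial>M) < \<infinity>}"

definition compensated_integral ::
    "'a measure \<Rightarrow> ('a \<Rightarrow> complex) \<Rightarrow> real \<Rightarrow> 'a measure \<Rightarrow> complex" where
  "compensated_integral M f \<epsilon> \<omega> =
     (\<integral>x. f x * indicator {x. cmod (f x) > \<epsilon>} x \<partial>\<omega>) -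
     (\<integral>x. f x * indicator {x. cmod (f x) \<le> 1} x * indicator {x. cmod (f x) > \<epsilon>} x \<partial>M)"

definition tendsto_in_measure ::
    "'b measure \<Rightarrow> ('i \<Rightarrow> 'b \<Rightarrow> complex) \<Rightarrow> ('b \<Rightarrow> complex) \<Rightarrow> 'i filter \<Rightarrow> bool" where
  "tendsto_in_measure Q X Y F \<longleftrightarrow>
     (\<forall>\<delta>>0. ((\<lambda>i. measure Q {\<omega> \<in> space Q. dist (X i \<omega>) (Y \<omega>) > \<delta>}) \<longlongrightarrow> 0) F)"

text \<open>
  The limit in measure is unique only up to null sets, so \<open>poisson_integral M P f\<close> is an
  arbitrary version of it.
\<close>

definition poisson_integral ::
    "'a measure \<Rightarrow> 'a measure measure \<Rightarrow> ('a \<Rightarrow> complex) \<Rightarrow> 'a measure \<Rightarrow> complex" where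
  "poisson_integral M P f =
     (SOME Y. Y \<in> borel_measurable (completion P) \<and>
        tendsto_in_measure (completion P) (compensated_integral M f) Y (at_right 0))"

definition stochastic_integral ::
    "'a measure \<Rightarrow> 'a measure measure \<Rightarrow> ('a measure \<Rightarrow> complex) \<Rightarrow> bool" where
  "stochastic_integral M P F \<longleftrightarrow>
     F \<in> borel_measurable (completion P) \<and>
     (\<exists>f\<in>L_chi M. \<exists>c. AE \<omega> in completion P. F \<omega> = poisson_integral M P f \<omega> + c)"

definition difference_op ::
    "'a measure \<Rightarrow> ('a measure \<Rightarrow> complex) \<Rightarrow> 'a \<Rightarrow> 'a measure \<Rightarrow> complex" where
  "difference_op M F x \<omega> = F (add_measure \<omega> (return M x)) - F \<omega>"

end

theory Submission
  imports Defs
begin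

text \<open>
  Everything rests on Mecke's formula
  \<open>E \<integral> g x * W \<omega> d\<omega> = \<integral> g x * E (W (\<omega> + \<delta>\<^sub>x)) d\<mu>\<close>, obtained by comparing characteristic functions of
  finitely many counts. If \<open>W\<close> is bounded and \<open>W (\<omega> + \<delta>\<^sub>x) = u x * W \<omega>\<close>, it gives the recursion
  \<open>n * E (W; N A = n) = (\<integral>\<^sub>A u) * E (W; N A = n - 1)\<close>, hence \<open>E W = exp (\<integral>\<^sub>A u) * E (W; N A = 0)\<close>.
  For \<open>W = exp (i t F)\<close> with \<open>D F = f\<close> real this yields
  \<open>\<bar>E W\<bar> \<le> exp (- \<integral>\<^sub>A (1 - cos (t f)))\<close>; as \<open>E W\<close> is close to 1 for small \<open>t\<close>, averaging over \<open>t\<close> shows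
  \<open>\<integral> min (f\<^sup>2) 1 < \<infinity>\<close>. For \<open>D G = 0\<close> and \<open>W = G * exp (i N h)\<close> it shows that \<open>G\<close> times the Poisson
  law has, up to a constant, the characteristic functions of the Poisson law, so \<open>G\<close> is constant; this
  applies to \<open>F - I f\<close> because \<open>D (I f) = f\<close>.
\<close>

section \<open>Configurations and counting variables\<close>

text \<open>No moment of \<open>F\<close> is available, so \<open>F\<close> enters expectations only
  through bounded functionals: \<open>cis (t * F \<omega>)\<close> in the integrability part,
  \<open>arctan\<close> in the constancy part. The event \<open>cnt A \<omega> = 0\<close> left over
  by the recursion is useful for two reasons. Its probability is \<open>exp (- measure M A)\<close>,
  which supplies the \<open>1\<close> in \<open>1 - cos\<close>.

  The other obstacle is measurability. \<open>F\<close> is measurable only for the completed law,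
  while inserting a point is a measurable map from \<open>M \<Otimes>\<^sub>M P\<close> to the
  uncompleted space. Computations are therefore made with versions measurable for \<open>P\<close>.
  Changing the version is harmless because, by Mecke's formula, inserting a point drawn from a set
  of finite measure produces a law absolutely continuous with respect to \<open>P\<close>.
  Convergence in measure is likewise replaced by almost sure convergence along a sequence, which
  persists when a point is inserted.\<close>

lemma emeasure_count_space_cases:
  "emeasure (count_space I) S = \<infinity> \<or> (\<exists>n. emeasure (count_space I) S = of_nat n)"
  if "S \<subseteq> I"
  using that by (cases "finite S") auto

lemma sets_configuration: "\<omega> \<in> configurations M \<Longrightarrow> sets \<omega> = sets M"
  and space_configuration: "\<omega> \<in> configurations M \<Longrightarrow> space \<omega> = space M"
  by (auto simp: configurations_def dirac_sum_def)

text \<open>Masses never lie strictly between integers; later this forces a set of mass below 1 to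
  have mass 0. Non-measurable sets are covered because \<open>emeasure\<close> is 0 on them.\<close>

lemma emeasure_configuration_cases:
  assumes "\<omega> \<in> configurations M"
  shows "emeasure \<omega> A = \<infinity> \<or> (\<exists>n. emeasure \<omega> A = of_nat n)"
proof (cases "A \<in> sets M")
  case True
  obtain I p where "\<omega> = dirac_sum M I p"
    using assms by (auto simp: configurations_def)
  then show ?thesis
    using True emeasure_count_space_cases[of "{i \<in> I. p i \<in> A}" I]
    by (simp add: emeasure_dirac_sum)
next
  case False
  then have "emeasure \<omega> A = 0"
    using assms by (simp add: emeasure_notin_sets sets_configuration)
  then show ?thesis
    by (metis of_nat_0)
qed

lemma sets_add_measure: "sets (add_measure \<omega> \<nu>) = sets \<omega>"
  by (auto simp: add_measure_def sets.space_closed sets.sigma_sets_eq)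

lemma add_return_in_configurations:
  assumes "\<omega> \<in> configurations M" and x: "x \<in> space M"
  shows "add_measure \<omega> (return M x) \<in> configurations M"
proof -
  obtain I p where \<omega>: "\<omega> = dirac_sum M I p" and p: "p \<in> I \<rightarrow> space M"
    using assms(1) by (auto simp: configurations_def)
  \<comment> \<open>Shifting the old indices by one frees the index 0 for the new point, even when
    all natural numbers are already in use.\<close>
  define J q where "J = insert 0 (Suc ` I)" and "q = (\<lambda>i. case i of 0 \<Rightarrow> x | Suc j \<Rightarrow> p j)"
  have "add_measure \<omega> (return M x) = dirac_sum M J q"
  proof (rule measure_eqI)
    show "sets (add_measure \<omega> (return M x)) = sets (dirac_sum M J q)"
      by (simp add: sets_add_measure \<omega>) (simp add: dirac_sum_def)
    fix A assume "A \<in> sets (add_measure \<omega> (return M x))"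
    then have A: "A \<in> sets M" "A \<in> sets \<omega>"
      using sets_configuration[OF assms(1)] by (simp_all add: sets_add_measure)
    have split: "{i \<in> J. q i \<in> A} = Suc ` {i \<in> I. p i \<in> A} \<union> (if x \<in> A then {0} else {})"
      by (auto simp: J_def q_def)
    have "emeasure (count_space J) {i \<in> J. q i \<in> A} =
        emeasure (count_space J) (Suc ` {i \<in> I. p i \<in> A}) +
        emeasure (count_space J) (if x \<in> A then {0} else {})"
      unfolding split by (rule plus_emeasure[symmetric]) (auto simp: J_def)
    also have "emeasure (count_space J) (Suc ` {i \<in> I. p i \<in> A}) =
        emeasure (count_space I) {i \<in> I. p i \<in> A}"
      by (subst (1 2) emeasure_count_space) (auto simp: J_def card_image finite_image_iff)
    also have "emeasure (count_space J) (if x \<in> A then {0} else {}) = indicator A x"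
      by (auto simp: J_def)
    finally show "emeasure (add_measure \<omega> (return M x)) A = emeasure (dirac_sum M J q) A"
      using A assms sets_configuration[OF assms(1)]
      by (simp add: emeasure_add_measure emeasure_dirac_sum \<omega>)
  qed
  moreover have "q \<in> J \<rightarrow> space M"
    using p x by (auto simp: J_def q_def)
  ultimately show ?thesis
    by (auto simp: configurations_def)
qed

text \<open>Natural numbers are wanted for level sets and power series. On configurations the floor
  changes nothing at finite mass; at infinite mass \<open>enn2real\<close> gives 0, so the value 0
  is ambiguous. For \<open>A\<close> of finite measure that case has probability 0.\<close>

definition cnt :: "'a set \<Rightarrow> 'a measure \<Rightarrow> nat" where
  "cnt A \<omega> = nat \<lfloor>enn2real (emeasure \<omega> A)\<rfloor>"

lemma cnt_of_nat: "emeasure \<omega> A = of_nat n \<Longrightarrow> cnt A \<omega> = n"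
  by (simp add: cnt_def)

section \<open>The law of the counts\<close>

locale poisson_space = M: sigma_finite_measure M
  for M :: "'a measure" and P :: "'a measure measure" +
  assumes poisson: "poisson_measure M P"
begin

sublocale P: prob_space P
  using poisson by (simp add: poisson_measure_def)

sublocale MP: pair_sigma_finite M P
  by standard

lemma space_P: "space P = configurations M"
  using poisson by (simp add: poisson_measure_def)

lemma sets_P: "sets P = sigma_sets (configurations M)
    {(\<lambda>\<omega>. emeasure \<omega> A) -` B \<inter> configurations M | A B.
      A \<in> sets M \<and> B \<in> sets (borel :: ennreal measure)}"
  using poisson by (simp add: poisson_measure_def)

lemma emeasure_measurable_P [measurable]:
  assumes "A \<in> sets M"
  shows "(\<lambda>\<omega>. emeasure \<omega> A) \<in> borel_measurable P"
  using assms by (auto simp: measurable_def space_P sets_P intro!: sigma_sets.Basic)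

lemma cnt_measurable [measurable]:
  assumes [measurable]: "A \<in> sets M"
  shows "cnt A \<in> measurable P (count_space UNIV)"
  unfolding cnt_def by measurable

text \<open>On a generator the preimage is the set where
  \<open>emeasure \<omega> A + indicator A x\<close> lies in \<open>B\<close>, a jointly measurable
  condition.\<close>

lemma add_return_measurable:
  "(\<lambda>(x, \<omega>). add_measure \<omega> (return M x)) \<in> measurable (M \<Otimes>\<^sub>M P) P"
proof -
  let ?S = "sigma (configurations M)
      {(\<lambda>\<omega>. emeasure \<omega> A) -` B \<inter> configurations M | A B.
        A \<in> sets M \<and> B \<in> sets (borel :: ennreal measure)}"
  have sets_eq: "sets P = sets ?S"
    by (subst sets_measure_of) (auto simp: sets_P)
  have "(\<lambda>(x, \<omega>). add_measure \<omega> (return M x)) \<in> measurable (M \<Otimes>\<^sub>M P) ?S"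
  proof (rule measurable_measure_of)
    show "(\<lambda>(x, \<omega>). add_measure \<omega> (return M x)) \<in> space (M \<Otimes>\<^sub>M P) \<rightarrow> configurations M"
      by (auto simp: space_pair_measure space_P add_return_in_configurations)
    fix Y assume "Y \<in> {(\<lambda>\<omega>. emeasure \<omega> A) -` B \<inter> configurations M | A B.
        A \<in> sets M \<and> B \<in> sets (borel :: ennreal measure)}"
    then obtain A and B :: "ennreal set"
      where [measurable]: "A \<in> sets M" "B \<in> sets borel"
        and Y: "Y = (\<lambda>\<omega>. emeasure \<omega> A) -` B \<inter> configurations M"
      by auto
    have "(\<lambda>(x, \<omega>). add_measure \<omega> (return M x)) -` Y \<inter> space (M \<Otimes>\<^sub>M P) =
        (\<lambda>(x, \<omega>). emeasure \<omega> A + indicator A x) -` B \<inter> space (M \<Otimes>\<^sub>M P)"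
      by (auto simp: Y space_pair_measure space_P add_return_in_configurations
          emeasure_add_measure sets_configuration)
    also have "\<dots> \<in> sets (M \<Otimes>\<^sub>M P)"
      by measurable
    finally show "(\<lambda>(x, \<omega>). add_measure \<omega> (return M x)) -` Y \<inter> space (M \<Otimes>\<^sub>M P)
        \<in> sets (M \<Otimes>\<^sub>M P)" .
  qed auto
  then show ?thesis
    by (simp only: measurable_cong_sets[OF refl sets_eq])
qed

lemma add_return_measurable_compose [measurable]:
  "f \<in> measurable N M \<Longrightarrow> g \<in> measurable N P \<Longrightarrow>
    (\<lambda>y. add_measure (g y) (return M (f y))) \<in> measurable N P"
  using measurable_compose[OF measurable_Pair add_return_measurable, of f N g] by simp

lemma indep_vars_emeasure:
  assumes "\<forall>i<k. A i \<in> sets M \<and> emeasure M (A i) < \<infinity>" "disjoint_family_on A {..<k}"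
  shows "P.indep_vars (\<lambda>_. borel :: ennreal measure) (\<lambda>i \<omega>. emeasure \<omega> (A i)) {..<k::nat}"
proof -
  from poisson[unfolded poisson_measure_def, THEN conjunct2, THEN conjunct2, THEN conjunct2,
    THEN spec, of k, THEN spec, of A] assms
  show ?thesis
    by (elim impE conjE) (intro conjI)
qed

lemma prob_emeasure_eq:
  assumes "A \<in> fmeasurable M"
  shows "measure P {\<omega> \<in> space P. emeasure \<omega> A = of_nat n} =
    exp (- measure M A) * measure M A ^ n / fact n"
proof -
  from poisson[unfolded poisson_measure_def, THEN conjunct2, THEN conjunct2, THEN conjunct2,
    THEN spec, of "Suc 0", THEN spec, of "\<lambda>_. A"] assms
  have "\<forall>i<Suc 0. \<forall>n. measure P {\<omega> \<in> space P. emeasure \<omega> A = of_nat n} =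
      exp (- measure M A) * measure M A ^ n / fact n"
    by (elim impE conjE) (auto simp: fmeasurable_def disjoint_family_on_def)
  then show ?thesis
    by auto
qed

text \<open>By the exponential series the Poisson weights of the finite values already add up to 1,
  so no probability is left for infinite mass.\<close>

lemma AE_emeasure_eq_cnt:
  assumes A: "A \<in> fmeasurable M"
  shows "AE \<omega> in P. emeasure \<omega> A = of_nat (cnt A \<omega>)"
proof -
  note [measurable] = fmeasurableD[OF A]
  define E where "E = (\<lambda>n::nat. {\<omega> \<in> space P. emeasure \<omega> A = of_nat n})"
  have [measurable]: "E n \<in> sets P" for n
    unfolding E_def by measurable
  have "(\<lambda>n. measure P (E n)) sums measure P (\<Union>n. E n)"
    by (rule P.finite_measure_UNION) (auto simp: disjoint_family_on_def E_def)
  moreover have "(\<lambda>n. measure P (E n)) sums 1"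
  proof -
    have "(\<lambda>n. exp (- measure M A) * (measure M A ^ n /\<^sub>R fact n)) sums
        (exp (- measure M A) * exp (measure M A))"
      by (intro sums_mult exp_converges)
    then show ?thesis
      by (simp add: E_def prob_emeasure_eq[OF A] exp_minus divide_inverse mult_ac)
  qed
  ultimately have "measure P (\<Union>n. E n) = 1"
    by (rule sums_unique2)
  then have "AE \<omega> in P. \<omega> \<in> (\<Union>n. E n)"
    by (subst P.AE_in_set_eq_1) auto
  then show ?thesis
    by eventually_elim (auto simp: E_def cnt_of_nat)
qed

lemma AE_emeasure_finite:
  assumes "A \<in> fmeasurable M"
  shows "AE \<omega> in P. emeasure \<omega> A < \<infinity>"
  using AE_emeasure_eq_cnt[OF assms]
  by eventually_elim (simp add: less_top[symmetric])

lemma prob_cnt_eq: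
  assumes A: "A \<in> fmeasurable M"
  shows "measure P {\<omega> \<in> space P. cnt A \<omega> = n} = exp (- measure M A) * measure M A ^ n / fact n"
proof -
  note [measurable] = fmeasurableD[OF A]
  have "measure P {\<omega> \<in> space P. cnt A \<omega> = n} =
      measure P {\<omega> \<in> space P. emeasure \<omega> A = of_nat n}"
  proof (rule P.finite_measure_eq_AE)
    show "AE \<omega> in P. (\<omega> \<in> {\<omega> \<in> space P. cnt A \<omega> = n}) =
        (\<omega> \<in> {\<omega> \<in> space P. emeasure \<omega> A = of_nat n})"
      using AE_emeasure_eq_cnt[OF A] by eventually_elim simp
  qed measurable
  then show ?thesis
    by (simp add: prob_emeasure_eq[OF A])
qed

text \<open>Finite mass is essential: at infinite mass \<open>cnt\<close> is 0 both before and after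
  the insertion of a point of \<open>A\<close>.\<close>

lemma cnt_add_return:
  assumes "\<omega> \<in> space P" "x \<in> space M" "A \<in> sets M" "emeasure \<omega> A < \<infinity>"
  shows "cnt A (add_measure \<omega> (return M x)) = cnt A \<omega> + indicator A x"
proof -
  obtain n where "emeasure \<omega> A = of_nat n"
    using assms emeasure_configuration_cases[of \<omega> M A] by (auto simp: space_P)
  then show ?thesis
    using assms
    by (auto simp: emeasure_add_measure space_P sets_configuration indicator_def cnt_of_nat
        intro!: cnt_of_nat)
qed

text \<open>\<open>poisson_measure\<close> speaks of families indexed by an initial segment of the
  natural numbers; a bijection carries the independence to any finite index set.\<close>

lemma expectation_prod_cnt:
  fixes g :: "'i \<Rightarrow> nat \<Rightarrow> complex"
  assumes "finite I" and dj: "disjoint_family_on A I" and A: "\<And>i. i \<in> I \<Longrightarrow> A i \<in> fmeasurable M"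
    and g: "\<And>i. i \<in> I \<Longrightarrow> integrable P (\<lambda>\<omega>. g i (cnt (A i) \<omega>))"
  shows "(\<integral>\<omega>. (\<Prod>i\<in>I. g i (cnt (A i) \<omega>)) \<partial>P) = (\<Prod>i\<in>I. \<integral>\<omega>. g i (cnt (A i) \<omega>) \<partial>P)"
proof -
  obtain h where h: "bij_betw h {..<card I} I"
    using \<open>finite I\<close> ex_bij_betw_nat_finite atLeast0LessThan by metis
  then have inj: "inj_on h {..<card I}" and img: "h ` {..<card I} = I"
    by (auto simp: bij_betw_def)
  have 1: "disjoint_family_on (\<lambda>i. A (h i)) {..<card I}"
    using dj inj img unfolding disjoint_family_on_def inj_on_def by blast
  have 2: "\<forall>i<card I. A (h i) \<in> sets M \<and> emeasure M (A (h i)) < \<infinity>"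
    using A img by (auto simp: fmeasurable_def)
  have "P.indep_vars (\<lambda>_. borel) (\<lambda>i \<omega>. emeasure \<omega> (A (h i))) {..<card I}"
    by (rule indep_vars_emeasure[OF 2 1])
  then have "P.indep_vars (\<lambda>_. borel)
      (\<lambda>i \<omega>. g (h i) (nat \<lfloor>enn2real (emeasure \<omega> (A (h i)))\<rfloor>)) {..<card I}"
    by (rule P.indep_vars_compose2) measurable
  then have "P.indep_vars (\<lambda>_. borel) (\<lambda>i \<omega>. g (h i) (cnt (A (h i)) \<omega>)) {..<card I}"
    by (simp add: cnt_def[abs_def])
  then have "(\<integral>\<omega>. (\<Prod>i<card I. g (h i) (cnt (A (h i)) \<omega>)) \<partial>P) =
      (\<Prod>i<card I. \<integral>\<omega>. g (h i) (cnt (A (h i)) \<omega>) \<partial>P)"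
    using g img by (intro P.indep_vars_lebesgue_integral) auto
  then show ?thesis
    by (simp only: prod.reindex_bij_betw[OF h, of "\<lambda>i. g i (cnt (A i) \<omega>)" for \<omega>]
      prod.reindex_bij_betw[OF h, of "\<lambda>i. \<integral>\<omega>. g i (cnt (A i) \<omega>) \<partial>P"])
qed

end

section \<open>Characteristic functions determine the law\<close>

text \<open>The mean of the \<open>d\<close>-th powers of the \<open>m\<close>-th roots of unity is
  1 if \<open>m\<close> divides \<open>d\<close> and 0 otherwise. Once
  \<open>m > \<bar>d\<bar>\<close>, divisibility means \<open>d = 0\<close>, so the sequence is
  eventually constant.\<close>

lemma average_unit_roots_tendsto:
  fixes d :: int
  shows "(\<lambda>m. (\<Sum>k<m. cis (2 * pi * real k * d / real m)) / of_nat m) \<longlonglongrightarrow> of_bool (d = 0)"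
proof (rule tendsto_eventually)
  show "\<forall>\<^sub>F m in sequentially. (\<Sum>k<m. cis (2 * pi * real k * d / real m)) / of_nat m = of_bool (d = 0)"
    using eventually_gt_at_top[of "nat \<bar>d\<bar>"]
  proof eventually_elim
    case (elim m)
    then have m: "m > 0" "\<bar>d\<bar> < int m"
      by auto
    define z where "z = cis (2 * pi * d / real m)"
    have pow: "cis (2 * pi * real k * d / real m) = z ^ k" for k
      unfolding z_def Complex.DeMoivre by (rule arg_cong[where f=cis]) (simp add: field_simps)
    show ?case
    proof (cases "d = 0")
      case True
      then show ?thesis
        using m by simp
    next
      case False
      have "z \<noteq> 1"
      proof
        assume "z = 1"
        then have "cos (2 * pi * d / real m) = 1"
          by (simp add: z_def complex_eq_iff)
        then obtain j :: int where "2 * pi * d / real m = j * 2 * pi"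
          by (auto simp: cos_one_2pi_int)
        then have "real_of_int d = real_of_int (j * int m)"
          using m by (simp add: field_simps)
        then have "d = j * int m"
          by (simp only: of_int_eq_iff)
        then have "int m \<le> \<bar>d\<bar>"
          using False by (auto simp: abs_mult)
        then show False
          using m by simp
      qed
      moreover have "z ^ m = 1"
        using m by (simp add: z_def Complex.DeMoivre complex_eq_iff cos_int_2pin sin_int_2pin)
      ultimately show ?thesis
        using False by (simp add: pow geometric_sum)
    qed
  qed
qed

lemma borel_measurable_cis [measurable]: "cis \<in> borel_measurable borel"
  by (intro borel_measurable_continuous_onI continuous_intros)

text \<open>The exponents of the characteristic functions. A list lets a further set be prepended
  without asking whether it overlaps or repeats earlier ones.\<close>

definition lin :: "(real \<times> 'a set) list \<Rightarrow> 'a measure \<Rightarrow> real" where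
  "lin xs \<omega> = (\<Sum>(a, B)\<leftarrow>xs. a * real (cnt B \<omega>))"

lemma lin_simps [simp]:
  "lin [] \<omega> = 0" "lin ((a, B) # xs) \<omega> = a * real (cnt B \<omega>) + lin xs \<omega>"
  by (simp_all add: lin_def)

section \<open>Finite measures are determined by linear combinations of counts\<close>

context poisson_space
begin

lemma lin_measurable [measurable]:
  assumes "snd ` set xs \<subseteq> fmeasurable M"
  shows "lin xs \<in> borel_measurable P"
  using assms
proof (induction xs)
  case (Cons x xs)
  obtain a B where x: "x = (a, B)"
    by force
  have [measurable]: "B \<in> sets M" "lin xs \<in> borel_measurable P"
    using Cons by (auto simp: x)
  have "lin (x # xs) = (\<lambda>\<omega>. a * real (cnt B \<omega>) + lin xs \<omega>)"
    by (auto simp: x)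
  then show ?case
    by simp
qed (simp add: lin_def[abs_def])

lemma pred_cnt_eq_list:
  assumes "fst ` set ys \<subseteq> fmeasurable M"
  shows "Measurable.pred P (\<lambda>\<omega>. \<forall>(B, n)\<in>set ys. cnt B \<omega> = n)"
  using assms
proof (induction ys)
  case (Cons y ys)
  obtain B n where y: "y = (B, n)"
    by force
  have [measurable]: "B \<in> sets M" "Measurable.pred P (\<lambda>\<omega>. \<forall>(B, n)\<in>set ys. cnt B \<omega> = n)"
    using Cons by (auto simp: y)
  have "(\<lambda>\<omega>. \<forall>(B, n)\<in>set (y # ys). cnt B \<omega> = n) =
      (\<lambda>\<omega>. cnt B \<omega> = n \<and> (\<forall>(B, n)\<in>set ys. cnt B \<omega> = n))"
    by (auto simp: y)
  then show ?case
    by simp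
qed simp

text \<open>Fourier inversion in one integer variable: the frequencies
  \<open>2 * pi * k / m\<close>, weighted against \<open>n\<close> and averaged over
  \<open>k\<close>, turn the exponential of \<open>cnt B\<close> into the event
  \<open>cnt B \<omega> = n\<close>. All integrands are bounded by 1, so the pointwise limit passes
  through the integral over the finite measure \<open>Q\<close>.\<close>

lemma integral_cis_lin_tendsto:
  fixes Q :: "'a measure measure"
  assumes "finite_measure Q" and Q: "sets Q = sets P"
    and xs: "snd ` set xs \<subseteq> fmeasurable M" and B: "B \<in> fmeasurable M"
    and R [measurable]: "Measurable.pred P R"
  shows "(\<lambda>m. (\<Sum>k<m. cis (- (2 * pi * real k * real n / real m)) *
        (\<integral>\<omega>. cis (lin ((2 * pi * real k / real m, B) # xs) \<omega>) * of_bool (R \<omega>) \<partial>Q)) / of_nat m)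
      \<longlonglongrightarrow> (\<integral>\<omega>. cis (lin xs \<omega>) * of_bool (cnt B \<omega> = n \<and> R \<omega>) \<partial>Q)"
proof -
  interpret Q: finite_measure Q by fact
  note [measurable_cong] = Q
  note [measurable] = lin_measurable[OF xs] fmeasurableD[OF B]
  define s where "s m \<omega> = cis (lin xs \<omega>) * of_bool (R \<omega>) *
      ((\<Sum>k<m. cis (2 * pi * real k * (int (cnt B \<omega>) - int n) / real m)) / of_nat m)" for m \<omega>
  have int: "integrable Q (\<lambda>\<omega>. cis (lin ((a, B) # xs) \<omega>) * of_bool (R \<omega>))" for a
    by (rule Q.integrable_const_bound[where B=1]) (auto simp: norm_mult)
  have s: "s m \<omega> = (\<Sum>k<m. cis (- (2 * pi * real k * real n / real m)) *
        (cis (lin ((2 * pi * real k / real m, B) # xs) \<omega>) * of_bool (R \<omega>))) / of_nat m" for m \<omega>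
  proof -
    have "cis (2 * pi * real k * (int (cnt B \<omega>) - int n) / real m) =
        cis (- (2 * pi * real k * real n / real m)) * cis (2 * pi * real k / real m * real (cnt B \<omega>))" for k
      unfolding cis_mult by (rule arg_cong[where f=cis]) (simp add: field_simps diff_divide_distrib)
    then show ?thesis
      unfolding s_def by (simp add: sum_distrib_left sum_divide_distrib cis_mult[symmetric] mult_ac)
  qed
  have "(\<lambda>m. \<integral>\<omega>. s m \<omega> \<partial>Q) \<longlonglongrightarrow>
      (\<integral>\<omega>. cis (lin xs \<omega>) * of_bool (R \<omega>) * of_bool (int (cnt B \<omega>) - int n = 0) \<partial>Q)"
  proof (rule integral_dominated_convergence[where w="\<lambda>_. 1"])
    show "AE \<omega> in Q. (\<lambda>m. s m \<omega>) \<longlonglongrightarrow>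
        cis (lin xs \<omega>) * of_bool (R \<omega>) * of_bool (int (cnt B \<omega>) - int n = 0)"
      unfolding s_def by (intro AE_I2 tendsto_mult tendsto_const average_unit_roots_tendsto)
    show "AE \<omega> in Q. norm (s m \<omega>) \<le> 1" for m
    proof (rule AE_I2)
      fix \<omega>
      have "norm (\<Sum>k<m. cis (2 * pi * real k * (int (cnt B \<omega>) - int n) / real m)) \<le> real m"
        by (rule order_trans[OF norm_sum]) simp
      then show "norm (s m \<omega>) \<le> 1"
        by (auto simp: s_def norm_mult norm_divide divide_le_eq_1)
    qed
    show "s m \<in> borel_measurable Q" for m
      unfolding s_def by measurable
  qed auto
  also have "(\<lambda>m. \<integral>\<omega>. s m \<omega> \<partial>Q) = (\<lambda>m. (\<Sum>k<m. cis (- (2 * pi * real k * real n / real m)) *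
        (\<integral>\<omega>. cis (lin ((2 * pi * real k / real m, B) # xs) \<omega>) * of_bool (R \<omega>) \<partial>Q)) / of_nat m)"
    unfolding s using int by (simp add: integral_sum del: lin_simps)
  also have "(\<integral>\<omega>. cis (lin xs \<omega>) * of_bool (R \<omega>) * of_bool (int (cnt B \<omega>) - int n = 0) \<partial>Q) =
      (\<integral>\<omega>. cis (lin xs \<omega>) * of_bool (cnt B \<omega> = n \<and> R \<omega>) \<partial>Q)"
    by (rule Bochner_Integration.integral_cong) auto
  finally show ?thesis .
qed

text \<open>The generator is reduced to a family closed under intersections, using finitely many
  sets of finite measure and finite values only. Infinite mass is the complement of the countably
  many finite values, and an arbitrary set is the increasing union of parts of finite
  measure.\<close>

lemma sets_P_cylinders:
  "sets P = sigma_sets (space P)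
    {{\<omega> \<in> space P. \<forall>(B, n)\<in>set ys. emeasure \<omega> B = of_nat n} | ys. fst ` set ys \<subseteq> fmeasurable M}"
  (is "_ = sigma_sets _ ?E")
proof
  show "sets P \<subseteq> sigma_sets (space P) ?E"
  proof -
    define S where "S = sigma (space P) ?E"
    have E_sub: "?E \<subseteq> Pow (space P)"
      by auto
    have S: "space S = space P" "sets S = sigma_sets (space P) ?E"
      using E_sub by (simp_all add: S_def)
    have fin: "(\<lambda>\<omega>. emeasure \<omega> A) \<in> borel_measurable S" if A: "A \<in> fmeasurable M" for A
    proof -
      define D where "D n = {\<omega> \<in> space P. emeasure \<omega> A = of_nat n}" for n :: nat
      have "D n \<in> ?E" for n
        using A by (auto simp: D_def intro!: exI[of _ "[(A, n)]"])
      then have D [measurable]: "D n \<in> sets S" for n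
        by (auto simp: S)
      \<comment> \<open>The supremum has at most one nonzero term, so it reads off the value from
        the level sets.\<close>
      have "emeasure \<omega> A = (if \<omega> \<in> (\<Union>n. D n) then (SUP n. if \<omega> \<in> D n then of_nat n else 0) else \<infinity>)"
        if "\<omega> \<in> space S" for \<omega>
      proof (cases "\<omega> \<in> (\<Union>n. D n)")
        case True
        then obtain m where m: "\<omega> \<in> D m" by auto
        then have eq: "(if \<omega> \<in> D n then of_nat n else 0) = (if n = m then of_nat m else 0 :: ennreal)" for n
          by (auto simp: D_def)
        have "(SUP n. if \<omega> \<in> D n then of_nat n else 0 :: ennreal) = of_nat m"
          unfolding eq by (intro antisym SUP_least SUP_upper2[of m]) auto
        then show ?thesis
          using True m by (simp add: D_def)
      next
        case False
        then show ?thesis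
          using that emeasure_configuration_cases[of \<omega> M A] by (auto simp: S D_def space_P)
      qed
      then show ?thesis
        by (subst measurable_cong) (simp, measurable)
    qed
    have "(\<lambda>\<omega>. emeasure \<omega> A) \<in> borel_measurable S" if A: "A \<in> sets M" for A
    proof -
      obtain X :: "nat \<Rightarrow> 'a set" where X: "range X \<subseteq> sets M" "(\<Union>i. X i) = space M"
        "\<And>i. emeasure M (X i) \<noteq> \<infinity>" "incseq X"
        by (rule M.sigma_finite_incseq) blast
      have "X i \<in> fmeasurable M" for i
        using X by (auto simp: fmeasurable_def top.not_eq_extremum)
      then have AX: "A \<inter> X i \<in> fmeasurable M" for i
        using A by (metis fmeasurable_Int_fmeasurable inf_commute)
      have "emeasure \<omega> A = (SUP i. emeasure \<omega> (A \<inter> X i))" if "\<omega> \<in> space S" for \<omega>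
      proof -
        have "sets \<omega> = sets M"
          using that by (simp add: S space_P sets_configuration)
        then have "(SUP i. emeasure \<omega> (A \<inter> X i)) = emeasure \<omega> (\<Union>i. A \<inter> X i)"
          using X A by (intro SUP_emeasure_incseq) (auto simp: incseq_def subset_eq)
        also have "(\<Union>i. A \<inter> X i) = A"
          using X(2) sets.sets_into_space[OF A] by auto
        finally show ?thesis by simp
      qed
      then show ?thesis
        using fin[OF AX] by (subst measurable_cong) auto
    qed
    then have "(\<lambda>\<omega>. emeasure \<omega> A) -` B \<inter> configurations M \<in> sigma_sets (space P) ?E"
      if "A \<in> sets M" "B \<in> sets (borel :: ennreal measure)" for A B
      using measurable_sets[of "\<lambda>\<omega>. emeasure \<omega> A" S borel B] that by (simp add: S space_P)
    then show ?thesis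
      unfolding sets_P
      by (subst space_P[symmetric], intro sigma_algebra.sigma_sets_subset[OF sigma_algebra_sigma_sets[OF E_sub]]) auto
  qed
next
  have "{\<omega> \<in> space P. \<forall>(B, n)\<in>set ys. emeasure \<omega> B = of_nat n} \<in> sets P"
    if "fst ` set ys \<subseteq> fmeasurable M" for ys :: "('a set \<times> nat) list"
    using that
  proof (induction ys)
    case (Cons y ys)
    obtain B n where y: "y = (B, n)"
      by force
    have [measurable]: "B \<in> sets M"
      using Cons by (auto simp: y)
    have "{\<omega> \<in> space P. emeasure \<omega> B = of_nat n} \<inter>
        {\<omega> \<in> space P. \<forall>(B, n)\<in>set ys. emeasure \<omega> B = of_nat n} \<in> sets P"
      using Cons by (intro sets.Int) auto
    also have "{\<omega> \<in> space P. emeasure \<omega> B = of_nat n} \<inter>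
        {\<omega> \<in> space P. \<forall>(B, n)\<in>set ys. emeasure \<omega> B = of_nat n} =
        {\<omega> \<in> space P. \<forall>(B, n)\<in>set (y # ys). emeasure \<omega> B = of_nat n}"
      by (auto simp: y)
    finally show ?case .
  qed simp
  then show "sigma_sets (space P) ?E \<subseteq> sets P"
    by (intro sets.sigma_sets_subset) auto
qed

text \<open>Conditions \<open>cnt B \<omega> = n\<close> are traded one at a time for exponentials
  by the averaging limit, down to the assumed equality; the exponent grows in exchange, hence the
  induction is general in \<open>xs\<close>. Since \<open>cnt\<close> cannot tell mass 0 from
  infinite mass, finiteness almost everywhere under both measures is used to compare the
  cylinders.\<close>

lemma measure_eqI_characteristic:
  fixes Q1 Q2 :: "'a measure measure"
  assumes fin: "finite_measure Q1" "finite_measure Q2"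
    and sets: "sets Q1 = sets P" "sets Q2 = sets P"
    and AE1: "\<And>B. B \<in> fmeasurable M \<Longrightarrow> AE \<omega> in Q1. emeasure \<omega> B < \<infinity>"
    and AE2: "\<And>B. B \<in> fmeasurable M \<Longrightarrow> AE \<omega> in Q2. emeasure \<omega> B < \<infinity>"
    and eq: "\<And>xs. snd ` set xs \<subseteq> fmeasurable M \<Longrightarrow>
      (\<integral>\<omega>. cis (lin xs \<omega>) \<partial>Q1) = (\<integral>\<omega>. cis (lin xs \<omega>) \<partial>Q2)"
  shows "Q1 = Q2"
proof -
  have *: "(\<integral>\<omega>. cis (lin xs \<omega>) * of_bool (\<forall>(B, n)\<in>set ys. cnt B \<omega> = n) \<partial>Q1) =
      (\<integral>\<omega>. cis (lin xs \<omega>) * of_bool (\<forall>(B, n)\<in>set ys. cnt B \<omega> = n) \<partial>Q2)"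
    if "snd ` set xs \<subseteq> fmeasurable M" "fst ` set ys \<subseteq> fmeasurable M" for xs ys
    using that
  proof (induction ys arbitrary: xs)
    case Nil
    then show ?case by (simp add: eq)
  next
    case (Cons y ys)
    obtain B n where y: "y = (B, n)"
      by force
    have B: "B \<in> fmeasurable M" and ys: "fst ` set ys \<subseteq> fmeasurable M"
      using Cons.prems by (auto simp: y)
    have IH: "(\<integral>\<omega>. cis (lin ((a, B) # xs) \<omega>) * of_bool (\<forall>(B, n)\<in>set ys. cnt B \<omega> = n) \<partial>Q1) =
      (\<integral>\<omega>. cis (lin ((a, B) # xs) \<omega>) * of_bool (\<forall>(B, n)\<in>set ys. cnt B \<omega> = n) \<partial>Q2)" for a
      using Cons.prems B ys by (intro Cons.IH) auto
    note lim = integral_cis_lin_tendsto[OF _ _ Cons.prems(1) B pred_cnt_eq_list[OF ys], of _ n]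
    have "(\<integral>\<omega>. cis (lin xs \<omega>) * of_bool (cnt B \<omega> = n \<and> (\<forall>(B, n)\<in>set ys. cnt B \<omega> = n)) \<partial>Q1) =
        (\<integral>\<omega>. cis (lin xs \<omega>) * of_bool (cnt B \<omega> = n \<and> (\<forall>(B, n)\<in>set ys. cnt B \<omega> = n)) \<partial>Q2)"
      using lim[OF fin(1) sets(1)] lim[OF fin(2) sets(2)] unfolding IH by (rule LIMSEQ_unique)
    then show ?case
      by (simp add: y)
  qed
  have cyl: "emeasure Q {\<omega> \<in> space P. \<forall>(B, n)\<in>set ys. emeasure \<omega> B = of_nat n} =
      ennreal (Re (\<integral>\<omega>. cis (lin [] \<omega>) * of_bool (\<forall>(B, n)\<in>set ys. cnt B \<omega> = n) \<partial>Q))"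
    if "finite_measure Q" and Q: "sets Q = sets P" and
      AE: "\<And>B. B \<in> fmeasurable M \<Longrightarrow> AE \<omega> in Q. emeasure \<omega> B < \<infinity>"
      and ys: "fst ` set ys \<subseteq> fmeasurable M" for Q ys
  proof -
    interpret Q: finite_measure Q by fact
    have [simp]: "space Q = space P"
      using Q by (rule sets_eq_imp_space_eq)
    have m: "{\<omega> \<in> space P. \<forall>(B, n)\<in>set ys. cnt B \<omega> = n} \<in> sets Q"
      using pred_cnt_eq_list[OF ys] by (simp add: Q pred_def)
    have "{\<omega> \<in> space P. \<forall>(B, n)\<in>set ys. emeasure \<omega> B = of_nat n} \<in> sigma_sets (space P)
    {{\<omega> \<in> space P. \<forall>(B, n)\<in>set ys. emeasure \<omega> B = of_nat n} | ys. fst ` set ys \<subseteq> fmeasurable M}"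
      using ys by (intro sigma_sets.Basic) auto
    then have m': "{\<omega> \<in> space P. \<forall>(B, n)\<in>set ys. emeasure \<omega> B = of_nat n} \<in> sets Q"
      by (simp add: Q sets_P_cylinders)
    have "AE \<omega> in Q. \<forall>(B, n)\<in>set ys. emeasure \<omega> B < \<infinity>"
      using ys AE by (intro AE_finite_allI) auto
    then have "AE \<omega> in Q. (\<forall>(B, n)\<in>set ys. emeasure \<omega> B = of_nat n) \<longleftrightarrow>
        (\<forall>(B, n)\<in>set ys. cnt B \<omega> = n)"
      using AE_space[of Q]
    proof eventually_elim
      case (elim \<omega>)
      have "emeasure \<omega> B = of_nat n \<longleftrightarrow> cnt B \<omega> = n" if "(B, n) \<in> set ys" for B n
        using elim that emeasure_configuration_cases[of \<omega> M B] by (auto simp: space_P dest: cnt_of_nat)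
      then show ?case
        by auto
    qed
    then have "emeasure Q {\<omega> \<in> space P. \<forall>(B, n)\<in>set ys. emeasure \<omega> B = of_nat n} =
        emeasure Q {\<omega> \<in> space P. \<forall>(B, n)\<in>set ys. cnt B \<omega> = n}"
      by (intro emeasure_eq_AE m m') auto
    also have "\<dots> = ennreal (\<integral>\<omega>. indicator {\<omega> \<in> space P. \<forall>(B, n)\<in>set ys. cnt B \<omega> = n} \<omega> \<partial>Q)"
      using m by (simp add: Q.emeasure_eq_measure Int_absorb2)
    also have "(\<integral>\<omega>. indicator {\<omega> \<in> space P. \<forall>(B, n)\<in>set ys. cnt B \<omega> = n} \<omega> \<partial>Q) =
        Re (\<integral>\<omega>. complex_of_real (indicator {\<omega> \<in> space P. \<forall>(B, n)\<in>set ys. cnt B \<omega> = n} \<omega>) \<partial>Q)"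
      by simp
    also have "(\<integral>\<omega>. complex_of_real (indicator {\<omega> \<in> space P. \<forall>(B, n)\<in>set ys. cnt B \<omega> = n} \<omega>) \<partial>Q) =
        (\<integral>\<omega>. cis (lin [] \<omega>) * of_bool (\<forall>(B, n)\<in>set ys. cnt B \<omega> = n) \<partial>Q)"
      by (rule Bochner_Integration.integral_cong) (auto simp: indicator_def)
    finally show ?thesis .
  qed
  show ?thesis
  proof (rule measure_eqI_generator_eq[where \<Omega>="space P" and A="\<lambda>_. space P" and
    E="{{\<omega> \<in> space P. \<forall>(B, n)\<in>set ys. emeasure \<omega> B = of_nat n} | ys. fst ` set ys \<subseteq> fmeasurable M}"])
    show "Int_stable {{\<omega> \<in> space P. \<forall>(B, n)\<in>set ys. emeasure \<omega> B = of_nat n} | ys.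
        fst ` set ys \<subseteq> fmeasurable M}"
    proof (rule Int_stableI, safe)
      fix xs ys :: "('a set \<times> nat) list"
      assume "fst ` set xs \<subseteq> fmeasurable M" "fst ` set ys \<subseteq> fmeasurable M"
      then show "\<exists>zs. {\<omega> \<in> space P. \<forall>(B, n)\<in>set xs. emeasure \<omega> B = of_nat n} \<inter>
          {\<omega> \<in> space P. \<forall>(B, n)\<in>set ys. emeasure \<omega> B = of_nat n} =
          {\<omega> \<in> space P. \<forall>(B, n)\<in>set zs. emeasure \<omega> B = of_nat n} \<and> fst ` set zs \<subseteq> fmeasurable M"
        by (intro exI[of _ "xs @ ys"]) auto
    qed
    show "range (\<lambda>_. space P) \<subseteq> {{\<omega> \<in> space P. \<forall>(B, n)\<in>set ys. emeasure \<omega> B = of_nat n} | ys.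
        fst ` set ys \<subseteq> fmeasurable M}"
      by (auto intro!: exI[of _ "[]"])
    show "emeasure Q1 X = emeasure Q2 X"
      if "X \<in> {{\<omega> \<in> space P. \<forall>(B, n)\<in>set ys. emeasure \<omega> B = of_nat n} | ys.
        fst ` set ys \<subseteq> fmeasurable M}" for X
      using that cyl[OF fin(1) sets(1) AE1] cyl[OF fin(2) sets(2) AE2] *[of "[]"] by auto
    show "emeasure Q1 (space P) \<noteq> \<infinity>"
      using finite_measure.emeasure_finite[OF fin(1)] by simp
  qed (auto simp: sets sets_P_cylinders)
qed

end

section \<open>Moments of the counts\<close>

text \<open>As \<open>W\<close> is complex, dominated convergence with majorant
  \<open>norm (W \<omega>)\<close> takes the place of countable additivity.\<close>

lemma integral_level_sets_sums:
  fixes W :: "'b \<Rightarrow> complex" and X :: "'b \<Rightarrow> nat"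
  assumes X [measurable]: "X \<in> measurable N (count_space UNIV)" and W: "integrable N W"
  shows "(\<lambda>n. \<integral>\<omega>. W \<omega> * of_bool (X \<omega> = n) \<partial>N) sums (\<integral>\<omega>. W \<omega> \<partial>N)"
proof -
  note [measurable] = borel_measurable_integrable[OF W]
  have int: "integrable N (\<lambda>\<omega>. W \<omega> * of_bool (X \<omega> = n))" for n
    using W by (rule Bochner_Integration.integrable_bound) auto
  have "(\<lambda>m. \<integral>\<omega>. W \<omega> * of_bool (X \<omega> < m) \<partial>N) \<longlonglongrightarrow> (\<integral>\<omega>. W \<omega> \<partial>N)"
  proof (rule integral_dominated_convergence[where w="\<lambda>\<omega>. norm (W \<omega>)"])
    show "AE \<omega> in N. (\<lambda>m. W \<omega> * of_bool (X \<omega> < m)) \<longlonglongrightarrow> W \<omega>"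
    proof (rule AE_I2, rule tendsto_eventually)
      show "\<forall>\<^sub>F m in sequentially. W \<omega> * of_bool (X \<omega> < m) = W \<omega>" for \<omega>
        using eventually_gt_at_top[of "X \<omega>"] by eventually_elim simp
    qed
  qed (use W in auto)
  also have "(\<lambda>m. \<integral>\<omega>. W \<omega> * of_bool (X \<omega> < m) \<partial>N) =
      (\<lambda>m. \<Sum>n<m. \<integral>\<omega>. W \<omega> * of_bool (X \<omega> = n) \<partial>N)"
  proof
    fix m
    have eq: "W \<omega> * of_bool (X \<omega> < m) = (\<Sum>n<m. W \<omega> * of_bool (X \<omega> = n))" for \<omega>
      by (auto simp: sum_distrib_left[symmetric] of_bool_def if_distrib sum.If_cases)
    show "(\<integral>\<omega>. W \<omega> * of_bool (X \<omega> < m) \<partial>N) = (\<Sum>n<m. \<integral>\<omega>. W \<omega> * of_bool (X \<omega> = n) \<partial>N)"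
      unfolding eq using int by (rule Bochner_Integration.integral_sum)
  qed
  finally show ?thesis
    by (simp add: sums_def)
qed

text \<open>This is the unnormalised mean of a Poisson law. Complex \<open>z\<close> is allowed
  because the factor \<open>cis (b * n)\<close> will be absorbed into the \<open>n\<close>-th
  power.\<close>

lemma sums_of_nat_exp:
  fixes z :: "'b :: {real_normed_field, banach}"
  shows "(\<lambda>n. of_nat n * (z ^ n / fact n)) sums (z * exp z)"
proof -
  have "(\<lambda>n. z * (z ^ n /\<^sub>R fact n)) sums (z * exp z)"
    by (intro sums_mult exp_converges)
  also have "(\<lambda>n. z * (z ^ n /\<^sub>R fact n)) = (\<lambda>n. of_nat (Suc n) * (z ^ Suc n / fact (Suc n)))"
  proof
    fix n
    have "of_nat (Suc n) * (z ^ Suc n / fact (Suc n)) = z ^ Suc n / fact n"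
      by (simp del: of_nat_Suc add: fact_Suc)
    then show "z * (z ^ n /\<^sub>R fact n) = of_nat (Suc n) * (z ^ Suc n / fact (Suc n))"
      by (simp add: scaleR_conv_of_real field_simps)
  qed
  finally show ?thesis
    by (subst (asm) sums_Suc_iff) simp
qed

context poisson_space
begin

lemma expectation_cnt_sums:
  fixes g :: "nat \<Rightarrow> complex"
  assumes A: "A \<in> fmeasurable M" and g: "integrable P (\<lambda>\<omega>. g (cnt A \<omega>))"
  shows "(\<lambda>n. g n * (exp (- measure M A) * measure M A ^ n / fact n)) sums (\<integral>\<omega>. g (cnt A \<omega>) \<partial>P)"
proof -
  note [measurable] = fmeasurableD[OF A]
  have "(\<integral>\<omega>. g (cnt A \<omega>) * of_bool (cnt A \<omega> = n) \<partial>P) =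
      g n * (exp (- measure M A) * measure M A ^ n / fact n)" for n
  proof -
    have "(\<integral>\<omega>. g (cnt A \<omega>) * of_bool (cnt A \<omega> = n) \<partial>P) =
        (\<integral>\<omega>. g n * complex_of_real (indicator {\<omega> \<in> space P. cnt A \<omega> = n} \<omega>) \<partial>P)"
      by (rule Bochner_Integration.integral_cong) auto
    also have "\<dots> = g n * complex_of_real (measure P {\<omega> \<in> space P. cnt A \<omega> = n})"
      by (simp add: Int_absorb2)
    finally show ?thesis
      by (simp add: prob_cnt_eq[OF A])
  qed
  then show ?thesis
    using integral_level_sets_sums[OF cnt_measurable[OF fmeasurableD[OF A]] g] by simp
qed

lemma expectation_cis_cnt:
  assumes A: "A \<in> fmeasurable M"
  shows "(\<integral>\<omega>. cis (b * real (cnt A \<omega>)) \<partial>P) = exp (measure M A * (cis b - 1))"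
proof -
  note [measurable] = fmeasurableD[OF A]
  have "integrable P (\<lambda>\<omega>. cis (b * real (cnt A \<omega>)))"
    by (rule P.integrable_const_bound[where B=1]) auto
  note * = expectation_cnt_sums[OF A this]
  have "(\<lambda>n. exp (- of_real (measure M A)) * ((measure M A * cis b) ^ n /\<^sub>R fact n)) sums
      (exp (- of_real (measure M A)) * exp (measure M A * cis b))"
    by (intro sums_mult exp_converges)
  also have "(\<lambda>n. exp (- of_real (measure M A)) * ((measure M A * cis b) ^ n /\<^sub>R fact n)) =
      (\<lambda>n. cis (b * real n) * (exp (- measure M A) * measure M A ^ n / fact n))"
    by (simp add: fun_eq_iff scaleR_conv_of_real power_mult_distrib Complex.DeMoivre exp_of_real[symmetric]
        field_simps)
  finally show ?thesis
    using * by (simp add: sums_iff exp_add[symmetric] algebra_simps)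
qed

lemma nn_integral_cnt:
  assumes A: "A \<in> fmeasurable M"
  shows "(\<integral>\<^sup>+ \<omega>. of_nat (cnt A \<omega>) \<partial>P) = emeasure M A"
proof -
  note [measurable] = fmeasurableD[OF A]
  have eq: "(of_nat (cnt A \<omega>) :: ennreal) =
      (\<Sum>n. of_nat n * indicator {\<omega> \<in> space P. cnt A \<omega> = n} \<omega>)" if "\<omega> \<in> space P" for \<omega>
  proof -
    have "(\<lambda>n. of_nat n * indicator {\<omega> \<in> space P. cnt A \<omega> = n} \<omega> :: ennreal) sums of_nat (cnt A \<omega>)"
      using sums_single[of "cnt A \<omega>" "\<lambda>n. of_nat n :: ennreal"]
      by (rule sums_cong[THEN iffD1, rotated]) (use that in \<open>auto simp: indicator_def\<close>)
    then show ?thesis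
      by (simp add: sums_iff)
  qed
  have "(\<integral>\<^sup>+ \<omega>. of_nat (cnt A \<omega>) \<partial>P) =
      (\<Sum>n. \<integral>\<^sup>+ \<omega>. of_nat n * indicator {\<omega> \<in> space P. cnt A \<omega> = n} \<omega> \<partial>P)"
    by (subst nn_integral_suminf[symmetric]) (auto intro!: nn_integral_cong simp: eq)
  also have "\<dots> = (\<Sum>n. ennreal (exp (- measure M A) * (real n * (measure M A ^ n / fact n))))"
  proof (rule suminf_cong)
    fix n
    have "(\<integral>\<^sup>+ \<omega>. of_nat n * indicator {\<omega> \<in> space P. cnt A \<omega> = n} \<omega> \<partial>P) =
        ennreal (real n) * ennreal (exp (- measure M A) * measure M A ^ n / fact n)"
      by (simp add: nn_integral_cmult_indicator P.emeasure_eq_measure prob_cnt_eq[OF A] ennreal_of_nat_eq_real_of_nat)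
    then show "(\<integral>\<^sup>+ \<omega>. of_nat n * indicator {\<omega> \<in> space P. cnt A \<omega> = n} \<omega> \<partial>P) =
        ennreal (exp (- measure M A) * (real n * (measure M A ^ n / fact n)))"
      by (simp add: ennreal_mult[symmetric] mult_ac)
  qed
  also have "\<dots> = ennreal (exp (- measure M A) * (measure M A * exp (measure M A)))"
    using sums_mult[OF sums_of_nat_exp[of "measure M A"], of "exp (- measure M A)"]
    by (intro suminf_ennreal_eq) auto
  also have "\<dots> = emeasure M A"
    using A by (simp add: exp_minus emeasure_eq_measure2)
  finally show ?thesis .
qed

lemma integrable_cnt:
  assumes A: "A \<in> fmeasurable M"
  shows "integrable P (\<lambda>\<omega>. real (cnt A \<omega>))"
proof -
  note [measurable] = fmeasurableD[OF A]
  show ?thesis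
    using nn_integral_cnt[OF A] A
    by (intro integrableI_bounded) (auto simp: ennreal_of_nat_eq_real_of_nat fmeasurable_def)
qed

lemma integrable_cnt_mult_cis:
  assumes A: "A \<in> fmeasurable M" and X [measurable]: "X \<in> borel_measurable P"
  shows "integrable P (\<lambda>\<omega>. of_nat (cnt A \<omega>) * cis (X \<omega>))"
proof -
  note [measurable] = fmeasurableD[OF A]
  show ?thesis
    using integrable_cnt[OF A] by (rule Bochner_Integration.integrable_bound) (auto simp: norm_mult)
qed

lemma expectation_cnt_mult_cis:
  assumes A: "A \<in> fmeasurable M"
  shows "(\<integral>\<omega>. of_nat (cnt A \<omega>) * cis (b * real (cnt A \<omega>)) \<partial>P) =
    measure M A * cis b * exp (measure M A * (cis b - 1))"
proof -
  note [measurable] = fmeasurableD[OF A]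
  have "integrable P (\<lambda>\<omega>. of_nat (cnt A \<omega>) * cis (b * real (cnt A \<omega>)))"
    using A by (rule integrable_cnt_mult_cis) measurable
  note * = expectation_cnt_sums[OF A this]
  have "(\<lambda>n. exp (- of_real (measure M A)) * (of_nat n * ((measure M A * cis b) ^ n / fact n))) sums
      (exp (- of_real (measure M A)) * ((measure M A * cis b) * exp (measure M A * cis b)))"
    by (intro sums_mult sums_of_nat_exp)
  also have "(\<lambda>n. exp (- of_real (measure M A)) * (of_nat n * ((measure M A * cis b) ^ n / fact n))) =
      (\<lambda>n. of_nat n * cis (b * real n) * (exp (- measure M A) * measure M A ^ n / fact n))"
    by (simp add: fun_eq_iff power_mult_distrib Complex.DeMoivre exp_of_real[symmetric] field_simps)
  finally show ?thesis
    using * by (simp add: sums_iff exp_add algebra_simps exp_diff exp_minus divide_inverse)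
qed

text \<open>
  The sets \<open>B 0, \<dots>, B (k - 1)\<close> may overlap, so the independence of the counts has to be
  applied to the cells of points having the same pattern of memberships.
\<close>

lemma expectation_cnt_mult_cis_sum:
  fixes k :: nat
  assumes B: "\<And>j. j < k \<Longrightarrow> B j \<in> fmeasurable M" and l: "l < k"
  shows "(\<integral>\<omega>. of_nat (cnt (B l) \<omega>) * cis (\<Sum>j<k. a j * real (cnt (B j) \<omega>)) \<partial>P) =
    (\<integral>x. indicator (B l) x * cis (\<Sum>j<k. a j * indicator (B j) x) \<partial>M) *
    (\<integral>\<omega>. cis (\<Sum>j<k. a j * real (cnt (B j) \<omega>)) \<partial>P)"
proof -
  define pat where "pat x = {j. j < k \<and> x \<in> B j}" for x
  \<comment> \<open>The empty pattern is left out: the points outside all \<open>B j\<close> may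
    form a set of infinite measure, and they do not influence the counts.\<close>
  define J where "J = Pow {..<k} - {{}}"
  define C where "C S = {x \<in> space M. pat x = S}" for S
  define b where "b S = (\<Sum>j\<in>S. a j)" for S
  have finJ: "finite J"
    by (simp add: J_def)
  have C_sub: "C S \<subseteq> B j" if "j \<in> S" for S j
    using that by (auto simp: C_def pat_def)
  have C: "C S \<in> fmeasurable M" if "S \<in> J" for S
  proof -
    obtain j where j: "j \<in> S" "j < k"
      using \<open>S \<in> J\<close> unfolding J_def by blast
    have [measurable]: "B j \<in> sets M" if "j < k" for j
      using B[OF that] by auto
    have "C S = {x \<in> space M. (\<forall>j\<in>{..<k}. x \<in> B j \<longleftrightarrow> j \<in> S)}"
      using \<open>S \<in> J\<close> by (auto simp: C_def pat_def J_def)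
    also have "\<dots> \<in> sets M"
      by measurable
    finally show ?thesis
      using B[OF j(2)] C_sub[OF j(1)] by (rule_tac fmeasurableI2)
  qed
  have dj: "disjoint_family_on C J"
    by (auto simp: disjoint_family_on_def C_def)
  have B_eq: "B j = (\<Union>S\<in>{S \<in> J. j \<in> S}. C S)" if "j < k" for j
    using that fmeasurableD[OF B[OF that]] sets.sets_into_space
    by (fastforce simp: C_def pat_def J_def)
  have AE_fin: "AE \<omega> in P. \<forall>S\<in>J. emeasure \<omega> (C S) = of_nat (cnt (C S) \<omega>)"
    using finJ AE_emeasure_eq_cnt[OF C] by (intro AE_finite_allI)
  have AE_cnt: "AE \<omega> in P. \<forall>j<k. cnt (B j) \<omega> = (\<Sum>S | S \<in> J \<and> j \<in> S. cnt (C S) \<omega>)"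
    using AE_fin AE_space
  proof eventually_elim
    case (elim \<omega>)
    have sets: "sets \<omega> = sets M"
      using elim by (simp add: space_P sets_configuration)
    have "emeasure \<omega> (B j) = of_nat (\<Sum>S | S \<in> J \<and> j \<in> S. cnt (C S) \<omega>)" if "j < k" for j
    proof -
      have "emeasure \<omega> (B j) = (\<Sum>S | S \<in> J \<and> j \<in> S. emeasure \<omega> (C S))"
        unfolding B_eq[OF that] using finJ dj fmeasurableD[OF C]
        by (intro sum_emeasure[symmetric]) (auto simp: sets disjoint_family_on_def)
      also have "\<dots> = (\<Sum>S | S \<in> J \<and> j \<in> S. of_nat (cnt (C S) \<omega>))"
        using elim by (intro sum.cong) auto
      finally show ?thesis
        by simp
    qed
    then show ?case
      by (auto intro: cnt_of_nat)
  qed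
  \<comment> \<open>Exchanging the two summations regroups the exponent by cells; the coefficient of
    a cell is the sum of the \<open>a j\<close> over its pattern.\<close>
  have b_sum: "(\<Sum>j<k. a j * (\<Sum>S | S \<in> J \<and> j \<in> S. c S)) = (\<Sum>S\<in>J. b S * c S)" for c :: "nat set \<Rightarrow> real"
  proof -
    have "(\<Sum>j<k. a j * (\<Sum>S | S \<in> J \<and> j \<in> S. c S)) = (\<Sum>j<k. \<Sum>S\<in>J. if j \<in> S then a j * c S else 0)"
      using finJ by (intro sum.cong refl) (auto simp: sum_distrib_left sum.inter_filter intro!: sum.cong)
    also have "\<dots> = (\<Sum>S\<in>J. \<Sum>j<k. if j \<in> S then a j * c S else 0)"
      by (rule sum.swap)
    also have "\<dots> = (\<Sum>S\<in>J. \<Sum>j\<in>S. a j * c S)"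
      by (intro sum.cong refl sum.mono_neutral_cong_right) (auto simp: J_def)
    finally show ?thesis
      by (simp add: b_def sum_distrib_right)
  qed
  have AE_lin: "AE \<omega> in P. (\<Sum>j<k. a j * real (cnt (B j) \<omega>)) = (\<Sum>S\<in>J. b S * real (cnt (C S) \<omega>))"
    using AE_cnt
  proof eventually_elim
    case (elim \<omega>)
    then have "(\<Sum>j<k. a j * real (cnt (B j) \<omega>)) =
        (\<Sum>j<k. a j * (\<Sum>S | S \<in> J \<and> j \<in> S. real (cnt (C S) \<omega>)))"
      by (intro sum.cong) auto
    then show ?case
      by (simp add: b_sum)
  qed
  have [measurable]: "cnt (B j) \<in> measurable P (count_space UNIV)" if "j < k" for j
    using B[OF that] by (intro cnt_measurable) auto
  have [measurable]: "cnt (C S) \<in> measurable P (count_space UNIV)" if "S \<in> J" for S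
    using C[OF that] by (intro cnt_measurable) auto
  have [measurable]: "C S \<in> sets M" if "S \<in> J" for S
    using C[OF that] by auto
  have [measurable]: "B j \<in> sets M" if "j < k" for j
    using B[OF that] by auto
  have cis_sum: "cis (\<Sum>S\<in>J. g S) = (\<Prod>S\<in>J. cis (g S))" for g
    using finJ by induction (auto simp: cis_mult[symmetric])
  define \<phi> where "\<phi> S = exp (measure M (C S) * (cis (b S) - 1))" for S
  have E_cis: "(\<integral>\<omega>. cis (\<Sum>j<k. a j * real (cnt (B j) \<omega>)) \<partial>P) = (\<Prod>S\<in>J. \<phi> S)"
  proof -
    have "(\<integral>\<omega>. cis (\<Sum>j<k. a j * real (cnt (B j) \<omega>)) \<partial>P) =
        (\<integral>\<omega>. (\<Prod>S\<in>J. cis (b S * real (cnt (C S) \<omega>))) \<partial>P)"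
      using AE_lin by (intro integral_cong_AE) (auto simp: cis_sum elim!: eventually_mono)
    also have "\<dots> = (\<Prod>S\<in>J. \<integral>\<omega>. cis (b S * real (cnt (C S) \<omega>)) \<partial>P)"
      using finJ dj C
      by (intro expectation_prod_cnt[where g="\<lambda>S n. cis (b S * real n)"] P.integrable_const_bound[where B=1]) auto
    finally show ?thesis
      using C by (simp add: \<phi>_def expectation_cis_cnt)
  qed
  have E_cnt_cis: "(\<integral>\<omega>. of_nat (cnt (C T) \<omega>) * (\<Prod>S\<in>J. cis (b S * real (cnt (C S) \<omega>))) \<partial>P) =
      measure M (C T) * cis (b T) * (\<Prod>S\<in>J. \<phi> S)"
    and int_cnt_cis: "integrable P (\<lambda>\<omega>. of_nat (cnt (C T) \<omega>) * (\<Prod>S\<in>J. cis (b S * real (cnt (C S) \<omega>))))"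
    if T: "T \<in> J" for T
  proof -
    show "integrable P (\<lambda>\<omega>. of_nat (cnt (C T) \<omega>) * (\<Prod>S\<in>J. cis (b S * real (cnt (C S) \<omega>))))"
      unfolding cis_sum[symmetric] using C[OF T] by (rule integrable_cnt_mult_cis) measurable
    \<comment> \<open>Only the factor of the cell \<open>T\<close> carries the extra count, so
      independence of the cells still gives a product, in which one factor is multiplied by
      \<open>measure M (C T) * cis (b T)\<close>.\<close>
    define g where "g S n = (if S = T then of_nat n else 1) * cis (b S * real n)" for S n
    have split: "(\<Prod>S\<in>J. (if S = T then u S else 1) * v S) = u T * (\<Prod>S\<in>J. v S)"
      for u v :: "nat set \<Rightarrow> complex"
      using finJ T by (simp add: prod.distrib prod.If_cases)
    have "(\<integral>\<omega>. of_nat (cnt (C T) \<omega>) * (\<Prod>S\<in>J. cis (b S * real (cnt (C S) \<omega>))) \<partial>P) =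
        (\<integral>\<omega>. (\<Prod>S\<in>J. g S (cnt (C S) \<omega>)) \<partial>P)"
      unfolding g_def by (subst split) simp
    also have "\<dots> = (\<Prod>S\<in>J. \<integral>\<omega>. g S (cnt (C S) \<omega>) \<partial>P)"
    proof (intro expectation_prod_cnt finJ dj C)
      show "integrable P (\<lambda>\<omega>. g S (cnt (C S) \<omega>))" if "S \<in> J" for S
      proof (cases "S = T")
        case True
        then show ?thesis
          using that C[OF that] by (auto simp: g_def intro!: integrable_cnt_mult_cis)
      next
        case False
        then show ?thesis
          using that by (auto simp: g_def intro!: P.integrable_const_bound[where B=1])
      qed
    qed
    also have "\<dots> = (\<Prod>S\<in>J. (if S = T then measure M (C S) * cis (b S) else 1) * \<phi> S)"
      using C by (intro prod.cong refl)
        (auto simp: g_def \<phi>_def expectation_cis_cnt expectation_cnt_mult_cis)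
    also have "\<dots> = measure M (C T) * cis (b T) * (\<Prod>S\<in>J. \<phi> S)"
      by (rule split)
    finally show "(\<integral>\<omega>. of_nat (cnt (C T) \<omega>) * (\<Prod>S\<in>J. cis (b S * real (cnt (C S) \<omega>))) \<partial>P) =
      measure M (C T) * cis (b T) * (\<Prod>S\<in>J. \<phi> S)" .
  qed
  have "(\<integral>\<omega>. of_nat (cnt (B l) \<omega>) * cis (\<Sum>j<k. a j * real (cnt (B j) \<omega>)) \<partial>P) =
      (\<integral>\<omega>. (\<Sum>T | T \<in> J \<and> l \<in> T. of_nat (cnt (C T) \<omega>) * (\<Prod>S\<in>J. cis (b S * real (cnt (C S) \<omega>)))) \<partial>P)"
  proof (rule integral_cong_AE)
    show "AE \<omega> in P. of_nat (cnt (B l) \<omega>) * cis (\<Sum>j<k. a j * real (cnt (B j) \<omega>)) =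
        (\<Sum>T | T \<in> J \<and> l \<in> T. of_nat (cnt (C T) \<omega>) * (\<Prod>S\<in>J. cis (b S * real (cnt (C S) \<omega>))))"
      using AE_lin AE_cnt
      by eventually_elim (use l in \<open>simp add: cis_sum sum_distrib_right\<close>)
  qed (use l in measurable)
  also have "\<dots> = (\<Sum>T | T \<in> J \<and> l \<in> T. measure M (C T) * cis (b T)) * (\<Prod>S\<in>J. \<phi> S)"
    by (subst Bochner_Integration.integral_sum) (simp_all add: int_cnt_cis E_cnt_cis sum_distrib_right)
  \<comment> \<open>On the cell \<open>T\<close> the exponent
    \<open>\<Sum>j<k. a j * indicator (B j) x\<close> has the constant value \<open>b T\<close>, so
    the integral over \<open>B l\<close> is a finite sum over the cells inside
    \<open>B l\<close>.\<close>
  also have "(\<Sum>T | T \<in> J \<and> l \<in> T. measure M (C T) * cis (b T)) =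
      (\<integral>x. indicator (B l) x * cis (\<Sum>j<k. a j * indicator (B j) x) \<partial>M)"
  proof -
    have "indicator (B l) x * cis (\<Sum>j<k. a j * indicator (B j) x) =
        (\<Sum>T | T \<in> J \<and> l \<in> T. indicator (C T) x *\<^sub>R cis (b T))" if x: "x \<in> space M" for x
    proof (cases "x \<in> B l")
      case True
      then have pat: "pat x \<in> {T. T \<in> J \<and> l \<in> T}"
        using l by (auto simp: J_def pat_def)
      have "(\<Sum>j<k. a j * indicator (B j) x) = b (pat x)"
        unfolding b_def by (intro sum.mono_neutral_cong_right) (auto simp: pat_def)
      moreover have "(\<Sum>T | T \<in> J \<and> l \<in> T. indicator (C T) x *\<^sub>R cis (b T)) =
          (\<Sum>T | T \<in> J \<and> l \<in> T. if T = pat x then cis (b T) else 0)"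
        using x by (intro sum.cong) (auto simp: C_def)
      ultimately show ?thesis
        using True pat finJ by simp
    next
      case False
      then have "x \<notin> C T" if "l \<in> T" for T
        using that C_sub by blast
      then show ?thesis
        using False by simp
    qed
    then have "(\<integral>x. indicator (B l) x * cis (\<Sum>j<k. a j * indicator (B j) x) \<partial>M) =
        (\<integral>x. (\<Sum>T | T \<in> J \<and> l \<in> T. indicator (C T) x *\<^sub>R cis (b T)) \<partial>M)"
      by (rule Bochner_Integration.integral_cong[OF refl])
    also have "\<dots> = (\<Sum>T | T \<in> J \<and> l \<in> T. measure M (C T) * cis (b T))"
    proof (subst Bochner_Integration.integral_sum)
      fix T assume T: "T \<in> {T. T \<in> J \<and> l \<in> T}"
      then show "integrable M (\<lambda>x. indicat_real (C T) x *\<^sub>R cis (b T))"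
        using C[of T] by (intro integrable_scaleR_left integrable_real_indicator) (auto simp: fmeasurable_def)
    next
      show "(\<Sum>T | T \<in> J \<and> l \<in> T. \<integral>x. indicat_real (C T) x *\<^sub>R cis (b T) \<partial>M) =
          (\<Sum>T | T \<in> J \<and> l \<in> T. measure M (C T) * cis (b T))"
      proof (rule sum.cong)
        fix T assume T: "T \<in> {T. T \<in> J \<and> l \<in> T}"
        then have "integrable M (indicat_real (C T))" "C T \<inter> space M = C T"
          using C[of T] by (auto simp: fmeasurable_def C_def)
        then show "(\<integral>x. indicat_real (C T) x *\<^sub>R cis (b T) \<partial>M) = measure M (C T) * cis (b T)"
          by (simp add: integral_scaleR_left scaleR_conv_of_real)
      qed simp
    qed
    finally show ?thesis by simp
  qed
  finally show ?thesis
    by (simp add: E_cis)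
qed

end

section \<open>Mecke's formula\<close>

text \<open>The increment of \<open>lin xs\<close> caused by a point at \<open>x\<close>.\<close>

definition lin_point :: "(real \<times> 'a set) list \<Rightarrow> 'a \<Rightarrow> real" where
  "lin_point xs x = (\<Sum>(a, B)\<leftarrow>xs. a * indicator B x)"

lemma lin_point_simps [simp]:
  "lin_point [] x = 0" "lin_point ((a, B) # xs) x = a * indicator B x + lin_point xs x"
  by (simp_all add: lin_point_def)

context poisson_space
begin

abbreviation add_point :: "'a \<times> 'a measure \<Rightarrow> 'a measure" where
  "add_point \<equiv> \<lambda>(x, \<omega>). add_measure \<omega> (return M x)"

lemma lin_point_measurable [measurable]:
  assumes "snd ` set xs \<subseteq> fmeasurable M"
  shows "lin_point xs \<in> borel_measurable M"
  using assms
proof (induction xs)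
  case (Cons x xs)
  obtain a B where x: "x = (a, B)"
    by force
  have [measurable]: "B \<in> sets M" "lin_point xs \<in> borel_measurable M"
    using Cons by (auto simp: x)
  have "lin_point (x # xs) = (\<lambda>\<omega>. a * indicator B \<omega> + lin_point xs \<omega>)"
    by (auto simp: x)
  then show ?case
    by simp
qed (simp add: lin_point_def[abs_def])

text \<open>Exceptions can occur only at configurations giving infinite mass to a listed set. That
  condition does not involve \<open>x\<close>, which is why the quantifier over \<open>x\<close> can
  stand inside.\<close>

lemma AE_lin_add_return:
  assumes "snd ` set xs \<subseteq> fmeasurable M"
  shows "AE \<omega> in P. \<forall>x\<in>space M. lin xs (add_measure \<omega> (return M x)) = lin xs \<omega> + lin_point xs x"
  using assms
proof (induction xs)
  case (Cons y xs)
  obtain a B where y: "y = (a, B)"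
    by force
  have B: "B \<in> fmeasurable M"
    using Cons by (auto simp: y)
  have "AE \<omega> in P. \<forall>x\<in>space M. lin xs (add_measure \<omega> (return M x)) = lin xs \<omega> + lin_point xs x"
    using Cons by auto
  then show ?case
    using AE_emeasure_finite[OF B] AE_space
    by eventually_elim (use B in \<open>auto simp: y cnt_add_return fmeasurableD algebra_simps split: split_indicator\<close>)
qed simp

lemma expectation_cnt_mult_cis_lin:
  assumes A: "A \<in> fmeasurable M" and xs: "snd ` set xs \<subseteq> fmeasurable M"
  shows "(\<integral>\<omega>. of_nat (cnt A \<omega>) * cis (lin xs \<omega>) \<partial>P) =
    (\<integral>x. indicator A x * cis (lin_point xs x) \<partial>M) * (\<integral>\<omega>. cis (lin xs \<omega>) \<partial>P)"
proof -
  \<comment> \<open>The coefficient 0 makes \<open>A\<close> one of the sets in the exponent, as the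
    formula for overlapping sets asks, without changing the value of the exponent.\<close>
  define ys where "ys = (0, A) # xs"
  define B a where "B j = snd (ys ! j)" and "a j = fst (ys ! j)" for j
  have B: "B j \<in> fmeasurable M" if "j < length ys" for j
    using A xs that nth_mem[OF that] by (auto simp: B_def ys_def)
  have "lin xs \<omega> = lin ys \<omega>" for \<omega>
    by (simp add: ys_def)
  also have "lin ys \<omega> = (\<Sum>j<length ys. a j * real (cnt (B j) \<omega>))" for \<omega>
    unfolding lin_def a_def B_def
    by (subst sum_list_sum_nth) (auto simp: atLeast0LessThan case_prod_beta)
  finally have 1: "lin xs \<omega> = (\<Sum>j<length ys. a j * real (cnt (B j) \<omega>))" for \<omega> .
  have "lin_point xs x = lin_point ys x" for x
    by (simp add: ys_def)
  also have "lin_point ys x = (\<Sum>j<length ys. a j * indicator (B j) x)" for x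
    unfolding lin_point_def a_def B_def
    by (subst sum_list_sum_nth) (auto simp: atLeast0LessThan case_prod_beta)
  finally have 2: "lin_point xs x = (\<Sum>j<length ys. a j * indicator (B j) x)" for x .
  have "B 0 = A"
    by (simp add: B_def ys_def)
  then show ?thesis
    using expectation_cnt_mult_cis_sum[of "length ys" B 0 a, OF B] by (simp add: 1 2 ys_def)
qed

text \<open>An equality of finite measures, both of total mass \<open>emeasure M A\<close>, so that
  uniqueness by characteristic functions applies. On the right the inserted point and the
  configuration are independent, so the exponential splits into an integral over \<open>A\<close>
  times the characteristic function of \<open>P\<close>. The moments of the counts give the same
  product on the left.\<close>

theorem mecke:
  assumes A: "A \<in> fmeasurable M"
  shows "density P (\<lambda>\<omega>. emeasure \<omega> A) = distr (density M (indicator A) \<Otimes>\<^sub>M P) P add_point"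
proof -
  note [measurable] = fmeasurableD[OF A]
  define N where "N = density M (indicator A)"
  have [measurable_cong]: "sets N = sets M"
    by (simp add: N_def)
  have [simp]: "space N = space M"
    by (simp add: N_def)
  have "emeasure N (space N) = emeasure M A"
    by (simp add: N_def emeasure_density nn_integral_indicator cong: nn_integral_cong)
  then interpret N: finite_measure N
    using A by (intro finite_measureI) (simp add: fmeasurable_def)
  interpret NP: pair_sigma_finite N P
    by standard
  interpret NPf: finite_measure "N \<Otimes>\<^sub>M P"
    by (intro finite_measure_pair_measure) unfold_locales
  have add_point [measurable]: "(\<lambda>z. add_point z) \<in> measurable (N \<Otimes>\<^sub>M P) P"
    by measurable
  \<comment> \<open>\<open>integral_density\<close> asks for a real density; it agrees almost surely
    with the \<open>ennreal\<close> one.\<close>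
  have dens: "density P (\<lambda>\<omega>. emeasure \<omega> A) = density P (\<lambda>\<omega>. ennreal (real (cnt A \<omega>)))"
    using AE_emeasure_eq_cnt[OF A]
    by (intro density_cong) (auto simp: ennreal_of_nat_eq_real_of_nat)
  have "density P (\<lambda>\<omega>. ennreal (real (cnt A \<omega>))) = distr (N \<Otimes>\<^sub>M P) P add_point"
  proof (rule measure_eqI_characteristic)
    have "emeasure (density P (\<lambda>\<omega>. ennreal (real (cnt A \<omega>)))) (space P) = emeasure M A"
      using nn_integral_cnt[OF A]
      by (simp add: emeasure_density ennreal_of_nat_eq_real_of_nat cong: nn_integral_cong)
    then show "finite_measure (density P (\<lambda>\<omega>. ennreal (real (cnt A \<omega>))))"
      using A by (intro finite_measureI) (simp add: fmeasurable_def)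
    show "finite_measure (distr (N \<Otimes>\<^sub>M P) P add_point)"
      by (rule NPf.finite_measure_distr) measurable
  next
    fix B assume B: "B \<in> fmeasurable M"
    note [measurable] = fmeasurableD[OF B]
    show "AE \<omega> in density P (\<lambda>\<omega>. ennreal (real (cnt A \<omega>))). emeasure \<omega> B < \<infinity>"
      using AE_emeasure_finite[OF B] by (subst AE_density) auto
    have "AE z in N \<Otimes>\<^sub>M P. emeasure (add_point z) B < \<infinity>"
    proof (rule NP.AE_pair_measure)
      show "{z \<in> space (N \<Otimes>\<^sub>M P). emeasure (add_point z) B < \<infinity>} \<in> sets (N \<Otimes>\<^sub>M P)"
        by measurable
      show "AE x in N. AE \<omega> in P. emeasure (add_point (x, \<omega>)) B < \<infinity>"
      proof (rule AE_I2)
        fix x assume "x \<in> space N"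
        show "AE \<omega> in P. emeasure (add_point (x, \<omega>)) B < \<infinity>"
          using AE_emeasure_finite[OF B] AE_space
          by eventually_elim
            (use B in \<open>auto simp: emeasure_add_measure space_P sets_configuration fmeasurableD
              emeasure_return indicator_def less_top[symmetric]\<close>)
      qed
    qed
    then show "AE \<omega> in distr (N \<Otimes>\<^sub>M P) P add_point. emeasure \<omega> B < \<infinity>"
      by (subst AE_distr_iff) auto
  next
    fix xs :: "(real \<times> 'a set) list" assume xs: "snd ` set xs \<subseteq> fmeasurable M"
    note [measurable] = lin_measurable[OF xs] lin_point_measurable[OF xs]
    have "(\<integral>\<omega>. cis (lin xs \<omega>) \<partial>density P (\<lambda>\<omega>. ennreal (real (cnt A \<omega>)))) =
        (\<integral>\<omega>. of_nat (cnt A \<omega>) * cis (lin xs \<omega>) \<partial>P)"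
      by (subst integral_density) (auto simp: scaleR_conv_of_real)
    also have "\<dots> = (\<integral>x. indicator A x * cis (lin_point xs x) \<partial>M) * (\<integral>\<omega>. cis (lin xs \<omega>) \<partial>P)"
      by (rule expectation_cnt_mult_cis_lin[OF A xs])
    also have "(\<integral>x. indicator A x * cis (lin_point xs x) \<partial>M) = (\<integral>x. cis (lin_point xs x) \<partial>N)"
    proof -
      have "N = density M (\<lambda>x. ennreal (indicator A x))"
        by (simp add: N_def ennreal_indicator)
      then show ?thesis
        by (simp add: integral_density scaleR_conv_of_real of_real_indicator)
    qed
    also have "(\<integral>x. cis (lin_point xs x) \<partial>N) * (\<integral>\<omega>. cis (lin xs \<omega>) \<partial>P) =
        (\<integral>x. (\<integral>\<omega>. cis (lin_point xs x) * cis (lin xs \<omega>) \<partial>P) \<partial>N)"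
      by simp
    also have "\<dots> = (\<integral>x. (\<integral>\<omega>. cis (lin xs (add_point (x, \<omega>))) \<partial>P) \<partial>N)"
    proof (rule Bochner_Integration.integral_cong[OF refl], rule integral_cong_AE)
      fix x assume x: "x \<in> space N"
      show "AE \<omega> in P. cis (lin_point xs x) * cis (lin xs \<omega>) = cis (lin xs (add_point (x, \<omega>)))"
        using AE_lin_add_return[OF xs]
        by eventually_elim (use x in \<open>simp add: cis_mult add.commute\<close>)
      have "(\<lambda>\<omega>. add_point (x, \<omega>)) \<in> measurable P P"
        using x by (intro measurable_Pair2[OF add_point])
      then show "(\<lambda>\<omega>. cis (lin xs (add_point (x, \<omega>)))) \<in> borel_measurable P"
        by measurable
    qed measurable
    also have "\<dots> = (\<integral>z. cis (lin xs (add_point z)) \<partial>(N \<Otimes>\<^sub>M P))"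
      by (intro NP.integral_fst') (rule NPf.integrable_const_bound[where B=1], simp_all)
    also have "\<dots> = (\<integral>\<omega>. cis (lin xs \<omega>) \<partial>distr (N \<Otimes>\<^sub>M P) P add_point)"
      by (rule integral_distr[symmetric]) measurable
    finally show "(\<integral>\<omega>. cis (lin xs \<omega>) \<partial>density P (\<lambda>\<omega>. ennreal (real (cnt A \<omega>)))) =
        (\<integral>\<omega>. cis (lin xs \<omega>) \<partial>distr (N \<Otimes>\<^sub>M P) P add_point)" .
  qed simp_all
  then show ?thesis
    by (simp add: dens N_def)
qed

corollary nn_integral_mecke_set:
  assumes A: "A \<in> fmeasurable M" and W [measurable]: "W \<in> borel_measurable P"
  shows "(\<integral>\<^sup>+ \<omega>. emeasure \<omega> A * W \<omega> \<partial>P) =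
    (\<integral>\<^sup>+ x. indicator A x * (\<integral>\<^sup>+ \<omega>. W (add_measure \<omega> (return M x)) \<partial>P) \<partial>M)"
proof -
  note [measurable] = fmeasurableD[OF A]
  define N where "N = density M (indicator A)"
  have N [measurable_cong]: "sets N = sets M"
    by (simp add: N_def)
  have [measurable]: "(\<lambda>z. add_point z) \<in> measurable (N \<Otimes>\<^sub>M P) P"
    by measurable
  have "(\<integral>\<^sup>+ \<omega>. emeasure \<omega> A * W \<omega> \<partial>P) = (\<integral>\<^sup>+ \<omega>. W \<omega> \<partial>density P (\<lambda>\<omega>. emeasure \<omega> A))"
    by (simp add: nn_integral_density)
  also have "\<dots> = (\<integral>\<^sup>+ z. W (add_point z) \<partial>(N \<Otimes>\<^sub>M P))"
    unfolding mecke[OF A] N_def[symmetric] by (rule nn_integral_distr) measurable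
  also have "\<dots> = (\<integral>\<^sup>+ x. (\<integral>\<^sup>+ \<omega>. W (add_point (x, \<omega>)) \<partial>P) \<partial>N)"
    by (rule P.nn_integral_fst[symmetric]) measurable
  also have "\<dots> = (\<integral>\<^sup>+ x. indicator A x * (\<integral>\<^sup>+ \<omega>. W (add_point (x, \<omega>)) \<partial>P) \<partial>M)"
    unfolding N_def by (rule nn_integral_density) measurable
  finally show ?thesis
    by simp
qed

end

section \<open>Multiplicative and invariant functionals\<close>

context poisson_space
begin

lemma exhausting_fmeasurable:
  obtains X :: "nat \<Rightarrow> 'a set" where "\<And>i. X i \<in> fmeasurable M" "(\<Union>i. X i) = space M" "incseq X"
proof -
  obtain X :: "nat \<Rightarrow> 'a set" where X: "range X \<subseteq> sets M" "(\<Union>i. X i) = space M"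
    "\<And>i. emeasure M (X i) \<noteq> \<infinity>" "incseq X"
    by (rule M.sigma_finite_incseq) blast
  show thesis
  proof (rule that)
    show "X i \<in> fmeasurable M" for i
      using X by (auto simp: fmeasurable_def top.not_eq_extremum)
  qed (use X in auto)
qed

text \<open>Mecke's formula for the indicator of a null set: the left side vanishes, hence for
  almost every \<open>x\<close> the probability of entering the null set by inserting
  \<open>x\<close> is 0. Exhausting the space by sets of finite measure covers all \<open>x\<close>.
  This is what lets almost sure statements survive the insertion of a point.\<close>

lemma AE_add_return:
  assumes "AE \<omega> in P. Q \<omega>"
  shows "AE x in M. AE \<omega> in P. Q (add_measure \<omega> (return M x))"
proof -
  obtain N where N: "N \<in> null_sets P" "{\<omega> \<in> space P. \<not> Q \<omega>} \<subseteq> N"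
    using assms by (auto simp: eventually_ae_filter)
  have [measurable]: "N \<in> sets P"
    using N by auto
  obtain X :: "nat \<Rightarrow> 'a set"
    where X: "\<And>i. X i \<in> fmeasurable M" "(\<Union>i. X i) = space M" "incseq X"
    by (rule exhausting_fmeasurable) blast
  have "AE x in M. indicator (X i) x *
      (\<integral>\<^sup>+ \<omega>. indicator N (add_measure \<omega> (return M x)) \<partial>P) = 0" for i
  proof (subst nn_integral_0_iff_AE[symmetric])
    have [measurable]: "X i \<in> sets M"
      using X(1) by auto
    show "(\<lambda>x. indicator (X i) x * (\<integral>\<^sup>+ \<omega>. indicator N (add_measure \<omega> (return M x)) \<partial>P))
        \<in> borel_measurable M"
      by measurable
    have "(\<integral>\<^sup>+ \<omega>. emeasure \<omega> (X i) * indicator N \<omega> \<partial>P) = 0"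
      using AE_not_in[OF N(1)] by (subst nn_integral_0_iff_AE) (auto elim!: eventually_mono)
    then show "(\<integral>\<^sup>+ x. indicator (X i) x * (\<integral>\<^sup>+ \<omega>. indicator N (add_measure \<omega> (return M x)) \<partial>P) \<partial>M) = 0"
      by (subst nn_integral_mecke_set[OF X(1), symmetric]) auto
  qed
  then have "AE x in M. \<forall>i. indicator (X i) x *
      (\<integral>\<^sup>+ \<omega>. indicator N (add_measure \<omega> (return M x)) \<partial>P) = 0"
    by (subst AE_all_countable) blast
  then show ?thesis
    using AE_space
  proof eventually_elim
    case (elim x)
    obtain i where "x \<in> X i"
      using elim X(2) by auto
    then have 0: "(\<integral>\<^sup>+ \<omega>. indicator N (add_measure \<omega> (return M x)) \<partial>P) = 0"
      using elim(1)[THEN spec, of i] by simp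
    have "(\<lambda>\<omega>. indicator N (add_measure \<omega> (return M x)) :: ennreal) \<in> borel_measurable P"
      using elim by measurable
    then have "AE \<omega> in P. indicator N (add_measure \<omega> (return M x)) = (0 :: ennreal)"
      using 0 by (subst (asm) nn_integral_0_iff_AE) auto
    then show ?case
      using AE_space
    proof eventually_elim
      case (elim \<omega>)
      have "add_measure \<omega> (return M x) \<in> space P"
        using \<open>x \<in> space M\<close> elim by (simp add: space_P add_return_in_configurations)
      then show ?case
        using N(2) elim by (auto simp: indicator_def split: if_splits)
    qed
  qed
qed

lemma integral_mecke_set:
  fixes W :: "'a measure \<Rightarrow> complex"
  assumes A: "A \<in> fmeasurable M" and W [measurable]: "W \<in> borel_measurable P"
    and bound: "\<And>\<omega>. norm (W \<omega>) \<le> c"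
  shows "(\<integral>\<omega>. of_nat (cnt A \<omega>) * W \<omega> \<partial>P) =
    (\<integral>x. indicator A x * (\<integral>\<omega>. W (add_measure \<omega> (return M x)) \<partial>P) \<partial>M)"
proof -
  note [measurable] = fmeasurableD[OF A]
  define N where "N = density M (indicator A)"
  have N [measurable_cong]: "sets N = sets M"
    by (simp add: N_def)
  have "emeasure N (space N) = emeasure M A"
    by (simp add: N_def emeasure_density nn_integral_indicator cong: nn_integral_cong)
  then interpret N: finite_measure N
    using A by (intro finite_measureI) (simp add: fmeasurable_def)
  interpret NP: pair_sigma_finite N P
    by standard
  interpret NPf: finite_measure "N \<Otimes>\<^sub>M P"
    by (intro finite_measure_pair_measure) unfold_locales
  have [measurable]: "(\<lambda>z. add_point z) \<in> measurable (N \<Otimes>\<^sub>M P) P"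
    by measurable
  have dens: "density P (\<lambda>\<omega>. emeasure \<omega> A) = density P (\<lambda>\<omega>. ennreal (real (cnt A \<omega>)))"
    using AE_emeasure_eq_cnt[OF A]
    by (intro density_cong) (auto simp: ennreal_of_nat_eq_real_of_nat)
  have "(\<integral>\<omega>. of_nat (cnt A \<omega>) * W \<omega> \<partial>P) = (\<integral>\<omega>. W \<omega> \<partial>density P (\<lambda>\<omega>. ennreal (real (cnt A \<omega>))))"
    by (subst integral_density) (auto simp: scaleR_conv_of_real)
  also have "\<dots> = (\<integral>\<omega>. W \<omega> \<partial>distr (N \<Otimes>\<^sub>M P) P add_point)"
    unfolding dens[symmetric] mecke[OF A] by (simp add: N_def)
  also have "\<dots> = (\<integral>z. W (add_point z) \<partial>(N \<Otimes>\<^sub>M P))"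
    by (rule integral_distr) measurable
  also have "\<dots> = (\<integral>x. (\<integral>\<omega>. W (add_point (x, \<omega>)) \<partial>P) \<partial>N)"
    by (rule NP.integral_fst'[symmetric])
      (rule NPf.integrable_const_bound[where B=c], simp_all add: bound)
  also have "\<dots> = (\<integral>x. indicator A x * (\<integral>\<omega>. W (add_measure \<omega> (return M x)) \<partial>P) \<partial>M)"
  proof -
    have "(\<lambda>x. \<integral>\<omega>. W (add_point (x, \<omega>)) \<partial>P) \<in> borel_measurable M"
      by (rule P.borel_measurable_lebesgue_integral) measurable
    moreover have "N = density M (\<lambda>x. ennreal (indicator A x))"
      by (simp add: N_def ennreal_indicator)
    ultimately show ?thesis
      by (simp add: integral_density scaleR_conv_of_real of_real_indicator)
  qed
  finally show ?thesis .
qed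

lemma expectation_multiplicative:
  fixes W :: "'a measure \<Rightarrow> complex" and u :: "'a \<Rightarrow> complex"
  assumes A: "A \<in> fmeasurable M" and W [measurable]: "W \<in> borel_measurable P"
    and bound: "\<And>\<omega>. norm (W \<omega>) \<le> c"
    and u: "AE x in M. AE \<omega> in P. W (add_measure \<omega> (return M x)) = u x * W \<omega>"
    and [measurable]: "u \<in> borel_measurable M"
  shows "(\<integral>\<omega>. W \<omega> \<partial>P) =
    exp (\<integral>x. indicator A x * u x \<partial>M) * (\<integral>\<omega>. W \<omega> * of_bool (cnt A \<omega> = 0) \<partial>P)"
proof -
  note [measurable] = fmeasurableD[OF A]
  define e where "e n = (\<integral>\<omega>. W \<omega> * of_bool (cnt A \<omega> = n) \<partial>P)" for n
  define U where "U = (\<integral>x. indicator A x * u x \<partial>M)"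
  have "of_nat (Suc n) * e (Suc n) = U * e n" for n
  proof -
    have "of_nat (Suc n) * e (Suc n) =
        (\<integral>\<omega>. of_nat (Suc n) * (W \<omega> * of_bool (cnt A \<omega> = Suc n)) \<partial>P)"
      by (simp add: e_def)
    \<comment> \<open>On this event the count equals \<open>Suc n\<close>, so the factor can be read
      as \<open>cnt A\<close>, the weight in Mecke's formula.\<close>
    also have "\<dots> = (\<integral>\<omega>. of_nat (cnt A \<omega>) * (W \<omega> * of_bool (cnt A \<omega> = Suc n)) \<partial>P)"
      by (rule Bochner_Integration.integral_cong) auto
    also have "\<dots> = (\<integral>x. indicator A x * (\<integral>\<omega>. W (add_measure \<omega> (return M x)) *
        of_bool (cnt A (add_measure \<omega> (return M x)) = Suc n) \<partial>P) \<partial>M)"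
    proof (rule integral_mecke_set[OF A])
      show "norm (W \<omega> * of_bool (cnt A \<omega> = Suc n)) \<le> c" for \<omega>
        using bound[of \<omega>] norm_ge_zero[of "W \<omega>"] by (auto simp: norm_mult simp del: norm_ge_zero)
    qed measurable
    also have "\<dots> = (\<integral>x. (indicator A x * u x) * e n \<partial>M)"
    proof (rule integral_cong_AE)
      show "AE x in M. indicator A x * (\<integral>\<omega>. W (add_measure \<omega> (return M x)) *
          of_bool (cnt A (add_measure \<omega> (return M x)) = Suc n) \<partial>P) = indicator A x * u x * e n"
        using u AE_space
      proof eventually_elim
        case (elim x)
        \<comment> \<open>A point inserted in \<open>A\<close> raises the count by one, so the event
          for \<open>Suc n\<close> pulls back to the event for \<open>n\<close>; this lowers the
          index in the recursion.\<close>
        have "(\<integral>\<omega>. W (add_measure \<omega> (return M x)) *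
            of_bool (cnt A (add_measure \<omega> (return M x)) = Suc n) \<partial>P) =
            (\<integral>\<omega>. u x * (W \<omega> * of_bool (cnt A \<omega> = n)) \<partial>P)" if "x \<in> A"
        proof (rule integral_cong_AE)
          show "AE \<omega> in P. W (add_measure \<omega> (return M x)) *
              of_bool (cnt A (add_measure \<omega> (return M x)) = Suc n) =
              u x * (W \<omega> * of_bool (cnt A \<omega> = n))"
            using elim(1) AE_emeasure_finite[OF A] AE_space
            by eventually_elim (use \<open>x \<in> space M\<close> that A in \<open>simp add: cnt_add_return fmeasurableD\<close>)
        qed (use \<open>x \<in> space M\<close> in measurable)
        then show ?case
          by (auto simp: e_def indicator_def)
      qed
      have "(\<lambda>x. \<integral>\<omega>. W (add_point (x, \<omega>)) * of_bool (cnt A (add_point (x, \<omega>)) = Suc n) \<partial>P)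
          \<in> borel_measurable M"
        by (rule P.borel_measurable_lebesgue_integral) measurable
      then show "(\<lambda>x. indicator A x * (\<integral>\<omega>. W (add_measure \<omega> (return M x)) *
          of_bool (cnt A (add_measure \<omega> (return M x)) = Suc n) \<partial>P)) \<in> borel_measurable M"
        by simp
    qed measurable
    finally show ?thesis
      by (simp add: U_def)
  qed
  then have rec: "e (Suc n) = U * e n / of_nat (Suc n)" for n
    by (metis nonzero_mult_div_cancel_left of_nat_neq_0)
  have e: "e n = (U ^ n /\<^sub>R fact n) * e 0" for n
    by (induction n) (simp_all add: rec scaleR_conv_of_real field_simps del: of_nat_Suc)
  have "integrable P W"
    by (rule P.integrable_const_bound[where B=c]) (auto simp: bound)
  then have "e sums (\<integral>\<omega>. W \<omega> \<partial>P)"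
    unfolding e_def by (intro integral_level_sets_sums) auto
  moreover have "e sums (exp U * e 0)"
  proof -
    have "(\<lambda>n. (U ^ n /\<^sub>R fact n) * e 0) sums (exp U * e 0)"
      by (intro sums_mult2 exp_converges)
    also have "(\<lambda>n. (U ^ n /\<^sub>R fact n) * e 0) = e"
      by (rule ext, rule e[symmetric])
    finally show ?thesis .
  qed
  ultimately show ?thesis
    unfolding U_def e_def by (rule sums_unique2)
qed

lemma fmeasurable_UN_list:
  "snd ` set xs \<subseteq> fmeasurable M \<Longrightarrow> \<Union>(snd ` set xs) \<in> fmeasurable M"
  by (induction xs) (auto intro: fmeasurable.Un)

text \<open>The multiplicative identity is used twice: for
  \<open>G \<omega> * cis (lin xs \<omega>)\<close> with factor \<open>cis (lin_point xs x)\<close>,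
  and for \<open>G\<close> with factor 1. Almost surely \<open>lin xs\<close> vanishes when
  \<open>A\<close>, the union of the listed sets, carries no point, so both identities contain the
  same expectation over \<open>cnt A \<omega> = 0\<close>, which is eliminated. What remains on the
  right depends on \<open>G\<close> only through its mean.\<close>

lemma expectation_mult_cis_invariant:
  fixes G :: "'a measure \<Rightarrow> complex"
  assumes G [measurable]: "G \<in> borel_measurable P" and bound: "\<And>\<omega>. norm (G \<omega>) \<le> c"
    and inv: "AE x in M. AE \<omega> in P. G (add_measure \<omega> (return M x)) = G \<omega>"
    and xs: "snd ` set xs \<subseteq> fmeasurable M"
  defines "A \<equiv> \<Union>(snd ` set xs)"
  shows "(\<integral>\<omega>. G \<omega> * cis (lin xs \<omega>) \<partial>P) * exp (\<integral>x. indicator A x \<partial>M) =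
    exp (\<integral>x. indicator A x * cis (lin_point xs x) \<partial>M) * (\<integral>\<omega>. G \<omega> \<partial>P)"
proof -
  note [measurable] = lin_measurable[OF xs] lin_point_measurable[OF xs]
  have A: "A \<in> fmeasurable M"
    unfolding A_def by (rule fmeasurable_UN_list[OF xs])
  note [measurable] = fmeasurableD[OF A]
  have 1: "(\<integral>\<omega>. G \<omega> * cis (lin xs \<omega>) \<partial>P) = exp (\<integral>x. indicator A x * cis (lin_point xs x) \<partial>M) *
      (\<integral>\<omega>. (G \<omega> * cis (lin xs \<omega>)) * of_bool (cnt A \<omega> = 0) \<partial>P)"
  proof (rule expectation_multiplicative[OF A, where c=c])
    show "AE x in M. AE \<omega> in P. G (add_measure \<omega> (return M x)) *
        cis (lin xs (add_measure \<omega> (return M x))) = cis (lin_point xs x) * (G \<omega> * cis (lin xs \<omega>))"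
      using inv AE_space
    proof eventually_elim
      case (elim x)
      show ?case
        using elim(1) AE_lin_add_return[OF xs]
        by eventually_elim (use elim(2) in \<open>simp add: cis_mult[symmetric] mult_ac\<close>)
    qed
  qed (auto simp: norm_mult bound)
  have 2: "(\<integral>\<omega>. G \<omega> \<partial>P) = exp (\<integral>x. indicator A x * 1 \<partial>M) * (\<integral>\<omega>. G \<omega> * of_bool (cnt A \<omega> = 0) \<partial>P)"
    using inv by (intro expectation_multiplicative[OF A, where c=c]) (auto simp: bound)
  have 3: "(\<integral>\<omega>. (G \<omega> * cis (lin xs \<omega>)) * of_bool (cnt A \<omega> = 0) \<partial>P) =
      (\<integral>\<omega>. G \<omega> * of_bool (cnt A \<omega> = 0) \<partial>P)"
  proof (rule integral_cong_AE)
    show "AE \<omega> in P. (G \<omega> * cis (lin xs \<omega>)) * of_bool (cnt A \<omega> = 0) = G \<omega> * of_bool (cnt A \<omega> = 0)"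
      using AE_emeasure_eq_cnt[OF A] AE_space
    proof eventually_elim
      case (elim \<omega>)
      show ?case
      proof (cases "cnt A \<omega> = 0")
        case True
        have "cnt B \<omega> = 0" if "B \<in> snd ` set xs" for B
        proof -
          have "emeasure \<omega> B \<le> emeasure \<omega> A"
            using that A elim by (intro emeasure_mono) (auto simp: A_def space_P sets_configuration)
          moreover have "emeasure \<omega> A = 0"
            using elim(1) True by (metis of_nat_0)
          ultimately show ?thesis
            by (simp add: cnt_def)
        qed
        then have "map (\<lambda>(a, B). a * real (cnt B \<omega>)) xs = map (\<lambda>_. 0) xs"
          by (intro map_cong refl) force
        then have "lin xs \<omega> = 0"
          by (simp only: lin_def sum_list_0)
        then show ?thesis
          by simp
      qed simp
    qed
  qed measurable
  show ?thesis
    using 1 2 3 by simp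
qed

text \<open>The constant \<open>m\<close> is invariant too and has the same mean as
  \<open>G\<close>, so the preceding identity gives equal characteristic functions for the densities
  \<open>G\<close> and \<open>m\<close>, the nonzero exponential being cancelled. Nonnegativity lets
  \<open>G\<close> serve as a density, and uniqueness of densities ends the argument.\<close>

lemma invariant_bounded_AE_const:
  fixes G :: "'a measure \<Rightarrow> real"
  assumes G [measurable]: "G \<in> borel_measurable P" and bound: "\<And>\<omega>. 0 \<le> G \<omega>" "\<And>\<omega>. G \<omega> \<le> c"
    and inv: "AE x in M. AE \<omega> in P. G (add_measure \<omega> (return M x)) = G \<omega>"
  shows "AE \<omega> in P. G \<omega> = (\<integral>\<omega>. G \<omega> \<partial>P)"
proof -
  define m where "m = (\<integral>\<omega>. G \<omega> \<partial>P)"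
  have m: "0 \<le> m"
    unfolding m_def using bound by (intro Bochner_Integration.integral_nonneg) auto
  have int: "integrable P G"
    using bound by (intro P.integrable_const_bound[where B=c]) auto
  have "density P (\<lambda>\<omega>. ennreal (G \<omega>)) = density P (\<lambda>\<omega>. ennreal m)"
  proof (rule measure_eqI_characteristic)
    have "emeasure (density P (\<lambda>\<omega>. ennreal (G \<omega>))) (space P) = ennreal m"
      using bound int by (simp add: emeasure_density nn_integral_eq_integral m_def cong: nn_integral_cong)
    then show "finite_measure (density P (\<lambda>\<omega>. ennreal (G \<omega>)))"
      by (intro finite_measureI) simp
    show "finite_measure (density P (\<lambda>\<omega>. ennreal m))"
      by (intro finite_measureI) (simp add: emeasure_density P.emeasure_space_1)
    show "AE \<omega> in density P (\<lambda>\<omega>. ennreal (G \<omega>)). emeasure \<omega> B < \<infinity>"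
      "AE \<omega> in density P (\<lambda>\<omega>. ennreal m). emeasure \<omega> B < \<infinity>" if "B \<in> fmeasurable M" for B
      using AE_emeasure_finite[OF that] by (auto simp: AE_density)
  next
    fix xs :: "(real \<times> 'a set) list" assume xs: "snd ` set xs \<subseteq> fmeasurable M"
    note [measurable] = lin_measurable[OF xs]
    define A where "A = \<Union>(snd ` set xs)"
    have "(\<integral>\<omega>. complex_of_real (G \<omega>) * cis (lin xs \<omega>) \<partial>P) * exp (\<integral>x. indicator A x \<partial>M) =
        exp (\<integral>x. indicator A x * cis (lin_point xs x) \<partial>M) * (\<integral>\<omega>. complex_of_real (G \<omega>) \<partial>P)"
      unfolding A_def using inv bound
      by (intro expectation_mult_cis_invariant[where c=c] xs) auto
    moreover have "(\<integral>\<omega>. complex_of_real m * cis (lin xs \<omega>) \<partial>P) * exp (\<integral>x. indicator A x \<partial>M) =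
        exp (\<integral>x. indicator A x * cis (lin_point xs x) \<partial>M) * (\<integral>\<omega>. complex_of_real m \<partial>P)"
      unfolding A_def by (intro expectation_mult_cis_invariant[where c=m] xs) (auto simp: m)
    moreover have "(\<integral>\<omega>. complex_of_real (G \<omega>) \<partial>P) = (\<integral>\<omega>. complex_of_real m \<partial>P)"
      by (simp add: m_def P.prob_space)
    ultimately have "(\<integral>\<omega>. complex_of_real (G \<omega>) * cis (lin xs \<omega>) \<partial>P) * exp (\<integral>x. indicator A x \<partial>M) =
        (\<integral>\<omega>. complex_of_real m * cis (lin xs \<omega>) \<partial>P) * exp (\<integral>x. indicator A x \<partial>M)"
      by (simp only:)
    then have "(\<integral>\<omega>. complex_of_real (G \<omega>) * cis (lin xs \<omega>) \<partial>P) =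
        (\<integral>\<omega>. complex_of_real m * cis (lin xs \<omega>) \<partial>P)"
      by (simp only: mult_right_cancel[OF exp_not_eq_zero])
    then show "(\<integral>\<omega>. cis (lin xs \<omega>) \<partial>density P (\<lambda>\<omega>. ennreal (G \<omega>))) =
        (\<integral>\<omega>. cis (lin xs \<omega>) \<partial>density P (\<lambda>\<omega>. ennreal m))"
      using bound m by (subst (1 2) integral_density) (auto simp: scaleR_conv_of_real)
  qed simp_all
  then have "AE \<omega> in P. ennreal (G \<omega>) = ennreal m"
    by (subst (asm) P.density_unique_iff) auto
  then show ?thesis
    using bound m by (auto simp: m_def)
qed

text \<open>\<open>F\<close> need not be integrable. \<open>arctan\<close> makes it bounded and
  preserves the invariance, the shift by \<open>pi\<close> makes it nonnegative, and
  \<open>tan\<close> undoes \<open>arctan\<close>.\<close>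

lemma invariant_AE_const_real:
  fixes F :: "'a measure \<Rightarrow> real"
  assumes F [measurable]: "F \<in> borel_measurable P"
    and inv: "AE x in M. AE \<omega> in P. F (add_measure \<omega> (return M x)) = F \<omega>"
  obtains c where "AE \<omega> in P. F \<omega> = c"
proof -
  define m where "m = (\<integral>\<omega>. arctan (F \<omega>) + pi \<partial>P)"
  have "AE \<omega> in P. arctan (F \<omega>) + pi = m"
    unfolding m_def
  proof (rule invariant_bounded_AE_const)
    show "0 \<le> arctan (F \<omega>) + pi" "arctan (F \<omega>) + pi \<le> 2 * pi" for \<omega>
      using arctan_bounded[of "F \<omega>"] pi_gt_zero by linarith+
    show "AE x in M. AE \<omega> in P. arctan (F (add_measure \<omega> (return M x))) + pi = arctan (F \<omega>) + pi"
      using inv by eventually_elim (auto elim!: eventually_mono)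
  qed measurable
  then have "AE \<omega> in P. F \<omega> = tan (m - pi)"
    by eventually_elim (metis add_diff_cancel_right' tan_arctan)
  then show thesis
    by (rule that)
qed

lemma invariant_AE_const:
  fixes F :: "'a measure \<Rightarrow> complex"
  assumes F [measurable]: "F \<in> borel_measurable P"
    and inv: "AE x in M. AE \<omega> in P. F (add_measure \<omega> (return M x)) = F \<omega>"
  obtains c where "AE \<omega> in P. F \<omega> = c"
proof -
  have "AE x in M. AE \<omega> in P. Re (F (add_measure \<omega> (return M x))) = Re (F \<omega>)"
    using inv by eventually_elim (auto elim!: eventually_mono)
  then obtain a where a: "AE \<omega> in P. Re (F \<omega>) = a"
    by (rule invariant_AE_const_real[rotated]) measurable
  have "AE x in M. AE \<omega> in P. Im (F (add_measure \<omega> (return M x))) = Im (F \<omega>)"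
    using inv by eventually_elim (auto elim!: eventually_mono)
  then obtain b where b: "AE \<omega> in P. Im (F \<omega>) = b"
    by (rule invariant_AE_const_real[rotated]) measurable
  have "AE \<omega> in P. F \<omega> = Complex a b"
    using a b by eventually_elim (simp add: complex_eq_iff)
  then show thesis
    by (rule that)
qed

end

section \<open>Integrability of the difference function\<close>

text \<open>Taylor polynomials at 0 bound sine and cosine alternately from above and below on the
  half-line; each inequality is the sign of the derivative in the next, starting from
  \<open>cos x \<le> 1\<close>.\<close>

lemma sin_le_cubic:
  fixes y :: real
  assumes "0 \<le> y"
  shows "sin y \<le> y - y ^ 3 / 6 + y ^ 5 / 120"
proof -
  have nonneg: "0 \<le> g y" if "g 0 = 0" "\<And>x. (g has_real_derivative g' x) (at x)" "\<And>x. 0 \<le> x \<Longrightarrow> 0 \<le> g' x"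
    "0 \<le> y" for g g' :: "real \<Rightarrow> real" and y
    using DERIV_nonneg_imp_nondecreasing[of 0 y g] that by fastforce
  have 1: "0 \<le> y - sin y" if "0 \<le> y" for y :: real
    by (rule nonneg[where g="\<lambda>y. y - sin y" and g'="\<lambda>x. 1 - cos x"]) (auto intro!: derivative_eq_intros that)
  have 2: "0 \<le> cos y - 1 + y ^ 2 / 2" if "0 \<le> y" for y :: real
    by (rule nonneg[where g="\<lambda>y. cos y - 1 + y ^ 2 / 2" and g'="\<lambda>x. x - sin x"]) (auto intro!: derivative_eq_intros that 1[simplified])
  have 3: "0 \<le> sin y - y + y ^ 3 / 6" if "0 \<le> y" for y :: real
    by (rule nonneg[where g="\<lambda>y. sin y - y + y ^ 3 / 6" and g'="\<lambda>x. cos x - 1 + x ^ 2 / 2"]) (auto intro!: derivative_eq_intros that 2[simplified])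
  have 4: "0 \<le> 1 - y ^ 2 / 2 + y ^ 4 / 24 - cos y" if "0 \<le> y" for y :: real
    by (rule nonneg[where g="\<lambda>y. 1 - y ^ 2 / 2 + y ^ 4 / 24 - cos y" and g'="\<lambda>x. sin x - x + x ^ 3 / 6"]) (auto intro!: derivative_eq_intros that 3[simplified])
  have "0 \<le> y - y ^ 3 / 6 + y ^ 5 / 120 - sin y"
    by (rule nonneg[where g="\<lambda>y. y - y ^ 3 / 6 + y ^ 5 / 120 - sin y" and g'="\<lambda>x. 1 - x ^ 2 / 2 + x ^ 4 / 24 - cos x"])
      (auto intro!: derivative_eq_intros assms 4[simplified])
  then show ?thesis
    by simp
qed

text \<open>For \<open>y \<le> 2\<close> the quintic term is at most \<open>y^3 / 30\<close>, which
  leaves \<open>2/15\<close> of \<open>y^3\<close>, more than \<open>1/8\<close>. For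
  \<open>y > 2\<close> already \<open>y - sin y \<ge> y - 1 \<ge> y / 2\<close>.\<close>

lemma diff_sin_ge:
  fixes y :: real
  assumes "0 \<le> y"
  shows "y * min (y\<^sup>2) 1 / 8 \<le> y - sin y"
proof (cases "y \<le> 2")
  case True
  have "y ^ 3 / 8 \<le> y - sin y"
  proof -
    have "y ^ 5 = y ^ 3 * y ^ 2"
      by (simp add: power_add[symmetric])
    also have "\<dots> \<le> y ^ 3 * 2 ^ 2"
      using True assms by (intro mult_left_mono power_mono) auto
    also have "\<dots> = 4 * y ^ 3"
      by simp
    finally show ?thesis
      using sin_le_cubic[OF assms] zero_le_power[OF assms, of 3] by linarith
  qed
  moreover have "y * min (y\<^sup>2) 1 \<le> y ^ 3"
    using mult_left_mono[OF min.cobounded1[of "y\<^sup>2" 1] assms] by (simp add: power3_eq_cube power2_eq_square)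
  ultimately show ?thesis
    by linarith
next
  case False
  have "y * min (y\<^sup>2) 1 \<le> y * 1"
    using assms by (intro mult_left_mono) auto
  then show ?thesis
    using False sin_le_one[of y] by linarith
qed

text \<open>Averaging over \<open>t\<close> removes the zeros of \<open>1 - cos (t * y)\<close> for large \<open>y\<close>.\<close>

lemma nn_integral_one_minus_cos_ge:
  fixes y :: real
  assumes r: "0 < r" "r \<le> 1"
  shows "ennreal (r ^ 3 / 8 * min (y\<^sup>2) 1) \<le> (\<integral>\<^sup>+ t. ennreal (1 - cos (t * y)) * indicator {0..r} t \<partial>lborel)"
proof (cases "y = 0")
  case False
  \<comment> \<open>With this substitution the averaged integral is
    \<open>(z - sin z) / \<bar>y\<bar>\<close>. The condition \<open>r \<le> 1\<close> lets the
    factor \<open>r^2\<close> pass inside the truncation at 1, which accounts for the third power of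
    \<open>r\<close>.\<close>
  define z where "z = r * \<bar>y\<bar>"
  have "((\<lambda>t. t - sin (t * \<bar>y\<bar>) / \<bar>y\<bar>) has_real_derivative (1 - cos (t * y))) (at t)" for t
    using False by (auto intro!: derivative_eq_intros simp: abs_if)
  then have "(\<integral>\<^sup>+ t. ennreal (1 - cos (t * y)) * indicator {0..r} t \<partial>lborel) =
      ennreal ((r - sin (r * \<bar>y\<bar>) / \<bar>y\<bar>) - (0 - sin (0 * \<bar>y\<bar>) / \<bar>y\<bar>))"
    using r by (intro nn_integral_FTC_Icc) (auto intro: has_field_derivative_at_within)
  moreover have "r ^ 3 / 8 * min (y\<^sup>2) 1 \<le> r - sin (r * \<bar>y\<bar>) / \<bar>y\<bar>"
  proof -
    have "r\<^sup>2 * min (y\<^sup>2) 1 \<le> min (z\<^sup>2) 1"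
    proof -
      have "r\<^sup>2 * min (y\<^sup>2) 1 \<le> r\<^sup>2 * y\<^sup>2"
        by (intro mult_left_mono) auto
      moreover have "r\<^sup>2 * min (y\<^sup>2) 1 \<le> 1 * 1"
        using r by (intro mult_mono) (auto intro: power_le_one)
      ultimately show ?thesis
        by (simp add: z_def power_mult_distrib)
    qed
    then have "r * (r\<^sup>2 * min (y\<^sup>2) 1) / 8 \<le> r * min (z\<^sup>2) 1 / 8"
      using r by (intro divide_right_mono mult_left_mono) auto
    also have "\<dots> = z * min (z\<^sup>2) 1 / 8 / \<bar>y\<bar>"
      using False by (simp add: z_def)
    also have "\<dots> \<le> (z - sin z) / \<bar>y\<bar>"
      using r by (intro divide_right_mono diff_sin_ge) (auto simp: z_def)
    also have "\<dots> = r - sin (r * \<bar>y\<bar>) / \<bar>y\<bar>"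
      using False by (simp add: z_def diff_divide_distrib)
    finally show ?thesis
      by (simp add: power3_eq_cube power2_eq_square mult_ac)
  qed
  ultimately show ?thesis
    by (simp add: ennreal_leI)
qed simp

section \<open>Truncated square integrability of the difference\<close>

context poisson_space
begin

text \<open>The expectation over \<open>cnt A \<omega> = 0\<close> is bounded in modulus by the void
  probability \<open>exp (- measure M A)\<close>. The assumption on \<open>t\<close> thus gives
  \<open>1 / 2 \<le> exp (Re U - measure M A)\<close>, whence the constant \<open>ln 2\<close>. It
  does not depend on \<open>A\<close>, so \<open>A\<close> may increase to the whole space.\<close>

lemma nn_integral_one_minus_cos_le:
  fixes F :: "'a measure \<Rightarrow> real" and f :: "'a \<Rightarrow> real"
  assumes F [measurable]: "F \<in> borel_measurable P" and f [measurable]: "f \<in> borel_measurable M"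
    and diff: "AE x in M. AE \<omega> in P. F (add_measure \<omega> (return M x)) = F \<omega> + f x"
    and t: "norm (\<integral>\<omega>. cis (t * F \<omega>) \<partial>P) \<ge> 1 / 2"
  shows "(\<integral>\<^sup>+ x. ennreal (1 - cos (t * f x)) \<partial>M) \<le> ennreal (ln 2)"
proof -
  have le: "(\<integral>\<^sup>+ x. ennreal (1 - cos (t * f x)) * indicator A x \<partial>M) \<le> ennreal (ln 2)"
    if A: "A \<in> fmeasurable M" for A
  proof -
    note [measurable] = fmeasurableD[OF A]
    have int1: "integrable M (\<lambda>x. indicator A x :: real)"
      using A by (intro integrable_real_indicator) (auto simp: fmeasurable_def)
    have int: "integrable M (\<lambda>x. indicator A x * cis (t * f x))"
      using int1 by (rule Bochner_Integration.integrable_bound) (auto simp: norm_mult split: split_indicator)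
    have int2: "integrable M (\<lambda>x. indicator A x * cos (t * f x))"
      using int1 by (rule Bochner_Integration.integrable_bound) (auto simp: abs_mult split: split_indicator)
    define U where "U = (\<integral>x. indicator A x * cis (t * f x) \<partial>M)"
    have E: "(\<integral>\<omega>. cis (t * F \<omega>) \<partial>P) = exp U * (\<integral>\<omega>. cis (t * F \<omega>) * of_bool (cnt A \<omega> = 0) \<partial>P)"
      unfolding U_def
    proof (rule expectation_multiplicative[OF A, where c=1])
      show "AE x in M. AE \<omega> in P. cis (t * F (add_measure \<omega> (return M x))) =
          cis (t * f x) * cis (t * F \<omega>)"
        using diff
      proof eventually_elim
        case (elim x)
        then show ?case
          by eventually_elim (simp add: cis_mult distrib_left add.commute)
      qed
    qed auto
    have "norm (\<integral>\<omega>. cis (t * F \<omega>) * of_bool (cnt A \<omega> = 0) \<partial>P) \<le>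
        (\<integral>\<omega>. norm (cis (t * F \<omega>) * of_bool (cnt A \<omega> = 0)) \<partial>P)"
      by (rule integral_norm_bound)
    also have "\<dots> = (\<integral>\<omega>. indicator {\<omega> \<in> space P. cnt A \<omega> = 0} \<omega> \<partial>P)"
      by (rule Bochner_Integration.integral_cong) (auto simp: norm_mult)
    also have "\<dots> = exp (- measure M A)"
      using prob_cnt_eq[OF A, of 0] by (simp add: Int_absorb2)
    finally have "norm (\<integral>\<omega>. cis (t * F \<omega>) \<partial>P) \<le> exp (Re U) * exp (- measure M A)"
      unfolding E norm_mult norm_exp_eq_Re by (intro mult_left_mono) auto
    then have "1 / 2 \<le> exp (Re U) * exp (- measure M A)"
      using t by linarith
    then have "1 / 2 \<le> exp (Re U - measure M A)"
      by (simp add: exp_add[symmetric])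
    then have "ln (1 / 2) \<le> Re U - measure M A"
      using ln_mono[of "1 / 2" "exp (Re U - measure M A)"] by simp
    then have "measure M A - Re U \<le> ln 2"
      by (simp add: ln_div)
    also have "Re U = (\<integral>x. indicator A x * cos (t * f x) \<partial>M)"
      unfolding U_def integral_Re[OF int, symmetric]
      by (rule Bochner_Integration.integral_cong) (auto split: split_indicator)
    also have "measure M A - (\<integral>x. indicator A x * cos (t * f x) \<partial>M) =
        (\<integral>x. indicator A x - indicator A x * cos (t * f x) \<partial>M)"
      using int1 int2 by (simp add: Int_absorb2 sets.sets_into_space)
    finally have "ennreal (\<integral>x. indicator A x - indicator A x * cos (t * f x) \<partial>M) \<le> ennreal (ln 2)"
      by (rule ennreal_leI)
    also have "ennreal (\<integral>x. indicator A x - indicator A x * cos (t * f x) \<partial>M) =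
        (\<integral>\<^sup>+ x. ennreal (indicator A x - indicator A x * cos (t * f x)) \<partial>M)"
      using int1 int2
      by (intro nn_integral_eq_integral[symmetric]) (auto split: split_indicator)
    also have "\<dots> = (\<integral>\<^sup>+ x. ennreal (1 - cos (t * f x)) * indicator A x \<partial>M)"
      by (intro nn_integral_cong) (auto split: split_indicator)
    finally show ?thesis .
  qed
  obtain X :: "nat \<Rightarrow> 'a set"
    where X: "\<And>i. X i \<in> fmeasurable M" "(\<Union>i. X i) = space M" "incseq X"
    by (rule exhausting_fmeasurable) blast
  have [measurable]: "X i \<in> sets M" for i
    using X(1) by auto
  have "(\<integral>\<^sup>+ x. ennreal (1 - cos (t * f x)) \<partial>M) =
      (\<integral>\<^sup>+ x. (SUP i. ennreal (1 - cos (t * f x)) * indicator (X i) x) \<partial>M)"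
  proof (rule nn_integral_cong)
    fix x assume "x \<in> space M"
    then obtain i where "x \<in> X i"
      using X(2) by auto
    then show "ennreal (1 - cos (t * f x)) = (SUP i. ennreal (1 - cos (t * f x)) * indicator (X i) x)"
      by (intro antisym SUP_upper2[of i] SUP_least) (auto split: split_indicator)
  qed
  also have "\<dots> = (SUP i. \<integral>\<^sup>+ x. ennreal (1 - cos (t * f x)) * indicator (X i) x \<partial>M)"
    using X(3) by (intro nn_integral_monotone_convergence_SUP)
      (auto simp: incseq_def le_fun_def split: split_indicator)
  also have "\<dots> \<le> ennreal (ln 2)"
    by (intro SUP_least le X)
  finally show ?thesis .
qed

lemma nn_integral_min_square_finite:
  fixes F :: "'a measure \<Rightarrow> real" and f :: "'a \<Rightarrow> real"
  assumes F [measurable]: "F \<in> borel_measurable P" and f [measurable]: "f \<in> borel_measurable M"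
    and diff: "AE x in M. AE \<omega> in P. F (add_measure \<omega> (return M x)) = F \<omega> + f x"
  shows "(\<integral>\<^sup>+ x. ennreal (min ((f x)\<^sup>2) 1) \<partial>M) < \<infinity>"
proof -
  have "(\<lambda>n. \<integral>\<omega>. cis (X n * F \<omega>) \<partial>P) \<longlonglongrightarrow> (\<integral>\<omega>. cis (0 * F \<omega>) \<partial>P)"
    if "X \<longlonglongrightarrow> 0" for X :: "nat \<Rightarrow> real"
  proof (rule integral_dominated_convergence[where w="\<lambda>_. 1"])
    show "AE \<omega> in P. (\<lambda>n. cis (X n * F \<omega>)) \<longlonglongrightarrow> cis (0 * F \<omega>)"
      using that by (intro AE_I2 tendsto_intros)
  qed auto
  then have "(\<lambda>t. \<integral>\<omega>. cis (t * F \<omega>) \<partial>P) \<midarrow>0\<rightarrow> (\<integral>\<omega>. cis (0 * F \<omega>) \<partial>P)"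
    by (subst tendsto_at_iff_sequentially) (auto simp: comp_def)
  from tendsto_norm[OF this] have "((\<lambda>t. norm (\<integral>\<omega>. cis (t * F \<omega>) \<partial>P)) \<longlongrightarrow> 1) (at 0)"
    by (simp add: P.prob_space)
  then have "\<forall>\<^sub>F t in at 0. 1 / 2 < norm (\<integral>\<omega>. cis (t * F \<omega>) \<partial>P)"
    by (rule order_tendstoD) simp
  then obtain d where d: "d > 0" "\<And>t. t \<noteq> 0 \<Longrightarrow> dist t 0 < d \<Longrightarrow> 1 / 2 < norm (\<integral>\<omega>. cis (t * F \<omega>) \<partial>P)"
    unfolding eventually_at by auto
  \<comment> \<open>The lower bound for the averaged cosine asks for \<open>r \<le> 1\<close>, and
    \<open>r < d\<close> keeps \<open>[0, r]\<close> inside the range where the characteristic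
    function of \<open>F\<close> exceeds \<open>1 / 2\<close> in modulus.\<close>
  define r where "r = min 1 (d / 2)"
  have r: "0 < r" "r \<le> 1" "r < d"
    using d by (auto simp: r_def)
  have le: "(\<integral>\<^sup>+ x. ennreal (1 - cos (t * f x)) \<partial>M) \<le> ennreal (ln 2)" if "t \<in> {0..r}" for t
  proof (cases "t = 0")
    case False
    then have "1 / 2 < norm (\<integral>\<omega>. cis (t * F \<omega>) \<partial>P)"
      using that r by (intro d) auto
    then show ?thesis
      by (intro nn_integral_one_minus_cos_le[OF F f diff]) simp
  qed simp
  interpret L: pair_sigma_finite M lborel
    by standard
  \<comment> \<open>The lower bound at \<open>f x\<close> is integrated over \<open>M\<close>;
    Tonelli's theorem then moves the integral over \<open>t\<close> outside, where the uniform bound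
    \<open>ln 2\<close> applies.\<close>
  have "ennreal (r ^ 3 / 8) * (\<integral>\<^sup>+ x. ennreal (min ((f x)\<^sup>2) 1) \<partial>M) =
      (\<integral>\<^sup>+ x. ennreal (r ^ 3 / 8 * min ((f x)\<^sup>2) 1) \<partial>M)"
    using r by (subst nn_integral_cmult[symmetric]) (auto intro!: nn_integral_cong simp: ennreal_mult[symmetric])
  also have "\<dots> \<le> (\<integral>\<^sup>+ x. (\<integral>\<^sup>+ t. ennreal (1 - cos (t * f x)) * indicator {0..r} t \<partial>lborel) \<partial>M)"
    using r by (intro nn_integral_mono nn_integral_one_minus_cos_ge) auto
  also have "\<dots> = (\<integral>\<^sup>+ t. (\<integral>\<^sup>+ x. ennreal (1 - cos (t * f x)) * indicator {0..r} t \<partial>M) \<partial>lborel)"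
    by (rule L.Fubini'[symmetric]) measurable
  also have "\<dots> \<le> (\<integral>\<^sup>+ t. ennreal (ln 2) * indicator {0..r} t \<partial>lborel)"
    using le by (intro nn_integral_mono) (auto split: split_indicator)
  also have "\<dots> < \<infinity>"
    using r by (simp add: nn_integral_cmult_indicator ennreal_mult_less_top)
  finally show ?thesis
    using r by (auto simp: ennreal_mult_less_top)
qed

text \<open>Truncation at 1 is subadditive on nonnegative numbers, so real and imaginary parts can
  be treated separately.\<close>

lemma difference_in_L_chi:
  fixes F :: "'a measure \<Rightarrow> complex"
  assumes F [measurable]: "F \<in> borel_measurable P" and f [measurable]: "f \<in> borel_measurable M"
    and diff: "AE x in M. AE \<omega> in P. F (add_measure \<omega> (return M x)) = F \<omega> + f x"
  shows "f \<in> L_chi M"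
proof -
  have re: "(\<integral>\<^sup>+ x. ennreal (min ((Re (f x))\<^sup>2) 1) \<partial>M) < \<infinity>"
  proof (rule nn_integral_min_square_finite)
    show "AE x in M. AE \<omega> in P. Re (F (add_measure \<omega> (return M x))) = Re (F \<omega>) + Re (f x)"
      using diff by eventually_elim (auto elim!: eventually_mono)
  qed measurable
  have im: "(\<integral>\<^sup>+ x. ennreal (min ((Im (f x))\<^sup>2) 1) \<partial>M) < \<infinity>"
  proof (rule nn_integral_min_square_finite)
    show "AE x in M. AE \<omega> in P. Im (F (add_measure \<omega> (return M x))) = Im (F \<omega>) + Im (f x)"
      using diff by eventually_elim (auto elim!: eventually_mono)
  qed measurable
  have min_add_1_le: "min (a + b) 1 \<le> min a 1 + min b 1" if "0 \<le> a" "0 \<le> b" for a b :: real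
    using that by (auto simp: min_def)
  have "(\<integral>\<^sup>+ x. ennreal (min ((cmod (f x))\<^sup>2) 1) \<partial>M) \<le>
      (\<integral>\<^sup>+ x. ennreal (min ((Re (f x))\<^sup>2) 1) + ennreal (min ((Im (f x))\<^sup>2) 1) \<partial>M)"
  proof (rule nn_integral_mono)
    fix x
    have "min ((cmod (f x))\<^sup>2) 1 \<le> min ((Re (f x))\<^sup>2) 1 + min ((Im (f x))\<^sup>2) 1"
      unfolding cmod_power2 by (rule min_add_1_le) auto
    then show "ennreal (min ((cmod (f x))\<^sup>2) 1) \<le>
        ennreal (min ((Re (f x))\<^sup>2) 1) + ennreal (min ((Im (f x))\<^sup>2) 1)"
      by (simp add: ennreal_plus[symmetric] ennreal_leI del: ennreal_plus)
  qed
  also have "\<dots> < \<infinity>"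
    using re im by (subst nn_integral_add) auto
  finally show ?thesis
    by (simp add: L_chi_def)
qed

end

section \<open>Second moments of linear functionals\<close>

context poisson_space
begin

lemma measurable_configuration:
  "\<omega> \<in> space P \<Longrightarrow> f \<in> measurable M N \<Longrightarrow> f \<in> measurable \<omega> N"
  by (simp add: space_P sets_configuration measurable_cong_sets[OF sets_configuration refl])

lemma nn_integral_measurable_P [measurable]:
  assumes "g \<in> borel_measurable M"
  shows "(\<lambda>\<omega>. \<integral>\<^sup>+ x. g x \<partial>\<omega>) \<in> borel_measurable P"
  using assms
proof induction
  case (cong f g)
  have "(\<integral>\<^sup>+ x. f x \<partial>\<omega>) = (\<integral>\<^sup>+ x. g x \<partial>\<omega>)" if "\<omega> \<in> space P" for \<omega>
    using that cong by (intro nn_integral_cong) (simp add: space_P space_configuration)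
  then show ?case
    using cong by (simp cong: measurable_cong)
next
  case (set A)
  have "(\<integral>\<^sup>+ x. indicator A x \<partial>\<omega>) = emeasure \<omega> A" if "\<omega> \<in> space P" for \<omega>
    using that set by (simp add: space_P sets_configuration)
  then show ?case
    using set by (simp cong: measurable_cong)
next
  case (mult u c)
  have "(\<integral>\<^sup>+ x. c * u x \<partial>\<omega>) = c * (\<integral>\<^sup>+ x. u x \<partial>\<omega>)" if "\<omega> \<in> space P" for \<omega>
    using mult by (simp add: nn_integral_cmult measurable_configuration[OF that])
  then show ?case
    using mult by (simp cong: measurable_cong)
next
  case (add u v)
  have "(\<integral>\<^sup>+ x. v x + u x \<partial>\<omega>) = (\<integral>\<^sup>+ x. v x \<partial>\<omega>) + (\<integral>\<^sup>+ x. u x \<partial>\<omega>)" if "\<omega> \<in> space P" for \<omega>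
    using add by (simp add: nn_integral_add measurable_configuration[OF that])
  then show ?case
    using add by (simp cong: measurable_cong)
next
  case (seq U)
  have "(\<integral>\<^sup>+ x. (SUP i. U i) x \<partial>\<omega>) = (SUP i. \<integral>\<^sup>+ x. U i x \<partial>\<omega>)" if "\<omega> \<in> space P" for \<omega>
    unfolding SUP_apply using seq
    by (simp add: nn_integral_monotone_convergence_SUP measurable_configuration[OF that])
  then show ?case
    using seq by (simp cong: measurable_cong)
qed

lemma nn_integral_add_return:
  assumes g: "g \<in> borel_measurable M" and \<omega>: "\<omega> \<in> space P" and x: "x \<in> space M"
  shows "(\<integral>\<^sup>+ y. g y \<partial>add_measure \<omega> (return M x)) = (\<integral>\<^sup>+ y. g y \<partial>\<omega>) + g x"
proof -
  define \<omega>' where "\<omega>' = add_measure \<omega> (return M x)"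
  have \<omega>': "\<omega>' \<in> space P"
    using \<omega> x by (simp add: \<omega>'_def space_P add_return_in_configurations)
  note meas = measurable_configuration[OF \<omega>] measurable_configuration[OF \<omega>']
  have "(\<integral>\<^sup>+ y. g y \<partial>\<omega>') = (\<integral>\<^sup>+ y. g y \<partial>\<omega>) + g x"
    using g
  proof induction
    case (cong f g)
    have "(\<integral>\<^sup>+ y. f y \<partial>\<nu>) = (\<integral>\<^sup>+ y. g y \<partial>\<nu>)" if "\<nu> \<in> space P" for \<nu>
      using that cong by (intro nn_integral_cong) (simp add: space_P space_configuration)
    then show ?case
      using cong \<omega> \<omega>' x by simp
  next
    case (set A)
    then show ?case
      using \<omega> \<omega>' by (simp add: space_P sets_configuration \<omega>'_def emeasure_add_measure)
  next
    case (mult u c)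
    then show ?case
      by (simp add: nn_integral_cmult meas distrib_left)
  next
    case (add u v)
    then show ?case
      by (simp add: nn_integral_add meas algebra_simps)
  next
    case (seq U)
    have "(SUP i. (\<integral>\<^sup>+ y. U i y \<partial>\<omega>) + U i x) = (SUP i. \<integral>\<^sup>+ y. U i y \<partial>\<omega>) + (SUP i. U i x)"
      using seq by (intro ennreal_SUP_add) (auto simp: incseq_def le_fun_def intro!: nn_integral_mono)
    then show ?case
      unfolding SUP_apply using seq by (simp add: nn_integral_monotone_convergence_SUP meas)
  qed
  then show ?thesis
    by (simp add: \<omega>'_def)
qed

text \<open>Both sides are linear and monotonically continuous in \<open>g\<close>, so indicators
  suffice; a set of infinite measure is approached from below by its intersections with an
  exhaustion.\<close>

lemma nn_integral_mecke:
  assumes g: "g \<in> borel_measurable M" and W [measurable]: "W \<in> borel_measurable P"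
  shows "(\<integral>\<^sup>+ \<omega>. (\<integral>\<^sup>+ x. g x \<partial>\<omega>) * W \<omega> \<partial>P) =
    (\<integral>\<^sup>+ x. g x * (\<integral>\<^sup>+ \<omega>. W (add_measure \<omega> (return M x)) \<partial>P) \<partial>M)"
  using g
proof induction
  case (cong f g)
  have "(\<integral>\<^sup>+ \<omega>. (\<integral>\<^sup>+ x. f x \<partial>\<omega>) * W \<omega> \<partial>P) = (\<integral>\<^sup>+ \<omega>. (\<integral>\<^sup>+ x. g x \<partial>\<omega>) * W \<omega> \<partial>P)"
    using cong
    by (intro nn_integral_cong arg_cong2[where f="(*)"] refl) (simp add: space_P space_configuration)
  moreover have "(\<integral>\<^sup>+ x. f x * (\<integral>\<^sup>+ \<omega>. W (add_measure \<omega> (return M x)) \<partial>P) \<partial>M) =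
      (\<integral>\<^sup>+ x. g x * (\<integral>\<^sup>+ \<omega>. W (add_measure \<omega> (return M x)) \<partial>P) \<partial>M)"
    using cong by (intro nn_integral_cong) simp
  ultimately show ?case
    using cong by simp
next
  case (set A)
  obtain X :: "nat \<Rightarrow> 'a set"
    where X: "\<And>i. X i \<in> fmeasurable M" "(\<Union>i. X i) = space M" "incseq X"
    by (rule exhausting_fmeasurable) blast
  have [measurable]: "X i \<in> sets M" "A \<in> sets M" for i
    using X(1) set by auto
  have AX: "A \<inter> X i \<in> fmeasurable M" for i
    using set X(1) by (metis fmeasurable_Int_fmeasurable inf_commute)
  have UN: "(\<Union>i. A \<inter> X i) = A"
    using X(2) sets.sets_into_space[OF set] by auto
  have inc: "incseq (\<lambda>i. A \<inter> X i)"
    using X(3) by (auto simp: incseq_def subset_eq)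
  have "(\<integral>\<^sup>+ \<omega>. (\<integral>\<^sup>+ x. indicator A x \<partial>\<omega>) * W \<omega> \<partial>P) = (\<integral>\<^sup>+ \<omega>. (SUP i. emeasure \<omega> (A \<inter> X i) * W \<omega>) \<partial>P)"
  proof (rule nn_integral_cong)
    fix \<omega> assume "\<omega> \<in> space P"
    then have s: "sets \<omega> = sets M"
      by (simp add: space_P sets_configuration)
    have "(SUP i. emeasure \<omega> (A \<inter> X i)) = emeasure \<omega> (\<Union>i. A \<inter> X i)"
      using inc by (intro SUP_emeasure_incseq) (auto simp: s)
    then have "(SUP i. emeasure \<omega> (A \<inter> X i)) = emeasure \<omega> A"
      by (simp only: UN)
    then show "(\<integral>\<^sup>+ x. indicator A x \<partial>\<omega>) * W \<omega> = (SUP i. emeasure \<omega> (A \<inter> X i) * W \<omega>)"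
      using set by (simp add: s SUP_mult_right_ennreal[symmetric])
  qed
  also have "\<dots> = (SUP i. \<integral>\<^sup>+ \<omega>. emeasure \<omega> (A \<inter> X i) * W \<omega> \<partial>P)"
  proof (rule nn_integral_monotone_convergence_SUP_AE)
    show "AE \<omega> in P. emeasure \<omega> (A \<inter> X i) * W \<omega> \<le> emeasure \<omega> (A \<inter> X (Suc i)) * W \<omega>" for i
    proof (rule AE_I2, rule mult_right_mono, rule emeasure_mono)
      show "A \<inter> X i \<subseteq> A \<inter> X (Suc i)"
        using inc by (simp only: incseq_Suc_iff)
    qed (simp_all add: space_P sets_configuration)
  qed measurable
  also have "\<dots> = (SUP i. \<integral>\<^sup>+ x. indicator (A \<inter> X i) x * (\<integral>\<^sup>+ \<omega>. W (add_measure \<omega> (return M x)) \<partial>P) \<partial>M)"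
    by (simp only: nn_integral_mecke_set[OF AX W])
  also have "\<dots> = (\<integral>\<^sup>+ x. (SUP i. indicator (A \<inter> X i) x * (\<integral>\<^sup>+ \<omega>. W (add_measure \<omega> (return M x)) \<partial>P)) \<partial>M)"
    using inc by (intro nn_integral_monotone_convergence_SUP[symmetric])
      (auto simp: incseq_def le_fun_def split: split_indicator)
  also have "\<dots> = (\<integral>\<^sup>+ x. indicator A x * (\<integral>\<^sup>+ \<omega>. W (add_measure \<omega> (return M x)) \<partial>P) \<partial>M)"
  proof (rule nn_integral_cong)
    fix x
    have "(SUP i. indicator (A \<inter> X i) x :: ennreal) = indicator A x"
    proof (cases "x \<in> A")
      case True
      then obtain i where "x \<in> A \<inter> X i"
        using UN by blast
      then show ?thesis
        using True by (intro antisym SUP_least SUP_upper2[of i]) (auto split: split_indicator)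
    qed simp
    then show "(SUP i. indicator (A \<inter> X i) x * (\<integral>\<^sup>+ \<omega>. W (add_measure \<omega> (return M x)) \<partial>P)) =
        indicator A x * (\<integral>\<^sup>+ \<omega>. W (add_measure \<omega> (return M x)) \<partial>P)"
      by (simp add: SUP_mult_right_ennreal[symmetric])
  qed
  finally show ?case .
next
  case (mult u c)
  have "(\<integral>\<^sup>+ \<omega>. (\<integral>\<^sup>+ x. c * u x \<partial>\<omega>) * W \<omega> \<partial>P) = (\<integral>\<^sup>+ \<omega>. c * ((\<integral>\<^sup>+ x. u x \<partial>\<omega>) * W \<omega>) \<partial>P)"
    using mult by (intro nn_integral_cong) (simp add: nn_integral_cmult measurable_configuration[of _ u] mult.assoc)
  then show ?case
    using mult by (simp add: nn_integral_cmult mult.assoc)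
next
  case (add u v)
  have "(\<integral>\<^sup>+ \<omega>. (\<integral>\<^sup>+ x. v x + u x \<partial>\<omega>) * W \<omega> \<partial>P) =
      (\<integral>\<^sup>+ \<omega>. (\<integral>\<^sup>+ x. v x \<partial>\<omega>) * W \<omega> + (\<integral>\<^sup>+ x. u x \<partial>\<omega>) * W \<omega> \<partial>P)"
    using add by (intro nn_integral_cong) (simp add: nn_integral_add measurable_configuration[of _ u] measurable_configuration[of _ v] distrib_right)
  then show ?case
    using add by (simp add: nn_integral_add distrib_right)
next
  case (seq U)
  have "(\<integral>\<^sup>+ \<omega>. (\<integral>\<^sup>+ x. (SUP i. U i) x \<partial>\<omega>) * W \<omega> \<partial>P) = (\<integral>\<^sup>+ \<omega>. (SUP i. (\<integral>\<^sup>+ x. U i x \<partial>\<omega>) * W \<omega>) \<partial>P)"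
    unfolding SUP_apply using seq
    by (intro nn_integral_cong)
      (simp add: nn_integral_monotone_convergence_SUP measurable_configuration[of _ "U _"] SUP_mult_right_ennreal)
  also have "\<dots> = (SUP i. \<integral>\<^sup>+ \<omega>. (\<integral>\<^sup>+ x. U i x \<partial>\<omega>) * W \<omega> \<partial>P)"
    using seq by (intro nn_integral_monotone_convergence_SUP)
      (auto simp: incseq_def le_fun_def intro!: mult_right_mono nn_integral_mono)
  also have "\<dots> = (SUP i. \<integral>\<^sup>+ x. U i x * (\<integral>\<^sup>+ \<omega>. W (add_measure \<omega> (return M x)) \<partial>P) \<partial>M)"
    by (simp only: seq.IH)
  also have "\<dots> = (\<integral>\<^sup>+ x. (SUP i. U i x * (\<integral>\<^sup>+ \<omega>. W (add_measure \<omega> (return M x)) \<partial>P)) \<partial>M)"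
    using seq by (intro nn_integral_monotone_convergence_SUP[symmetric])
      (auto simp: incseq_def le_fun_def intro!: mult_right_mono)
  finally show ?case
    by (simp add: SUP_mult_right_ennreal image_comp)
qed

text \<open>The second moment comes from Mecke's formula with \<open>N\<close> itself as weight.
  Inserting a point adds \<open>g x\<close> to \<open>N\<close>, so the formula yields
  \<open>m^2\<close> from the mean and \<open>v\<close>, the integral of \<open>g^2\<close>, from
  the inserted point.\<close>

lemma variance_nonneg:
  assumes g [measurable]: "g \<in> borel_measurable M" and nonneg: "\<And>x. 0 \<le> g x"
    and int: "integrable M g" and int2: "integrable M (\<lambda>x. (g x)\<^sup>2)"
  shows "(\<integral>\<^sup>+ \<omega>. ennreal ((enn2real (\<integral>\<^sup>+ x. ennreal (g x) \<partial>\<omega>) - (\<integral>x. g x \<partial>M))\<^sup>2) \<partial>P) =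
    (\<integral>\<^sup>+ x. ennreal ((g x)\<^sup>2) \<partial>M)"
    and "AE \<omega> in P. (\<integral>\<^sup>+ x. ennreal (g x) \<partial>\<omega>) < \<infinity>"
proof -
  define N where "N \<omega> = (\<integral>\<^sup>+ x. ennreal (g x) \<partial>\<omega>)" for \<omega>
  define m where "m = (\<integral>x. g x \<partial>M)"
  define v where "v = (\<integral>x. (g x)\<^sup>2 \<partial>M)"
  have m: "0 \<le> m" "(\<integral>\<^sup>+ x. ennreal (g x) \<partial>M) = ennreal m"
    using nonneg int by (simp_all add: m_def nn_integral_eq_integral)
  have v: "0 \<le> v" "(\<integral>\<^sup>+ x. ennreal ((g x)\<^sup>2) \<partial>M) = ennreal v"
    using int2 by (simp_all add: v_def nn_integral_eq_integral)
  have [measurable]: "N \<in> borel_measurable P"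
    unfolding N_def by measurable
  have EN: "(\<integral>\<^sup>+ \<omega>. N \<omega> \<partial>P) = ennreal m"
    using nn_integral_mecke[of "\<lambda>x. ennreal (g x)" "\<lambda>_. 1"]
    by (simp add: N_def P.emeasure_space_1 m)
  have "(\<integral>\<^sup>+ \<omega>. N \<omega> * N \<omega> \<partial>P) =
      (\<integral>\<^sup>+ x. ennreal (g x) * (\<integral>\<^sup>+ \<omega>. N (add_measure \<omega> (return M x)) \<partial>P) \<partial>M)"
    using nn_integral_mecke[of "\<lambda>x. ennreal (g x)" N] by (simp add: N_def)
  also have "\<dots> = (\<integral>\<^sup>+ x. ennreal m * ennreal (g x) + ennreal ((g x)\<^sup>2) \<partial>M)"
  proof (rule nn_integral_cong)
    fix x assume x: "x \<in> space M"
    have "(\<integral>\<^sup>+ \<omega>. N (add_measure \<omega> (return M x)) \<partial>P) = (\<integral>\<^sup>+ \<omega>. N \<omega> + ennreal (g x) \<partial>P)"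
      using x by (intro nn_integral_cong) (simp add: N_def nn_integral_add_return)
    also have "\<dots> = ennreal m + ennreal (g x)"
      by (simp add: nn_integral_add EN P.emeasure_space_1)
    finally show "ennreal (g x) * (\<integral>\<^sup>+ \<omega>. N (add_measure \<omega> (return M x)) \<partial>P) =
        ennreal m * ennreal (g x) + ennreal ((g x)\<^sup>2)"
      using nonneg by (simp add: distrib_left ennreal_mult power2_eq_square mult.commute)
  qed
  also have "\<dots> = ennreal (m\<^sup>2 + v)"
    using m v by (simp add: nn_integral_add nn_integral_cmult ennreal_mult power2_eq_square)
  finally have EN2: "(\<integral>\<^sup>+ \<omega>. N \<omega> * N \<omega> \<partial>P) = ennreal (m\<^sup>2 + v)" .
  show fin: "AE \<omega> in P. (\<integral>\<^sup>+ x. ennreal (g x) \<partial>\<omega>) < \<infinity>"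
    using nn_integral_PInf_AE[of N P] EN by (simp add: N_def less_top)
  define X where "X \<omega> = enn2real (N \<omega>)" for \<omega>
  have [measurable]: "X \<in> borel_measurable P"
    unfolding X_def by measurable
  have N: "AE \<omega> in P. N \<omega> = ennreal (X \<omega>)"
    using fin by eventually_elim (simp add: X_def N_def)
  have X0: "0 \<le> X \<omega>" for \<omega>
    by (simp add: X_def)
  have "(\<integral>\<^sup>+ \<omega>. ennreal (X \<omega>) \<partial>P) = ennreal m"
    unfolding EN[symmetric] using N by (intro nn_integral_cong_AE) auto
  then have X1: "has_bochner_integral P X m"
    using m X0 by (intro has_bochner_integral_nn_integral) auto
  have "(\<integral>\<^sup>+ \<omega>. ennreal ((X \<omega>)\<^sup>2) \<partial>P) = ennreal (m\<^sup>2 + v)"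
    unfolding EN2[symmetric] using N
    by (intro nn_integral_cong_AE) (auto simp: power2_eq_square ennreal_mult X0)
  then have X2: "has_bochner_integral P (\<lambda>\<omega>. (X \<omega>)\<^sup>2) (m\<^sup>2 + v)"
    using m v by (intro has_bochner_integral_nn_integral) auto
  have "has_bochner_integral P (\<lambda>\<omega>. (X \<omega>)\<^sup>2 - 2 * m * X \<omega> + m\<^sup>2) ((m\<^sup>2 + v) - 2 * m * m + m\<^sup>2)"
    using X1 X2 P.prob_space P.emeasure_space_1
    by (intro has_bochner_integral_add has_bochner_integral_diff has_bochner_integral_mult_right)
      (auto simp: has_bochner_integral_iff)
  also have "(\<lambda>\<omega>. (X \<omega>)\<^sup>2 - 2 * m * X \<omega> + m\<^sup>2) = (\<lambda>\<omega>. (X \<omega> - m)\<^sup>2)"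
    by (simp add: fun_eq_iff power2_eq_square algebra_simps)
  also have "(m\<^sup>2 + v) - 2 * m * m + m\<^sup>2 = v"
    by (simp add: power2_eq_square)
  finally have "(\<integral>\<^sup>+ \<omega>. ennreal ((X \<omega> - m)\<^sup>2) \<partial>P) = ennreal v"
    by (simp add: has_bochner_integral_iff nn_integral_eq_integral)
  then show "(\<integral>\<^sup>+ \<omega>. ennreal ((enn2real (\<integral>\<^sup>+ x. ennreal (g x) \<partial>\<omega>) - (\<integral>x. g x \<partial>M))\<^sup>2) \<partial>P) =
    (\<integral>\<^sup>+ x. ennreal ((g x)\<^sup>2) \<partial>M)"
    by (simp add: X_def N_def m_def v)
qed

lemma integral_measurable_P_real:
  fixes g :: "'a \<Rightarrow> real"
  assumes g [measurable]: "g \<in> borel_measurable M"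
  shows "(\<lambda>\<omega>. \<integral>x. g x \<partial>\<omega>) \<in> borel_measurable P"
proof -
  \<comment> \<open>The Bochner integral of a non-integrable function is 0, so this default has to
    be reproduced on a measurable set of configurations.\<close>
  have "(\<integral>x. g x \<partial>\<omega>) = (if (\<integral>\<^sup>+ x. ennreal (norm (g x)) \<partial>\<omega>) < \<infinity>
      then enn2real (\<integral>\<^sup>+ x. ennreal (g x) \<partial>\<omega>) - enn2real (\<integral>\<^sup>+ x. ennreal (- g x) \<partial>\<omega>) else 0)"
    if \<omega>: "\<omega> \<in> space P" for \<omega>
    using measurable_configuration[OF \<omega> g]
    by (auto simp: integrable_iff_bounded intro!: real_lebesgue_integral_def not_integrable_integral_eq)
  then show ?thesis
    by (subst measurable_cong) (assumption, measurable)
qed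

lemma integral_measurable_P [measurable]:
  fixes g :: "'a \<Rightarrow> complex"
  assumes g [measurable]: "g \<in> borel_measurable M"
  shows "(\<lambda>\<omega>. \<integral>x. g x \<partial>\<omega>) \<in> borel_measurable P"
proof -
  have [measurable]: "(\<lambda>\<omega>. \<integral>x. Re (g x) \<partial>\<omega>) \<in> borel_measurable P" "(\<lambda>\<omega>. \<integral>x. Im (g x) \<partial>\<omega>) \<in> borel_measurable P"
    by (intro integral_measurable_P_real; measurable)+
  have "(\<integral>x. g x \<partial>\<omega>) = (if (\<integral>\<^sup>+ x. ennreal (norm (g x)) \<partial>\<omega>) < \<infinity>
      then complex_of_real (\<integral>x. Re (g x) \<partial>\<omega>) + \<i> * complex_of_real (\<integral>x. Im (g x) \<partial>\<omega>) else 0)"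
    if \<omega>: "\<omega> \<in> space P" for \<omega>
  proof (cases "integrable \<omega> g")
    case True
    then show ?thesis
      using measurable_configuration[OF \<omega> g] by (auto simp: integrable_iff_bounded complex_eq_iff)
  next
    case False
    then show ?thesis
      using measurable_configuration[OF \<omega> g]
      by (auto simp: not_integrable_integral_eq[OF False]) (auto simp: integrable_iff_bounded)
  qed
  then show ?thesis
    by (subst measurable_cong) (assumption, measurable)
qed

text \<open>By Mecke's formula with weight 1 the integral of \<open>norm (g x)\<close> over the
  configuration has finite mean, so it is finite almost surely.\<close>

lemma AE_integrable_configuration:
  fixes g :: "'a \<Rightarrow> 'c :: {banach, second_countable_topology}"
  assumes int: "integrable M g"
  shows "AE \<omega> in P. integrable \<omega> g"
proof -
  note [measurable] = borel_measurable_integrable[OF int]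
  have "(\<integral>\<^sup>+ \<omega>. (\<integral>\<^sup>+ x. ennreal (norm (g x)) \<partial>\<omega>) \<partial>P) = (\<integral>\<^sup>+ x. ennreal (norm (g x)) \<partial>M)"
    using nn_integral_mecke[of "\<lambda>x. ennreal (norm (g x))" "\<lambda>_. 1"] by (simp add: P.emeasure_space_1)
  also have "\<dots> < \<infinity>"
    using int by (simp add: integrable_iff_bounded)
  finally have "AE \<omega> in P. (\<integral>\<^sup>+ x. ennreal (norm (g x)) \<partial>\<omega>) \<noteq> \<infinity>"
    by (intro nn_integral_PInf_AE) auto
  then show ?thesis
    using AE_space
  proof eventually_elim
    case (elim \<omega>)
    then show ?case
      using measurable_configuration[OF elim(2), of g borel] by (simp add: integrable_iff_bounded less_top)
  qed
qed

text \<open>The factor 2 comes from \<open>(a - b)^2 \<le> 2 * a^2 + 2 * b^2\<close> for the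
  positive and negative parts, which avoids their covariance. The squares simply add up because the
  two parts have disjoint supports. A constant factor is harmless in a Cauchy estimate.\<close>

lemma variance_real:
  fixes g :: "'a \<Rightarrow> real"
  assumes int: "integrable M g" and int2: "integrable M (\<lambda>x. (g x)\<^sup>2)"
  shows "(\<integral>\<^sup>+ \<omega>. ennreal (((\<integral>x. g x \<partial>\<omega>) - (\<integral>x. g x \<partial>M))\<^sup>2) \<partial>P) \<le> 2 * (\<integral>\<^sup>+ x. ennreal ((g x)\<^sup>2) \<partial>M)"
proof -
  note [measurable] = borel_measurable_integrable[OF int]
  define p n where "p x = max (g x) 0" and "n x = max (- g x) 0" for x
  have [measurable]: "p \<in> borel_measurable M" "n \<in> borel_measurable M"
    unfolding p_def n_def by measurable
  have ip: "integrable M p" "integrable M n"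
    unfolding p_def n_def using int by auto
  have ip2: "integrable M (\<lambda>x. (p x)\<^sup>2)" "integrable M (\<lambda>x. (n x)\<^sup>2)"
    by (rule Bochner_Integration.integrable_bound[OF int2]; simp add: p_def n_def max_def)+
  define Z where "Z h \<omega> = enn2real (\<integral>\<^sup>+ x. ennreal (h x) \<partial>\<omega>) - (\<integral>x. h x \<partial>M)" for h :: "'a \<Rightarrow> real" and \<omega>
  have [measurable]: "Z p \<in> borel_measurable P" "Z n \<in> borel_measurable P"
    unfolding Z_def by measurable
  have eq: "g x = p x - n x" "(g x)\<^sup>2 = (p x)\<^sup>2 + (n x)\<^sup>2" for x
    by (auto simp: p_def n_def max_def)
  have "AE \<omega> in P. (\<integral>x. g x \<partial>\<omega>) - (\<integral>x. g x \<partial>M) = Z p \<omega> - Z n \<omega>"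
    using AE_integrable_configuration[OF ip(1)] AE_integrable_configuration[OF ip(2)]
  proof eventually_elim
    case (elim \<omega>)
    have "(\<integral>x. g x \<partial>\<omega>) = (\<integral>x. p x \<partial>\<omega>) - (\<integral>x. n x \<partial>\<omega>)"
      unfolding eq(1) using elim by (rule Bochner_Integration.integral_diff)
    moreover have "(\<integral>x. g x \<partial>M) = (\<integral>x. p x \<partial>M) - (\<integral>x. n x \<partial>M)"
      unfolding eq(1) using ip by (rule Bochner_Integration.integral_diff)
    moreover have "(\<integral>x. p x \<partial>\<omega>) = enn2real (\<integral>\<^sup>+ x. ennreal (p x) \<partial>\<omega>)"
      using elim(1)[THEN borel_measurable_integrable] by (rule integral_eq_nn_integral) (simp add: p_def)
    moreover have "(\<integral>x. n x \<partial>\<omega>) = enn2real (\<integral>\<^sup>+ x. ennreal (n x) \<partial>\<omega>)"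
      using elim(2)[THEN borel_measurable_integrable] by (rule integral_eq_nn_integral) (simp add: n_def)
    ultimately show ?case
      by (simp add: Z_def)
  qed
  then have "(\<integral>\<^sup>+ \<omega>. ennreal (((\<integral>x. g x \<partial>\<omega>) - (\<integral>x. g x \<partial>M))\<^sup>2) \<partial>P) =
      (\<integral>\<^sup>+ \<omega>. ennreal ((Z p \<omega> - Z n \<omega>)\<^sup>2) \<partial>P)"
    by (intro nn_integral_cong_AE) auto
  also have "\<dots> \<le> (\<integral>\<^sup>+ \<omega>. 2 * ennreal ((Z p \<omega>)\<^sup>2) + 2 * ennreal ((Z n \<omega>)\<^sup>2) \<partial>P)"
  proof (rule nn_integral_mono)
    fix \<omega>
    have "(Z p \<omega> - Z n \<omega>)\<^sup>2 \<le> 2 * (Z p \<omega>)\<^sup>2 + 2 * (Z n \<omega>)\<^sup>2"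
      using zero_le_power2[of "Z p \<omega> + Z n \<omega>"] by (simp add: power2_eq_square algebra_simps)
    then have "ennreal ((Z p \<omega> - Z n \<omega>)\<^sup>2) \<le> ennreal (2 * (Z p \<omega>)\<^sup>2 + 2 * (Z n \<omega>)\<^sup>2)"
      by (rule ennreal_leI)
    then show "ennreal ((Z p \<omega> - Z n \<omega>)\<^sup>2) \<le> 2 * ennreal ((Z p \<omega>)\<^sup>2) + 2 * ennreal ((Z n \<omega>)\<^sup>2)"
      by (simp add: ennreal_mult)
  qed
  also have "\<dots> = 2 * (\<integral>\<^sup>+ x. ennreal ((p x)\<^sup>2) \<partial>M) + 2 * (\<integral>\<^sup>+ x. ennreal ((n x)\<^sup>2) \<partial>M)"
    using variance_nonneg(1)[of p] variance_nonneg(1)[of n] ip ip2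
    by (simp add: nn_integral_add nn_integral_cmult Z_def[symmetric]) (simp add: p_def n_def)
  also have "\<dots> = 2 * (\<integral>\<^sup>+ x. ennreal ((g x)\<^sup>2) \<partial>M)"
    by (simp add: eq(2) nn_integral_add distrib_left)
  finally show ?thesis .
qed

lemma variance_complex:
  fixes h :: "'a \<Rightarrow> complex"
  assumes int: "integrable M h" and int2: "integrable M (\<lambda>x. (cmod (h x))\<^sup>2)"
  shows "(\<integral>\<^sup>+ \<omega>. ennreal ((cmod ((\<integral>x. h x \<partial>\<omega>) - (\<integral>x. h x \<partial>M)))\<^sup>2) \<partial>P) \<le>
    2 * (\<integral>\<^sup>+ x. ennreal ((cmod (h x))\<^sup>2) \<partial>M)"
proof -
  note [measurable] = borel_measurable_integrable[OF int]
  have [measurable]: "(\<lambda>\<omega>. \<integral>x. Re (h x) \<partial>\<omega>) \<in> borel_measurable P" "(\<lambda>\<omega>. \<integral>x. Im (h x) \<partial>\<omega>) \<in> borel_measurable P"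
    by (intro integral_measurable_P_real; measurable)+
  have sq: "integrable M (\<lambda>x. (Re (h x))\<^sup>2)" "integrable M (\<lambda>x. (Im (h x))\<^sup>2)"
    by (rule Bochner_Integration.integrable_bound[OF int2]; simp add: cmod_power2)+
  have "(\<integral>\<^sup>+ \<omega>. ennreal ((cmod ((\<integral>x. h x \<partial>\<omega>) - (\<integral>x. h x \<partial>M)))\<^sup>2) \<partial>P) =
      (\<integral>\<^sup>+ \<omega>. ennreal (((\<integral>x. Re (h x) \<partial>\<omega>) - (\<integral>x. Re (h x) \<partial>M))\<^sup>2) +
        ennreal (((\<integral>x. Im (h x) \<partial>\<omega>) - (\<integral>x. Im (h x) \<partial>M))\<^sup>2) \<partial>P)"
    using AE_integrable_configuration[OF int] int
    by (intro nn_integral_cong_AE) (auto simp: cmod_power2 elim!: eventually_mono)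
  also have "\<dots> \<le> 2 * (\<integral>\<^sup>+ x. ennreal ((Re (h x))\<^sup>2) \<partial>M) + 2 * (\<integral>\<^sup>+ x. ennreal ((Im (h x))\<^sup>2) \<partial>M)"
    using variance_real[OF integrable_Re[OF int] sq(1)] variance_real[OF integrable_Im[OF int] sq(2)]
    by (subst nn_integral_add) (measurable, rule add_mono)
  also have "\<dots> = 2 * (\<integral>\<^sup>+ x. ennreal ((cmod (h x))\<^sup>2) \<partial>M)"
    by (simp add: cmod_power2 nn_integral_add distrib_left)
  finally show ?thesis .
qed

end

section \<open>The compensated integral\<close>

text \<open>
  The limit is constructed along a fast sequence, where Fatou's lemma shows that it is a limit in
  \<open>L\<^sup>2\<close>.
\<close>

lemma (in prob_space) L2_Cauchy_limit:
  fixes X :: "real \<Rightarrow> 'a \<Rightarrow> complex" and r :: "real \<Rightarrow> ennreal"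
  assumes X [measurable]: "\<And>e. X e \<in> borel_measurable M"
    and cauchy: "\<And>d e. 0 < d \<Longrightarrow> d \<le> e \<Longrightarrow> e \<le> 1 \<Longrightarrow>
      (\<integral>\<^sup>+ \<omega>. ennreal ((cmod (X d \<omega> - X e \<omega>))\<^sup>2) \<partial>M) \<le> r e"
    and r: "(r \<longlongrightarrow> 0) (at_right 0)"
  obtains Y e where "Y \<in> borel_measurable M" "tendsto_in_measure M X Y (at_right 0)"
    "\<And>n. 0 < e n" "e \<longlonglongrightarrow> 0" "AE \<omega> in M. (\<lambda>n. X (e n) \<omega>) \<longlonglongrightarrow> Y \<omega>"
proof -
  \<comment> \<open>The rate \<open>(1 / 4) ^ n\<close> for squared distances makes the distances of
    order \<open>(1 / 2) ^ n\<close>, hence summable; the other bound forces \<open>e\<close> to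
    tend to 0.\<close>
  have "\<exists>e>0. e \<le> 1 / real (Suc n) \<and> r e < ennreal ((1 / 4) ^ n)" for n
  proof -
    have "\<forall>\<^sub>F e in at_right 0. r e < ennreal ((1 / 4) ^ n)"
      using r by (rule order_tendstoD) simp
    moreover have "\<forall>\<^sub>F e in at_right (0::real). 0 < e \<and> e < 1 / real (Suc n)"
      by (auto simp: eventually_at_right_field intro!: exI[of _ "1 / real (Suc n)"])
    ultimately have "\<forall>\<^sub>F e in at_right 0. 0 < e \<and> e < 1 / real (Suc n) \<and> r e < ennreal ((1 / 4) ^ n)"
      by eventually_elim auto
    then have "\<exists>e. 0 < e \<and> e < 1 / real (Suc n) \<and> r e < ennreal ((1 / 4) ^ n)"
      by (rule eventually_happens'[OF trivial_limit_at_right_real])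
    then show ?thesis
      using less_imp_le by blast
  qed
  then obtain e where e: "0 < e n" "e n \<le> 1 / real (Suc n)" "r (e n) < ennreal ((1 / 4) ^ n)" for n
    by metis
  have e1: "e n \<le> 1" for n
    using e(2)[of n] by (rule order_trans) simp
  have e0: "e \<longlonglongrightarrow> 0"
  proof (rule tendsto_sandwich[OF _ _ tendsto_const])
    show "(\<lambda>n. 1 / real (Suc n)) \<longlonglongrightarrow> 0"
      using LIMSEQ_inverse_real_of_nat by (simp add: inverse_eq_divide)
  qed (use e in \<open>auto intro!: always_eventually less_imp_le\<close>)
  define D where "D n \<omega> = cmod (X (e (Suc n)) \<omega> - X (e n) \<omega>)" for n \<omega>
  have [measurable]: "D n \<in> borel_measurable M" for n
    unfolding D_def by measurable
  \<comment> \<open>The sequence \<open>e\<close> need not be monotone, so the Cauchy bound is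
    applied at the larger of two consecutive values.\<close>
  have D2: "(\<integral>\<^sup>+ \<omega>. ennreal ((D n \<omega>)\<^sup>2) \<partial>M) \<le> ennreal ((1 / 4) ^ n)" for n
  proof (cases "e (Suc n) \<le> e n")
    case True
    then have "(\<integral>\<^sup>+ \<omega>. ennreal ((D n \<omega>)\<^sup>2) \<partial>M) \<le> r (e n)"
      unfolding D_def using e e1 by (intro cauchy)
    then show ?thesis
      using e(3)[of n] by simp
  next
    case False
    then have "(\<integral>\<^sup>+ \<omega>. ennreal ((D n \<omega>)\<^sup>2) \<partial>M) \<le> r (e (Suc n))"
      unfolding D_def norm_minus_commute[of "X (e (Suc n)) _"] using e e1 by (intro cauchy) auto
    also have "\<dots> \<le> ennreal ((1 / 4) ^ Suc n)"
      using e(3)[of "Suc n"] by simp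
    also have "\<dots> \<le> ennreal ((1 / 4) ^ n)"
      by (intro ennreal_leI power_decreasing) auto
    finally show ?thesis .
  qed
  have D1: "(\<integral>\<^sup>+ \<omega>. ennreal (D n \<omega>) \<partial>M) \<le> ennreal (2 * (1 / 2) ^ n)" for n
  proof -
    have "(\<integral>\<^sup>+ \<omega>. ennreal (D n \<omega>) \<partial>M) \<le>
        (\<integral>\<^sup>+ \<omega>. ennreal (2 ^ n) * ennreal ((D n \<omega>)\<^sup>2) + ennreal ((1 / 2) ^ n) \<partial>M)"
    proof (rule nn_integral_mono)
      fix \<omega>
      have "D n \<omega> \<le> 2 ^ n * (D n \<omega>)\<^sup>2 + (1 / 2) ^ n"
      proof -
        \<comment> \<open>This elementary inequality stands in for Cauchy-Schwarz in passing from
          second to first moments; the weight \<open>2 ^ n\<close> balances both terms at order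
          \<open>(1 / 2) ^ n\<close>.\<close>
        have "0 \<le> (2 ^ n * D n \<omega> - 1)\<^sup>2 + 2 ^ n * D n \<omega>"
          by (simp add: D_def)
        then have "2 ^ n * D n \<omega> \<le> 2 ^ n * (2 ^ n * (D n \<omega>)\<^sup>2 + (1 / 2) ^ n)"
          by (simp add: power2_eq_square algebra_simps power_one_over)
        then show ?thesis
          by simp
      qed
      then have "ennreal (D n \<omega>) \<le> ennreal (2 ^ n * (D n \<omega>)\<^sup>2 + (1 / 2) ^ n)"
        by (rule ennreal_leI)
      then show "ennreal (D n \<omega>) \<le> ennreal (2 ^ n) * ennreal ((D n \<omega>)\<^sup>2) + ennreal ((1 / 2) ^ n)"
        by (simp add: ennreal_mult)
    qed
    also have "\<dots> = ennreal (2 ^ n) * (\<integral>\<^sup>+ \<omega>. ennreal ((D n \<omega>)\<^sup>2) \<partial>M) + ennreal ((1 / 2) ^ n)"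
      by (simp add: nn_integral_add nn_integral_cmult emeasure_space_1)
    also have "\<dots> \<le> ennreal (2 ^ n) * ennreal ((1 / 4) ^ n) + ennreal ((1 / 2) ^ n)"
      by (intro add_mono mult_left_mono D2) auto
    also have "\<dots> = ennreal (2 ^ n * (1 / 4) ^ n + (1 / 2) ^ n)"
      by (simp add: ennreal_mult)
    also have "2 ^ n * (1 / 4) ^ n + (1 / 2) ^ n = 2 * (1 / 2 :: real) ^ n"
      by (simp add: power_mult_distrib[symmetric])
    finally show ?thesis .
  qed
  have "(\<integral>\<^sup>+ \<omega>. (\<Sum>n. ennreal (D n \<omega>)) \<partial>M) = (\<Sum>n. \<integral>\<^sup>+ \<omega>. ennreal (D n \<omega>) \<partial>M)"
    by (rule nn_integral_suminf) measurable
  also have "\<dots> \<le> (\<Sum>n. ennreal (2 * (1 / 2) ^ n))"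
    by (intro suminf_le D1) auto
  also have "\<dots> < \<infinity>"
    by (simp add: ennreal_suminf_neq_top less_top[symmetric] summable_mult summable_geometric)
  finally have "AE \<omega> in M. (\<Sum>n. ennreal (D n \<omega>)) \<noteq> \<infinity>"
    by (intro nn_integral_PInf_AE) auto
  then have conv: "AE \<omega> in M. convergent (\<lambda>n. X (e n) \<omega>)"
  proof eventually_elim
    case (elim \<omega>)
    then have "summable (\<lambda>n. D n \<omega>)"
      by (intro summable_suminf_not_top) (auto simp: D_def)
    then have "summable (\<lambda>n. X (e (Suc n)) \<omega> - X (e n) \<omega>)"
      unfolding D_def by (rule summable_norm_cancel)
    then have "convergent (\<lambda>n. X (e n) \<omega> - X (e 0) \<omega>)"
      by (simp add: summable_iff_convergent sum_lessThan_telescope[of "\<lambda>n. X (e n) \<omega>"])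
    then have "convergent (\<lambda>n. (X (e n) \<omega> - X (e 0) \<omega>) + X (e 0) \<omega>)"
      by (intro convergent_add convergent_const)
    then show ?case
      by simp
  qed
  define Y where "Y \<omega> = lim (\<lambda>n. X (e n) \<omega>)" for \<omega>
  have [measurable]: "Y \<in> borel_measurable M"
    unfolding Y_def by measurable
  have Y: "AE \<omega> in M. (\<lambda>n. X (e n) \<omega>) \<longlonglongrightarrow> Y \<omega>"
    using conv by eventually_elim (simp add: Y_def convergent_LIMSEQ_iff)
  have L2: "(\<integral>\<^sup>+ \<omega>. ennreal ((cmod (X d \<omega> - Y \<omega>))\<^sup>2) \<partial>M) \<le> r d" if d: "0 < d" "d \<le> 1" for d
  proof -
    have "AE \<omega> in M. ennreal ((cmod (X d \<omega> - Y \<omega>))\<^sup>2) =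
        liminf (\<lambda>n. ennreal ((cmod (X d \<omega> - X (e n) \<omega>))\<^sup>2))"
      using Y
    proof eventually_elim
      case (elim \<omega>)
      show ?case
        by (rule lim_imp_Liminf[symmetric]) (auto intro!: tendsto_intros elim)
    qed
    then have "(\<integral>\<^sup>+ \<omega>. ennreal ((cmod (X d \<omega> - Y \<omega>))\<^sup>2) \<partial>M) =
        (\<integral>\<^sup>+ \<omega>. liminf (\<lambda>n. ennreal ((cmod (X d \<omega> - X (e n) \<omega>))\<^sup>2)) \<partial>M)"
      by (rule nn_integral_cong_AE)
    also have "\<dots> \<le> liminf (\<lambda>n. \<integral>\<^sup>+ \<omega>. ennreal ((cmod (X d \<omega> - X (e n) \<omega>))\<^sup>2) \<partial>M)"
      by (rule nn_integral_liminf) measurable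
    also have "\<dots> \<le> limsup (\<lambda>n. \<integral>\<^sup>+ \<omega>. ennreal ((cmod (X d \<omega> - X (e n) \<omega>))\<^sup>2) \<partial>M)"
      by (rule Liminf_le_Limsup) simp
    also have "\<dots> \<le> r d"
    proof (rule Limsup_bounded)
      have "\<forall>\<^sub>F n in sequentially. e n < d"
        using e0 d(1) by (rule order_tendstoD)
      then show "\<forall>\<^sub>F n in sequentially. (\<integral>\<^sup>+ \<omega>. ennreal ((cmod (X d \<omega> - X (e n) \<omega>))\<^sup>2) \<partial>M) \<le> r d"
      proof eventually_elim
        case (elim n)
        then have "(\<integral>\<^sup>+ \<omega>. ennreal ((cmod (X (e n) \<omega> - X d \<omega>))\<^sup>2) \<partial>M) \<le> r d"
          using e(1) d(2) by (intro cauchy) auto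
        then show ?case
          by (simp only: norm_minus_commute[of "X (e n) _"])
      qed
    qed
    finally show ?thesis .
  qed
  have "tendsto_in_measure M X Y (at_right 0)"
    unfolding tendsto_in_measure_def
  proof (intro allI impI)
    fix \<delta> :: real assume \<delta>: "0 < \<delta>"
    \<comment> \<open>Chebyshev's inequality; \<open>r d < 1\<close> ensures that
      \<open>enn2real\<close> loses nothing.\<close>
    have le: "measure M {\<omega> \<in> space M. dist (X d \<omega>) (Y \<omega>) > \<delta>} \<le> enn2real (r d) / \<delta>\<^sup>2"
      if d: "0 < d" "d \<le> 1" "r d < 1" for d
    proof -
      have "ennreal (\<delta>\<^sup>2) * emeasure M {\<omega> \<in> space M. dist (X d \<omega>) (Y \<omega>) > \<delta>} =
          (\<integral>\<^sup>+ \<omega>. ennreal (\<delta>\<^sup>2) * indicator {\<omega> \<in> space M. dist (X d \<omega>) (Y \<omega>) > \<delta>} \<omega> \<partial>M)"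
        by (rule nn_integral_cmult_indicator[symmetric]) measurable
      also have "\<dots> \<le> (\<integral>\<^sup>+ \<omega>. ennreal ((cmod (X d \<omega> - Y \<omega>))\<^sup>2) \<partial>M)"
        using \<delta> by (intro nn_integral_mono)
          (auto simp: dist_norm intro!: ennreal_leI power_mono split: split_indicator)
      also have "\<dots> \<le> r d"
        by (rule L2[OF d(1,2)])
      also have "\<dots> = ennreal (enn2real (r d))"
        using d(3) by (metis ennreal_enn2real ennreal_one_less_top less_trans)
      finally have "\<delta>\<^sup>2 * measure M {\<omega> \<in> space M. dist (X d \<omega>) (Y \<omega>) > \<delta>} \<le> enn2real (r d)"
        by (simp add: emeasure_eq_measure ennreal_mult[symmetric])
      then show ?thesis
        using \<delta> by (simp add: field_simps)
    qed
    have r': "((\<lambda>d. enn2real (r d) / \<delta>\<^sup>2) \<longlongrightarrow> 0 / \<delta>\<^sup>2) (at_right 0)"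
      using r \<delta> by (intro tendsto_intros) auto
    show "((\<lambda>d. measure M {\<omega> \<in> space M. dist (X d \<omega>) (Y \<omega>) > \<delta>}) \<longlongrightarrow> 0) (at_right 0)"
    proof (rule tendsto_sandwich[OF _ _ tendsto_const])
      have "\<forall>\<^sub>F d in at_right 0. r d < 1"
        using r by (rule order_tendstoD) simp
      moreover have "\<forall>\<^sub>F d in at_right (0::real). 0 < d \<and> d < 1"
        by (auto simp: eventually_at_right_field intro!: exI[of _ 1])
      ultimately show "\<forall>\<^sub>F d in at_right 0.
          measure M {\<omega> \<in> space M. dist (X d \<omega>) (Y \<omega>) > \<delta>} \<le> enn2real (r d) / \<delta>\<^sup>2"
        by eventually_elim (auto intro!: le)
      show "((\<lambda>d. enn2real (r d) / \<delta>\<^sup>2) \<longlongrightarrow> 0) (at_right 0)"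
        using r' by simp
    qed simp
  qed
  then show thesis
    using e e0 Y by (intro that[of Y e]) auto
qed

text \<open>Where \<open>Y\<close> and \<open>Z\<close> are more than \<open>2 * \<delta>\<close>
  apart, every \<open>X e\<close> is more than \<open>\<delta>\<close> away from one of them. This
  will identify the arbitrarily chosen \<open>poisson_integral\<close> with a constructed
  limit.\<close>

lemma (in prob_space) tendsto_in_measure_unique:
  assumes X [measurable]: "\<And>e. X e \<in> borel_measurable M"
    and [measurable]: "Y \<in> borel_measurable M" "Z \<in> borel_measurable M"
    and Y: "tendsto_in_measure M X Y F" and Z: "tendsto_in_measure M X Z F" and F: "F \<noteq> bot"
  shows "AE \<omega> in M. Y \<omega> = Z \<omega>"
proof -
  have zero: "prob {\<omega> \<in> space M. dist (Y \<omega>) (Z \<omega>) > 2 * \<delta>} = 0" if \<delta>: "0 < \<delta>" for \<delta>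
  proof -
    have le: "prob {\<omega> \<in> space M. dist (Y \<omega>) (Z \<omega>) > 2 * \<delta>} \<le>
        prob {\<omega> \<in> space M. dist (X e \<omega>) (Y \<omega>) > \<delta>} + prob {\<omega> \<in> space M. dist (X e \<omega>) (Z \<omega>) > \<delta>}" for e
    proof -
      have "prob {\<omega> \<in> space M. dist (Y \<omega>) (Z \<omega>) > 2 * \<delta>} \<le>
          prob ({\<omega> \<in> space M. dist (X e \<omega>) (Y \<omega>) > \<delta>} \<union> {\<omega> \<in> space M. dist (X e \<omega>) (Z \<omega>) > \<delta>})"
      proof (rule finite_measure_mono)
        have "dist (X e \<omega>) (Y \<omega>) > \<delta> \<or> dist (X e \<omega>) (Z \<omega>) > \<delta>" if "dist (Y \<omega>) (Z \<omega>) > 2 * \<delta>" for \<omega>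
          using that dist_triangle3[of "Y \<omega>" "Z \<omega>" "X e \<omega>"] by linarith
        then show "{\<omega> \<in> space M. dist (Y \<omega>) (Z \<omega>) > 2 * \<delta>} \<subseteq>
            {\<omega> \<in> space M. dist (X e \<omega>) (Y \<omega>) > \<delta>} \<union> {\<omega> \<in> space M. dist (X e \<omega>) (Z \<omega>) > \<delta>}"
          by blast
      qed measurable
      also have "\<dots> \<le> prob {\<omega> \<in> space M. dist (X e \<omega>) (Y \<omega>) > \<delta>} +
          prob {\<omega> \<in> space M. dist (X e \<omega>) (Z \<omega>) > \<delta>}"
        by (rule measure_Un_le) measurable
      finally show ?thesis .
    qed
    have "((\<lambda>e. prob {\<omega> \<in> space M. dist (X e \<omega>) (Y \<omega>) > \<delta>} +
        prob {\<omega> \<in> space M. dist (X e \<omega>) (Z \<omega>) > \<delta>}) \<longlongrightarrow> 0 + 0) F"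
      using Y Z \<delta> unfolding tendsto_in_measure_def by (intro tendsto_add) auto
    then have "prob {\<omega> \<in> space M. dist (Y \<omega>) (Z \<omega>) > 2 * \<delta>} \<le> 0 + 0"
      by (rule tendsto_lowerbound[OF _ _ F]) (simp add: le)
    then show ?thesis
      by (simp add: measure_le_0_iff)
  qed
  have close: "AE \<omega> in M. \<not> dist (Y \<omega>) (Z \<omega>) > 2 * \<delta>" if "0 < \<delta>" for \<delta>
    by (subst AE_iff_measurable[OF _ refl]) (auto simp: emeasure_eq_measure zero[OF that])
  have "AE \<omega> in M. \<not> dist (Y \<omega>) (Z \<omega>) > 2 * (1 / real (Suc n))" for n
    by (rule close) simp
  then have "AE \<omega> in M. \<forall>n. \<not> dist (Y \<omega>) (Z \<omega>) > 2 * (1 / real (Suc n))"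
    by (subst AE_all_countable) blast
  then show ?thesis
  proof eventually_elim
    case (elim \<omega>)
    have "(\<lambda>n. 2 * (1 / real (Suc n))) \<longlonglongrightarrow> 2 * 0"
      using LIMSEQ_inverse_real_of_nat by (intro tendsto_mult tendsto_const) (simp add: inverse_eq_divide)
    then have "dist (Y \<omega>) (Z \<omega>) \<le> 2 * 0"
      by (rule LIMSEQ_le_const) (use elim in \<open>auto simp: not_less\<close>)
    then show ?case
      by simp
  qed
qed

section \<open>Truncated integrals and their limit\<close>

context poisson_space
begin

text \<open>Finitely many points see only finitely many values of \<open>f\<close>, whether or not
  \<open>f\<close> is integrable for \<open>M\<close>. To avoid enumerating points: the parts of
  \<open>A\<close> where \<open>cmod (f x) > n\<close> decrease to the empty set, so their masses
  tend to 0, and being integers they are eventually 0. Hence \<open>f\<close> is bounded almost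
  everywhere on \<open>A\<close>.\<close>

lemma integrable_on_finite_mass:
  fixes f :: "'a \<Rightarrow> complex"
  assumes f: "f \<in> borel_measurable M" and A: "A \<in> sets M" and \<omega>: "\<omega> \<in> space P"
    and fin: "emeasure \<omega> A < \<infinity>"
  shows "integrable \<omega> (\<lambda>x. f x * indicator A x)"
proof -
  have sets [measurable_cong]: "sets \<omega> = sets M"
    using \<omega> by (simp add: space_P sets_configuration)
  note [measurable] = f A
  define B where "B n = {x \<in> space \<omega>. x \<in> A \<and> real n < cmod (f x)}" for n
  have B [measurable]: "B n \<in> sets \<omega>" for n
    unfolding B_def by measurable
  have "(\<lambda>n. emeasure \<omega> (B n)) \<longlonglongrightarrow> emeasure \<omega> (\<Inter>n. B n)"
  proof (rule Lim_emeasure_decseq)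
    show "decseq B"
      by (auto simp: decseq_def B_def)
    fix n
    have "emeasure \<omega> (B n) \<le> emeasure \<omega> A"
      using A by (intro emeasure_mono) (auto simp: B_def sets)
    then show "emeasure \<omega> (B n) \<noteq> \<infinity>"
      using fin by auto
  qed auto
  also have "(\<Inter>n. B n) = {}"
    by (auto simp: B_def) (metis less_asym reals_Archimedean2)
  finally have "(\<lambda>n. emeasure \<omega> (B n)) \<longlonglongrightarrow> 0"
    by simp
  then have "\<forall>\<^sub>F n in sequentially. emeasure \<omega> (B n) < 1"
    by (rule order_tendstoD) simp
  then obtain n where n: "emeasure \<omega> (B n) < 1"
    using eventually_happens'[OF sequentially_bot] by blast
  have "emeasure \<omega> (B n) = 0"
  proof -
    obtain k where k: "emeasure \<omega> (B n) = of_nat k"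
      using n emeasure_configuration_cases[of \<omega> M "B n"] \<omega> by (auto simp: space_P)
    then have "k = 0"
      using n by (metis less_one of_nat_1 of_nat_less_iff)
    then show ?thesis
      using k by simp
  qed
  then have "AE x in \<omega>. x \<notin> B n"
    by (intro AE_not_in) (auto simp: null_sets_def)
  then have "AE x in \<omega>. cmod (f x * indicator A x) \<le> norm (real n * indicator A x)"
    using AE_space by eventually_elim (auto simp: B_def norm_mult not_less split: split_indicator)
  moreover have "integrable \<omega> (\<lambda>x. real n * indicator A x)"
    using fin A by (intro integrable_mult_right integrable_real_indicator) (auto simp: sets)
  moreover have "(\<lambda>x. f x * indicator A x) \<in> borel_measurable \<omega>"
    by measurable
  ultimately show ?thesis
    by (rule_tac Bochner_Integration.integrable_bound)
qed

lemma integral_add_return_real: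
  fixes g :: "'a \<Rightarrow> real"
  assumes g: "g \<in> borel_measurable M" and \<omega>: "\<omega> \<in> space P" and x: "x \<in> space M"
    and int: "integrable \<omega> g"
  shows "integrable (add_measure \<omega> (return M x)) g"
    and "(\<integral>y. g y \<partial>add_measure \<omega> (return M x)) = (\<integral>y. g y \<partial>\<omega>) + g x"
proof -
  note [measurable] = g
  let ?\<omega> = "add_measure \<omega> (return M x)"
  have \<omega>': "?\<omega> \<in> space P"
    using \<omega> x by (simp add: space_P add_return_in_configurations)
  have nn: "(\<integral>\<^sup>+ y. ennreal (h y) \<partial>?\<omega>) = (\<integral>\<^sup>+ y. ennreal (h y) \<partial>\<omega>) + ennreal (h x)"
    if [measurable]: "h \<in> borel_measurable M" for h
    by (rule nn_integral_add_return[OF _ \<omega> x]) measurable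
  show int': "integrable ?\<omega> g"
    using int nn[of "\<lambda>y. norm (g y)"] measurable_configuration[OF \<omega>' g]
    by (simp add: integrable_iff_bounded)
  have fin: "(\<integral>\<^sup>+ y. ennreal (g y) \<partial>\<omega>) < \<infinity>" "(\<integral>\<^sup>+ y. ennreal (- g y) \<partial>\<omega>) < \<infinity>"
    using int by (auto simp: real_integrable_def less_top)
  have "enn2real (a + ennreal b) = enn2real a + max b 0" if "a < \<infinity>" for a b
    using that by (cases "b \<ge> 0") (auto simp: enn2real_plus max_def ennreal_neg)
  then show "(\<integral>y. g y \<partial>?\<omega>) = (\<integral>y. g y \<partial>\<omega>) + g x"
    using int int' fin by (simp add: real_lebesgue_integral_def nn max_def)
qed

lemma integral_add_return:
  fixes g :: "'a \<Rightarrow> complex"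
  assumes g: "g \<in> borel_measurable M" and \<omega>: "\<omega> \<in> space P" and x: "x \<in> space M"
    and int: "integrable \<omega> g"
  shows "(\<integral>y. g y \<partial>add_measure \<omega> (return M x)) = (\<integral>y. g y \<partial>\<omega>) + g x"
proof -
  note [measurable] = g
  note re = integral_add_return_real[OF _ \<omega> x integrable_Re[OF int]]
  note im = integral_add_return_real[OF _ \<omega> x integrable_Im[OF int]]
  have "integrable (add_measure \<omega> (return M x)) (\<lambda>y. of_real (Re (g y)) + \<i> * of_real (Im (g y)))"
    by (intro Bochner_Integration.integrable_add integrable_mult_right integrable_of_real re(1) im(1)) measurable
  then have "integrable (add_measure \<omega> (return M x)) g"
    by (simp flip: complex_eq)
  then show ?thesis
    using re(2) im(2) int by (simp add: complex_eq_iff)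
qed

lemma compensated_integral_measurable [measurable]:
  assumes [measurable]: "f \<in> borel_measurable M"
  shows "compensated_integral M f e \<in> borel_measurable P"
  unfolding compensated_integral_def[abs_def] by measurable

text \<open>Markov's inequality for \<open>min ((cmod (f x))^2) 1\<close>, with threshold
  \<open>min (e^2) 1\<close> so that \<open>e > 1\<close> is covered as well.\<close>

lemma L_chi_level_set:
  assumes f: "f \<in> L_chi M" and e: "0 < e"
  shows "{x \<in> space M. e < cmod (f x)} \<in> fmeasurable M"
proof (rule fmeasurableI)
  have [measurable]: "f \<in> borel_measurable M"
    using f by (simp add: L_chi_def)
  show "{x \<in> space M. e < cmod (f x)} \<in> sets M"
    by measurable
  have "ennreal (min (e\<^sup>2) 1) * emeasure M {x \<in> space M. e < cmod (f x)} =
      (\<integral>\<^sup>+ x. ennreal (min (e\<^sup>2) 1) * indicator {x \<in> space M. e < cmod (f x)} x \<partial>M)"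
    by (rule nn_integral_cmult_indicator[symmetric]) measurable
  also have "\<dots> \<le> (\<integral>\<^sup>+ x. ennreal (min ((cmod (f x))\<^sup>2) 1) \<partial>M)"
  proof (rule nn_integral_mono)
    fix x
    have "min (e\<^sup>2) 1 \<le> min ((cmod (f x))\<^sup>2) 1" if "e < cmod (f x)"
      using e that by (intro min.mono power_mono) auto
    then show "ennreal (min (e\<^sup>2) 1) * indicator {x \<in> space M. e < cmod (f x)} x \<le>
        ennreal (min ((cmod (f x))\<^sup>2) 1)"
      by (simp add: ennreal_leI split: split_indicator)
  qed
  also have "\<dots> < \<infinity>"
    using f by (simp add: L_chi_def)
  finally show "emeasure M {x \<in> space M. e < cmod (f x)} < \<infinity>"
    using zero_less_power[OF e, of 2] by (auto simp: ennreal_mult_less_top min_def split: if_splits)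
qed

lemma AE_integrable_truncated:
  assumes f: "f \<in> L_chi M" and e: "0 < e"
  shows "AE \<omega> in P. integrable \<omega> (\<lambda>x. f x * indicator {x. e < cmod (f x)} x)"
  using AE_emeasure_finite[OF L_chi_level_set[OF assms]] AE_space
proof eventually_elim
  case (elim \<omega>)
  have [measurable]: "f \<in> borel_measurable M"
    using f by (simp add: L_chi_def)
  have "integrable \<omega> (\<lambda>x. f x * indicator {x \<in> space M. e < cmod (f x)} x)"
    using elim by (intro integrable_on_finite_mass) auto
  also have "?this \<longleftrightarrow> integrable \<omega> (\<lambda>x. f x * indicator {x. e < cmod (f x)} x)"
    using elim by (intro Bochner_Integration.integrable_cong refl)
      (auto simp: space_P space_configuration split: split_indicator)
  finally show ?case .
qed

text \<open>The compensating integral over \<open>M\<close> does not depend on the configuration and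
  cancels; only the truncated value at the new point remains.\<close>

lemma AE_compensated_integral_add_return:
  assumes f: "f \<in> L_chi M" and e: "0 < e"
  shows "AE \<omega> in P. \<forall>x\<in>space M. compensated_integral M f e (add_measure \<omega> (return M x)) =
    compensated_integral M f e \<omega> + f x * indicator {x. e < cmod (f x)} x"
  using AE_integrable_truncated[OF assms] AE_space
proof eventually_elim
  case (elim \<omega>)
  have [measurable]: "f \<in> borel_measurable M"
    using f by (simp add: L_chi_def)
  show ?case
    unfolding compensated_integral_def using elim by (auto simp: integral_add_return)
qed

text \<open>The difference of the two truncations is the centred integral of \<open>h\<close>, the
  part of \<open>f\<close> with \<open>d < cmod (f x) \<le> e\<close>. Because
  \<open>e \<le> 1\<close>, the cutoff \<open>cmod (f x) \<le> 1\<close> in the compensator leaves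
  \<open>h\<close> untouched, so the second-moment bound applies directly.\<close>

lemma compensated_integral_Cauchy:
  assumes f: "f \<in> L_chi M" and de: "0 < d" "d \<le> e" "e \<le> 1"
  shows "(\<integral>\<^sup>+ \<omega>. ennreal ((cmod (compensated_integral M f d \<omega> - compensated_integral M f e \<omega>))\<^sup>2) \<partial>P) \<le>
    2 * (\<integral>\<^sup>+ x. ennreal ((cmod (f x))\<^sup>2 * indicator {x. cmod (f x) \<le> e} x) \<partial>M)"
proof -
  have [measurable]: "f \<in> borel_measurable M"
    using f by (simp add: L_chi_def)
  define t where "t c x = f x * indicator {x. c < cmod (f x)} x" for c x
  define h where "h x = t d x - t e x" for x
  have [measurable]: "t c \<in> borel_measurable M" "h \<in> borel_measurable M" for c
    unfolding h_def t_def by measurable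
  let ?A = "{x \<in> space M. d < cmod (f x)}"
  have A: "?A \<in> fmeasurable M"
    by (rule L_chi_level_set[OF f de(1)])
  have iA: "integrable M (\<lambda>x. indicator ?A x :: real)"
    using A by (intro integrable_real_indicator) (auto simp: fmeasurable_def)
  \<comment> \<open>Everything bounded by 1 that lives on the level set, which has finite measure,
    is integrable.\<close>
  have int: "integrable M (\<lambda>x. u x)"
    if [measurable]: "u \<in> borel_measurable M" and "\<And>x. x \<in> space M \<Longrightarrow> norm (u x) \<le> indicator ?A x"
    for u :: "'a \<Rightarrow> 'c :: {banach, second_countable_topology}"
    using iA by (rule Bochner_Integration.integrable_bound) (auto intro!: AE_I2 that)
  have h: "integrable M h" "integrable M (\<lambda>x. (cmod (h x))\<^sup>2)"
    using de by (auto intro!: int power_le_one simp: h_def t_def split: split_indicator)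
  have c: "integrable M (\<lambda>x. f x * indicator {x. cmod (f x) \<le> 1} x * indicator {x. c < cmod (f x)} x)"
    if "d \<le> c" for c
    using that by (auto intro!: int simp: norm_mult split: split_indicator)
  have "AE \<omega> in P. compensated_integral M f d \<omega> - compensated_integral M f e \<omega> =
      (\<integral>x. h x \<partial>\<omega>) - (\<integral>x. h x \<partial>M)"
    using AE_integrable_truncated[OF f de(1)] AE_integrable_truncated[OF f less_le_trans[OF de(1,2)]]
  proof eventually_elim
    case (elim \<omega>)
    have "(\<integral>x. h x \<partial>\<omega>) = (\<integral>x. t d x \<partial>\<omega>) - (\<integral>x. t e x \<partial>\<omega>)"
      unfolding h_def using elim unfolding t_def by (rule Bochner_Integration.integral_diff)
    moreover have "(\<integral>x. h x \<partial>M) =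
        (\<integral>x. f x * indicator {x. cmod (f x) \<le> 1} x * indicator {x. d < cmod (f x)} x \<partial>M) -
        (\<integral>x. f x * indicator {x. cmod (f x) \<le> 1} x * indicator {x. e < cmod (f x)} x \<partial>M)"
    proof (subst Bochner_Integration.integral_diff[symmetric])
      show "(\<integral>x. h x \<partial>M) = (\<integral>x. f x * indicator {x. cmod (f x) \<le> 1} x * indicator {x. d < cmod (f x)} x -
        f x * indicator {x. cmod (f x) \<le> 1} x * indicator {x. e < cmod (f x)} x \<partial>M)"
        using de by (intro Bochner_Integration.integral_cong)
          (auto simp: h_def t_def split: split_indicator)
    qed (use c de in auto)
    ultimately show ?case
      by (simp add: compensated_integral_def t_def)
  qed
  then have "(\<integral>\<^sup>+ \<omega>. ennreal ((cmod (compensated_integral M f d \<omega> - compensated_integral M f e \<omega>))\<^sup>2) \<partial>P) =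
      (\<integral>\<^sup>+ \<omega>. ennreal ((cmod ((\<integral>x. h x \<partial>\<omega>) - (\<integral>x. h x \<partial>M)))\<^sup>2) \<partial>P)"
    by (intro nn_integral_cong_AE) auto
  also have "\<dots> \<le> 2 * (\<integral>\<^sup>+ x. ennreal ((cmod (h x))\<^sup>2) \<partial>M)"
    by (rule variance_complex[OF h])
  also have "\<dots> \<le> 2 * (\<integral>\<^sup>+ x. ennreal ((cmod (f x))\<^sup>2 * indicator {x. cmod (f x) \<le> e} x) \<partial>M)"
    using de by (intro mult_left_mono nn_integral_mono)
      (auto intro!: ennreal_leI simp: h_def t_def split: split_indicator)
  finally show ?thesis .
qed

text \<open>Dominated convergence, with the integrand that defines \<open>L_chi\<close> as majorant.
  The cap \<open>min e 1\<close> makes the domination hold for every \<open>e\<close>, not only for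
  small ones; where \<open>f x \<noteq> 0\<close> the integrand is eventually 0.\<close>

lemma L_chi_small_part_tendsto:
  assumes f: "f \<in> L_chi M"
  shows "((\<lambda>e. 2 * (\<integral>\<^sup>+ x. ennreal ((cmod (f x))\<^sup>2 * indicator {x. cmod (f x) \<le> min e 1} x) \<partial>M))
    \<longlongrightarrow> 0) (at_right 0)"
proof -
  have [measurable]: "f \<in> borel_measurable M"
    using f by (simp add: L_chi_def)
  have "(\<lambda>n. \<integral>\<^sup>+ x. ennreal ((cmod (f x))\<^sup>2 * indicator {x. cmod (f x) \<le> min (X n) 1} x) \<partial>M)
      \<longlonglongrightarrow> (\<integral>\<^sup>+ x. 0 \<partial>M)" if X: "X \<longlonglongrightarrow> 0" "\<And>n. 0 < X n" for X :: "nat \<Rightarrow> real"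
  proof (rule nn_integral_dominated_convergence[where w="\<lambda>x. ennreal (min ((cmod (f x))\<^sup>2) 1)"])
    show "(\<integral>\<^sup>+ x. ennreal (min ((cmod (f x))\<^sup>2) 1) \<partial>M) < \<infinity>"
      using f by (simp add: L_chi_def)
    show "AE x in M. (\<lambda>n. ennreal ((cmod (f x))\<^sup>2 * indicator {x. cmod (f x) \<le> min (X n) 1} x)) \<longlonglongrightarrow> 0"
    proof (rule AE_I2)
      fix x
      show "(\<lambda>n. ennreal ((cmod (f x))\<^sup>2 * indicator {x. cmod (f x) \<le> min (X n) 1} x)) \<longlonglongrightarrow> 0"
      proof (cases "f x = 0")
        case False
        then have "\<forall>\<^sub>F n in sequentially. X n < cmod (f x)"
          using X(1) by (intro order_tendstoD) auto
        then show ?thesis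
        proof (intro tendsto_eventually, eventually_elim)
          case (elim n)
          then show ?case
            by (simp split: split_indicator)
        qed
      qed simp
    qed
    show "AE x in M. ennreal ((cmod (f x))\<^sup>2 * indicator {x. cmod (f x) \<le> min (X n) 1} x) \<le>
        ennreal (min ((cmod (f x))\<^sup>2) 1)" for n
      by (auto intro!: AE_I2 ennreal_leI power_le_one split: split_indicator)
  qed measurable
  then have "((\<lambda>e. \<integral>\<^sup>+ x. ennreal ((cmod (f x))\<^sup>2 * indicator {x. cmod (f x) \<le> min e 1} x) \<partial>M) \<longlongrightarrow> 0)
      (at_right 0)"
    by (subst tendsto_at_iff_sequentially) (auto simp: comp_def)
  then have "((\<lambda>e. 2 * (\<integral>\<^sup>+ x. ennreal ((cmod (f x))\<^sup>2 * indicator {x. cmod (f x) \<le> min e 1} x) \<partial>M))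
    \<longlongrightarrow> 2 * 0) (at_right 0)"
    by (rule ennreal_tendsto_cmult[rotated]) simp
  then show ?thesis
    by simp
qed

text \<open>Existence of a limit justifies the choice in \<open>poisson_integral\<close>, and
  uniqueness of limits in measure identifies the chosen version with \<open>Y\<close>. The sequence
  \<open>e\<close> is kept because the difference of \<open>Y\<close> will be computed
  pointwise.\<close>

lemma poisson_integral_limit:
  assumes f: "f \<in> L_chi M"
  obtains Y e where "Y \<in> borel_measurable P" "\<And>n. 0 < e n" "e \<longlonglongrightarrow> 0"
    "AE \<omega> in P. (\<lambda>n. compensated_integral M f (e n) \<omega>) \<longlonglongrightarrow> Y \<omega>"
    "AE \<omega> in completion P. poisson_integral M P f \<omega> = Y \<omega>"
proof -
  have [measurable]: "f \<in> borel_measurable M"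
    using f by (simp add: L_chi_def)
  obtain Y e where Y [measurable]: "Y \<in> borel_measurable P"
    and lim: "tendsto_in_measure P (compensated_integral M f) Y (at_right 0)"
    and e: "\<And>n. 0 < e n" "e \<longlonglongrightarrow> 0" "AE \<omega> in P. (\<lambda>n. compensated_integral M f (e n) \<omega>) \<longlonglongrightarrow> Y \<omega>"
  proof (rule P.L2_Cauchy_limit[of "compensated_integral M f"])
    show "((\<lambda>e. 2 * (\<integral>\<^sup>+ x. ennreal ((cmod (f x))\<^sup>2 * indicator {x. cmod (f x) \<le> min e 1} x) \<partial>M))
        \<longlongrightarrow> 0) (at_right 0)"
      by (rule L_chi_small_part_tendsto[OF f])
    show "(\<integral>\<^sup>+ \<omega>. ennreal ((cmod (compensated_integral M f d \<omega> - compensated_integral M f e \<omega>))\<^sup>2) \<partial>P) \<le>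
        2 * (\<integral>\<^sup>+ x. ennreal ((cmod (f x))\<^sup>2 * indicator {x. cmod (f x) \<le> min e 1} x) \<partial>M)"
      if "0 < d" "d \<le> e" "e \<le> 1" for d e
      using compensated_integral_Cauchy[OF f that] that by (simp add: min_absorb1)
  qed auto
  have c: "prob_space (completion P)"
    by (intro prob_spaceI) (simp add: P.emeasure_space_1)
  have "measure (completion P) {\<omega> \<in> space (completion P). dist (compensated_integral M f e \<omega>) (Y \<omega>) > \<delta>} =
      measure P {\<omega> \<in> space P. dist (compensated_integral M f e \<omega>) (Y \<omega>) > \<delta>}" for e \<delta>
    by simp
  then have "tendsto_in_measure (completion P) (compensated_integral M f) Y (at_right 0)"
    using lim unfolding tendsto_in_measure_def by presburger
  then have Yc: "Y \<in> borel_measurable (completion P) \<and>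
      tendsto_in_measure (completion P) (compensated_integral M f) Y (at_right 0)"
    using measurable_completion[OF Y] by simp
  then have I: "poisson_integral M P f \<in> borel_measurable (completion P) \<and>
      tendsto_in_measure (completion P) (compensated_integral M f) (poisson_integral M P f) (at_right 0)"
    unfolding poisson_integral_def by (rule someI[where x=Y and P="\<lambda>Y. Y \<in> borel_measurable (completion P) \<and>
      tendsto_in_measure (completion P) (compensated_integral M f) Y (at_right 0)"])
  have "AE \<omega> in completion P. poisson_integral M P f \<omega> = Y \<omega>"
  proof (rule prob_space.tendsto_in_measure_unique[OF c])
    show "compensated_integral M f e \<in> borel_measurable (completion P)" for e
      by (rule measurable_completion) measurable
    show "at_right (0 :: real) \<noteq> bot"
      by simp
  qed (use I Yc in auto)
  then show thesis
    using Y e by (intro that[of Y e])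
qed

end

section \<open>The characterization of stochastic integrals\<close>

lemma iso_real_line_sigma_finite:
  assumes "iso_real_line M"
  shows "sigma_finite_measure M"
proof -
  obtain \<phi> :: "'a \<Rightarrow> real" where \<phi> [measurable]: "\<phi> \<in> measurable M lborel" and d: "distr M lborel \<phi> = lborel"
    using assms by (auto simp: iso_real_line_def)
  define A where "A n = \<phi> -` {- real n..real n} \<inter> space M" for n
  have [measurable]: "A n \<in> sets M" for n
    unfolding A_def by measurable
  have fin: "emeasure M (A n) \<noteq> \<infinity>" for n
  proof -
    have "emeasure M (A n) = emeasure (distr M lborel \<phi>) {- real n..real n}"
      unfolding A_def by (rule emeasure_distr[OF \<phi>, symmetric]) simp
    then show ?thesis
      by (simp add: d)
  qed
  have "x \<in> (\<Union>n. A n)" if "x \<in> space M" for x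
  proof -
    obtain n where "\<bar>\<phi> x\<bar> \<le> real n"
      using real_arch_simple by blast
    then show ?thesis
      using that by (auto simp: A_def abs_le_iff intro!: exI[of _ n])
  qed
  then have "(\<Union>n. A n) = space M"
    by (auto simp: A_def)
  then show ?thesis
    using fin by (intro sigma_finite_measure.intro exI[of _ "range A"]) auto
qed

lemma completion_ex_borel_measurable_complex:
  fixes F :: "'b \<Rightarrow> complex"
  assumes F: "F \<in> borel_measurable (completion N)"
  obtains F' where "F' \<in> borel_measurable N" "AE x in N. F x = F' x"
proof -
  have "(\<lambda>x. Re (F x)) \<in> borel_measurable (completion N)" "(\<lambda>x. Im (F x)) \<in> borel_measurable (completion N)"
    using F by measurable
  from this[THEN completion_ex_borel_measurable_real]
  obtain a b where [measurable]: "a \<in> borel_measurable N" "b \<in> borel_measurable N"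
    and ab: "AE x in N. Re (F x) = a x" "AE x in N. Im (F x) = b x"
    by blast
  have "AE x in N. F x = complex_of_real (a x) + \<i> * complex_of_real (b x)"
    using ab by eventually_elim (simp add: complex_eq_iff)
  then show thesis
    by (intro that[of "\<lambda>x. complex_of_real (a x) + \<i> * complex_of_real (b x)"]) measurable
qed

section \<open>Transfer to the completed law\<close>

context poisson_space
begin

sublocale completion_P: prob_space "completion P"
  by (intro prob_spaceI) (simp add: P.emeasure_space_1)

sublocale MPc: pair_sigma_finite M "completion P"
  by standard

text \<open>Convergence along \<open>e\<close> holds almost surely at \<open>\<omega>\<close> and,
  for almost every \<open>x\<close>, also after the insertion of \<open>x\<close>. Passing to the
  limit in the difference of the truncated integrals replaces
  \<open>f x * indicator {x. e n < cmod (f x)} x\<close> by \<open>f x\<close>.\<close>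

lemma poisson_integral_version:
  assumes f: "f \<in> L_chi M"
  obtains Y where "Y \<in> borel_measurable P"
    "AE \<omega> in P. poisson_integral M P f \<omega> = Y \<omega>"
    "AE x in M. AE \<omega> in P. Y (add_measure \<omega> (return M x)) = Y \<omega> + f x"
proof -
  obtain Y e where Y: "Y \<in> borel_measurable P" and e: "\<And>n. 0 < e n" "e \<longlonglongrightarrow> 0"
    and lim: "AE \<omega> in P. (\<lambda>n. compensated_integral M f (e n) \<omega>) \<longlonglongrightarrow> Y \<omega>"
    and I: "AE \<omega> in completion P. poisson_integral M P f \<omega> = Y \<omega>"
    using poisson_integral_limit[OF f] by blast
  have step: "AE \<omega> in P. \<forall>n. \<forall>x\<in>space M. compensated_integral M f (e n) (add_measure \<omega> (return M x)) =
      compensated_integral M f (e n) \<omega> + f x * indicator {x. e n < cmod (f x)} x"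
    using AE_compensated_integral_add_return[OF f e(1)] by (subst AE_all_countable) blast
  have "AE x in M. AE \<omega> in P. Y (add_measure \<omega> (return M x)) = Y \<omega> + f x"
    using AE_add_return[OF lim] AE_space
  proof eventually_elim
    case (elim x)
    have ind: "(\<lambda>n. f x * indicator {x. e n < cmod (f x)} x) \<longlonglongrightarrow> f x"
    proof (cases "f x = 0")
      case False
      then have "\<forall>\<^sub>F n in sequentially. e n < cmod (f x)"
        using e(2) by (intro order_tendstoD) auto
      then show ?thesis
      proof (intro tendsto_eventually, eventually_elim)
        case (elim n)
        then show ?case
          by simp
      qed
    qed simp
    show ?case
      using elim(1) lim step
    proof eventually_elim
      case (elim \<omega>)
      have "(\<lambda>n. compensated_integral M f (e n) (add_measure \<omega> (return M x))) \<longlonglongrightarrow> Y \<omega> + f x"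
        using tendsto_add[OF elim(2) ind] elim(3) \<open>x \<in> space M\<close> by simp
      then show ?case
        using elim(1) by (intro LIMSEQ_unique)
    qed
  qed
  moreover have "AE \<omega> in P. poisson_integral M P f \<omega> = Y \<omega>"
    using I by (simp add: AE_completion_iff)
  ultimately show thesis
    using Y by (intro that)
qed

text \<open>Almost every section of a null set is null. Replacing \<open>F\<close> by
  \<open>F'\<close> also after the insertion is legitimate because, for almost every
  \<open>x\<close>, inserting \<open>x\<close> leads into a given null set with probability
  0.\<close>

lemma AE_difference_iterated:
  assumes "AE (x, \<omega>) in M \<Otimes>\<^sub>M completion P. difference_op M F x \<omega> = f x"
    and F': "AE \<omega> in P. F \<omega> = F' \<omega>"
  shows "AE x in M. AE \<omega> in P. F' (add_measure \<omega> (return M x)) = F' \<omega> + f x"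
proof -
  have "AE x in M. AE \<omega> in completion P. difference_op M F x \<omega> = f x"
    using MPc.AE_pair[OF assms(1)] by simp
  then show ?thesis
    using AE_add_return[OF F']
  proof eventually_elim
    case (elim x)
    have "AE \<omega> in P. difference_op M F x \<omega> = f x"
      using elim(1) by (simp add: AE_completion_iff)
    then show ?case
      using elim(2) F' by eventually_elim (simp add: difference_op_def algebra_simps)
  qed
qed

text \<open>Returning from sections to the product requires a measurable set of good pairs, which
  \<open>F\<close> itself does not supply. The set is formed with \<open>F'\<close> and with a
  measurable null set \<open>N\<close> containing all configurations where \<open>F\<close> and
  \<open>F'\<close> differ; \<open>N\<close> has to be avoided both before and after the
  insertion.\<close>

lemma AE_difference_pair:
  assumes [measurable]: "F' \<in> borel_measurable P" "f \<in> borel_measurable M"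
    and F': "AE \<omega> in P. F \<omega> = F' \<omega>"
    and diff: "AE x in M. AE \<omega> in P. F' (add_measure \<omega> (return M x)) = F' \<omega> + f x"
  shows "AE (x, \<omega>) in M \<Otimes>\<^sub>M completion P. difference_op M F x \<omega> = f x"
proof -
  obtain N where N [measurable]: "N \<in> sets P" and N0: "N \<in> null_sets P"
    and sub: "{\<omega> \<in> space P. F \<omega> \<noteq> F' \<omega>} \<subseteq> N"
    using F' by (auto simp: eventually_ae_filter)
  \<comment> \<open>Completion only adds measurable sets, so the second projection may be regarded
    as a map into the uncompleted space.\<close>
  have [measurable]: "snd \<in> measurable (M \<Otimes>\<^sub>M completion P) P"
    using measurable_compose[OF measurable_snd measurable_completion[OF measurable_ident]] by simp
  have "AE z in M \<Otimes>\<^sub>M completion P.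
      F' (add_measure (snd z) (return M (fst z))) = F' (snd z) + f (fst z) \<and>
      snd z \<notin> N \<and> add_measure (snd z) (return M (fst z)) \<notin> N"
  proof (rule MPc.AE_pair_measure)
    have notN: "AE \<omega> in P. \<omega> \<notin> N"
      by (rule AE_not_in[OF N0])
    show "AE x in M. AE \<omega> in completion P.
        F' (add_measure (snd (x, \<omega>)) (return M (fst (x, \<omega>)))) = F' (snd (x, \<omega>)) + f (fst (x, \<omega>)) \<and>
        snd (x, \<omega>) \<notin> N \<and> add_measure (snd (x, \<omega>)) (return M (fst (x, \<omega>))) \<notin> N"
      using diff AE_add_return[OF notN]
    proof eventually_elim
      case (elim x)
      then show ?case
        using notN unfolding AE_completion_iff by eventually_elim simp
    qed
  qed measurable
  then show ?thesis
    using AE_space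
  proof eventually_elim
    case (elim z)
    obtain x \<omega> where z: "z = (x, \<omega>)" "x \<in> space M" "\<omega> \<in> space P"
      using elim(2) by (auto simp: space_pair_measure)
    have "add_measure \<omega> (return M x) \<in> space P"
      using z by (simp add: space_P add_return_in_configurations)
    then have "F \<omega> = F' \<omega>" "F (add_measure \<omega> (return M x)) = F' (add_measure \<omega> (return M x))"
      using elim(1) sub z by auto
    then show ?case
      using elim(1) by (simp add: z difference_op_def)
  qed
qed

lemma stochastic_integral_of_difference:
  assumes F: "F \<in> borel_measurable (completion P)" and f: "f \<in> borel_measurable M"
    and diff: "AE (x, \<omega>) in M \<Otimes>\<^sub>M completion P. difference_op M F x \<omega> = f x"
  shows "f \<in> L_chi M" "\<exists>c. AE \<omega> in completion P. F \<omega> = poisson_integral M P f \<omega> + c"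
proof -
  obtain F' where F' [measurable]: "F' \<in> borel_measurable P" and eq: "AE \<omega> in P. F \<omega> = F' \<omega>"
    using completion_ex_borel_measurable_complex[OF F] .
  have DF: "AE x in M. AE \<omega> in P. F' (add_measure \<omega> (return M x)) = F' \<omega> + f x"
    by (rule AE_difference_iterated[OF diff eq])
  \<comment> \<open>Membership in \<open>L_chi\<close> precedes the comparison, since it provides
    the version \<open>Y\<close> of the integral whose difference is \<open>f\<close>.\<close>
  show chi: "f \<in> L_chi M"
    by (rule difference_in_L_chi[OF F' f DF])
  obtain Y where Y [measurable]: "Y \<in> borel_measurable P"
    and I: "AE \<omega> in P. poisson_integral M P f \<omega> = Y \<omega>"
    and DY: "AE x in M. AE \<omega> in P. Y (add_measure \<omega> (return M x)) = Y \<omega> + f x"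
    using poisson_integral_version[OF chi] .
  have "AE x in M. AE \<omega> in P. F' (add_measure \<omega> (return M x)) - Y (add_measure \<omega> (return M x)) = F' \<omega> - Y \<omega>"
    using DF DY
  proof eventually_elim
    case (elim x)
    then show ?case
      by eventually_elim simp
  qed
  then obtain c where "AE \<omega> in P. F' \<omega> - Y \<omega> = c"
    by (rule invariant_AE_const[rotated]) measurable
  then have "AE \<omega> in P. F \<omega> = poisson_integral M P f \<omega> + c"
    using eq I by eventually_elim (simp add: algebra_simps)
  then show "\<exists>c. AE \<omega> in completion P. F \<omega> = poisson_integral M P f \<omega> + c"
    by (auto simp: AE_completion_iff)
qed

lemma difference_of_stochastic_integral:
  assumes f: "f \<in> L_chi M" and F: "AE \<omega> in completion P. F \<omega> = poisson_integral M P f \<omega> + c"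
  shows "AE (x, \<omega>) in M \<Otimes>\<^sub>M completion P. difference_op M F x \<omega> = f x"
proof -
  obtain Y where Y [measurable]: "Y \<in> borel_measurable P"
    and I: "AE \<omega> in P. poisson_integral M P f \<omega> = Y \<omega>"
    and DY: "AE x in M. AE \<omega> in P. Y (add_measure \<omega> (return M x)) = Y \<omega> + f x"
    using poisson_integral_version[OF f] .
  show ?thesis
  proof (rule AE_difference_pair)
    show "(\<lambda>\<omega>. Y \<omega> + c) \<in> borel_measurable P"
      by measurable
    show "f \<in> borel_measurable M"
      using f by (simp add: L_chi_def)
    show "AE \<omega> in P. F \<omega> = Y \<omega> + c"
      using F[unfolded AE_completion_iff] I by eventually_elim simp
    show "AE x in M. AE \<omega> in P. Y (add_measure \<omega> (return M x)) + c = Y \<omega> + c + f x"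
      using DY
    proof eventually_elim
      case (elim x)
      then show ?case
        by eventually_elim simp
    qed
  qed
qed

end

theorem theorem15:
  fixes M :: "'a measure" and P :: "'a measure measure" and F :: "'a measure \<Rightarrow> complex"
  assumes "iso_real_line M"
    and "poisson_measure M P"
    and "F \<in> borel_measurable (completion P)"
  shows "(stochastic_integral M P F \<longleftrightarrow>
            (\<exists>f\<in>borel_measurable M.
               AE (x, \<omega>) in M \<Otimes>\<^sub>M completion P. difference_op M F x \<omega> = f x)) \<and>
         (\<forall>f\<in>borel_measurable M.
            (AE (x, \<omega>) in M \<Otimes>\<^sub>M completion P. difference_op M F x \<omega> = f x) \<longrightarrow>
              f \<in> L_chi M \<and>
              (\<exists>c. AE \<omega> in completion P. F \<omega> = poisson_integral M P f \<omega> + c))"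
proof -
  interpret poisson_space M P
    using iso_real_line_sigma_finite[OF assms(1)] assms(2)
    by (simp add: poisson_space_def poisson_space_axioms_def)
  note converse = stochastic_integral_of_difference[OF assms(3)]
  have "\<exists>f\<in>borel_measurable M. AE (x, \<omega>) in M \<Otimes>\<^sub>M completion P. difference_op M F x \<omega> = f x"
    if F: "stochastic_integral M P F"
  proof -
    obtain f c where f: "f \<in> L_chi M" and c: "AE \<omega> in completion P. F \<omega> = poisson_integral M P f \<omega> + c"
      using F by (auto simp: stochastic_integral_def)
    have "f \<in> borel_measurable M"
      using f by (simp add: L_chi_def)
    then show ?thesis
      using difference_of_stochastic_integral[OF f c] by blast
  qed
  moreover have "stochastic_integral M P F"
    if "f \<in> borel_measurable M" "AE (x, \<omega>) in M \<Otimes>\<^sub>M completion P. difference_op M F x \<omega> = f x" for f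
    using assms(3) converse[OF that] by (auto simp: stochastic_integral_def)
  ultimately show ?thesis
    using converse by blast
qed

end
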